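(* Assume that $V_h^{n-1}\subset V_h^n$ for $n=1,\dots,N$. Let $Z=(Z_1,Z_2)\in\mathcal U_{hk}$ be the solution of the discrete dual problem $$B^*(V,Z)=L^*(V)\qquad\forall\,V\in\mathcal V_{hk},$$ with sufficiently smooth data $z_1^T,z_2^T,j_1,j_2$ and with $Z_i(T)=\mathcal P_hz_i^T$, $i=1,2$. Then, for $l\in\mathbb R$ and $n=0,1,\dots,N-1$, with $\tilde\kappa=1-\kappa$, $$\begin{aligned} \|Z_1(t_n)\|_{h,l}^2&+\tilde\kappa\|Z_2(t_n)\|_{h,l+1}^2+2\int_{t_n}^T\!\int_t^T\xi(s-t)\,a\big(A_h^l\dot Z_2(t),\dot Z_2(s)\big)\,ds\,dt\\ &=\|Z_1(T)\|_{h,l}^2+(1+\kappa)\|Z_2(T)\|_{h,l+1}^2\\ &\quad+2\int_{t_n}^T(A_h^lZ_1,\mathcal P_k\mathcal P_hj_1)\,dt+2\int_{t_n}^T(A_h^{l+1}Z_2,\mathcal P_k\mathcal P_hj_2)\,dt\\ &\quad-2\int_{t_n}^T\!\int_t^T\mathcal K(s-t)\,a\big(A_h^l\mathcal P_k\mathcal P_hj_2,Z_2(s)\big)\,ds\,dt\\ &\quad-2\int_{t_n}^T\mathcal K(T-t)\,a\big(A_h^lZ_2(t),Z_2(T)\big)\,dt-2\xi(T-t_n)\,a\big(A_h^lZ_2(t_n),Z_2(T)\big). \end{aligned}$$ Moreover, for some constant $C=C(\kappa)$, $$\|Z_1(t_n)\|_{h,l}+\|Z_2(t_n)\|_{h,l+1}\le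 C\Big\{\|Z_1(T)\|_{h,l}+\|Z_2(T)\|_{h,l+1}+\int_{t_n}^T\big(\|\mathcal P_hj_1\|_{h,l}+\|\mathcal P_hj_2\|_{h,l+1}\big)\,dt\Big\}.$$
   Context: Let $T>0$, and let $\Omega\subset\mathbb R^d$ be a convex polygonal domain. Write $H=L_2(\Omega)^d$ with norm $\|\cdot\|$ and inner product $(\cdot,\cdot)$, and $V=H_0^1(\Omega)^d$. $A$ is a self-adjoint, positive definite, uniformly elliptic second order operator on $H$ with $\mathcal D(A)=H^2(\Omega)^d\cap V$, and $a(u,v)=(Au,v)$, extended to $V\times V$. The kernel satisfies $\mathcal K\ge0$, $\dot{\mathcal K}\le0$, $\|\mathcal K\|_{L_1(\mathbb R^+)}=\kappa<1$, and $\xi(t)=\int_t^\infty\mathcal K(s)\,ds=\kappa-\int_0^t\mathcal K(s)\,ds$. Discretization. $0=t_0<t_1<\dots<t_N=T$, $I_n=(t_{n-1},t_n)$. To each $t_n$ is associated a triangulation $\mathcal T_h^n$ of $\Omega$ and the space $V_h^n\subset V$ of continuous piecewise linear functions on $\mathcal T_h^n$ vanishing on $\partial\Omega$. $\bar V_h^n$ is the analogous space on the triangulation composed of the union of the meshes $\mathcal T_h^{n-1}$ and $\mathcal T_h^n$; if $V_h^{n-1}\subset V_h^n$ then $\bar V_h^n=V_h^n$. $\mathcal U_{hk}$ is the set of $U=(U_1,U_2)$ continuous on $\Omega\times[0,T]$, linear in $t$ on each $I_n$, with $U(\cdot,t_n)\in(V_h^n)^2$ and $U(\cdot,t)\in(\bar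 V_h^n)^2$ for $t\in I_n$. $\mathcal V_{hk}$ is the set of $V=(V_1,V_2)$ that on each $I_n$ are constant in $t$ with values in $(V_h^n)^2$. For $V\in\mathcal V_{hk}$, $V(T)$ denotes the limit from the left. Forms: $$B^*(v,z)=\int_0^T\Big\{-(v_1,\dot z_1)+a(v_1,z_2)-\int_t^T\mathcal K(s-t)a(v_1,z_2(s))\,ds-(v_2,\dot z_2)-(v_2,z_1)\Big\}dt+(v_1(T),z_1(T))+(v_2(T),z_2(T)),$$ $$L^*(v)=\int_0^T\{(v_1,j_1)+(v_2,j_2)\}\,dt+(v_1(T),z_1^T)+(v_2(T),z_2^T),$$ where $j_1,j_2$ are load terms and $z_1^T,z_2^T$ the (terminal) data of the dual problem. Projections and discrete operators. $\mathcal P_{h,n}:H\to V_h^n$ is the $L_2$-orthogonal projection, and $(\mathcal P_hv)(t)=\mathcal P_{h,n}v(t)$ for $t\in I_n$ (with $\mathcal P_h=\mathcal P_{h,N}$ at $t=T$). $\mathcal P_k$ is the $L_2$-projection in time onto functions constant on each $I_n$ (the average over each $I_n$). $A_n:V_h^n\to V_h^n$ is defined by $a(v,w)=(A_nv,w)$ for all $v,w\in V_h^n$; $A_hv=A_nv$ for $v\in V_h^n$; and $\|v\|_{h,l}=\|A_n^{l/2}v\|=\sqrt{(v,A_n^lv)}$ for $v\in V_h^n$, $l\in\mathbb R$.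
   Formalization: For l ≠ 0 it is assumed that A_h^l is well defined, i.e. A_m^l v = A_n^l v on V_h^m ∩ V_h^n (automatic for l = 0 or unchanged spaces); with strictly growing spaces A_h^l is otherwise ambiguous and the identity fails. The dimension d is fixed. *)

theory Defs
  imports "HOL-Analysis.Analysis"
begin

section \<open>Function spaces on a domain\<close>

text \<open>
  Elements of function spaces are represented by functions on the whole space; only their
  values on \<open>\<Omega>\<close> enter the inner products and norms.
\<close>

definition L2 :: "(real^'d) set \<Rightarrow> (real^'d \<Rightarrow> 'b::euclidean_space) set" where
  "L2 \<Omega> = {u. set_borel_measurable lborel \<Omega> u \<and> set_integrable lborel \<Omega> (\<lambda>x. (norm (u x))\<^sup>2)}"

definition L2_inner :: "(real^'d) set \<Rightarrow> (real^'d \<Rightarrow> 'b::euclidean_space) \<Rightarrow> (real^'d \<Rightarrow> 'b) \<Rightarrow> real" where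
  "L2_inner \<Omega> u v = (LINT x:\<Omega>|lborel. u x \<bullet> v x)"

definition L2_norm :: "(real^'d) set \<Rightarrow> (real^'d \<Rightarrow> 'b::euclidean_space) \<Rightarrow> real" where
  "L2_norm \<Omega> u = sqrt (L2_inner \<Omega> u u)"

definition pderiv_at :: "'d \<Rightarrow> (real^'d \<Rightarrow> 'b::euclidean_space) \<Rightarrow> real^'d \<Rightarrow> 'b" where
  "pderiv_at j f x = frechet_derivative f (at x) (axis j 1)"

primrec Ck :: "nat \<Rightarrow> (real^'d \<Rightarrow> 'b::euclidean_space) \<Rightarrow> bool" where
  "Ck 0 f \<longleftrightarrow> continuous_on UNIV f"
| "Ck (Suc k) f \<longleftrightarrow> f differentiable_on UNIV \<and> (\<forall>j. Ck k (pderiv_at j f))"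

definition test_function :: "(real^'d) set \<Rightarrow> (real^'d \<Rightarrow> 'b::euclidean_space) \<Rightarrow> bool" where
  "test_function \<Omega> \<phi> \<longleftrightarrow> (\<forall>k. Ck k \<phi>) \<and> compact (closure {x. \<phi> x \<noteq> 0}) \<and> closure {x. \<phi> x \<noteq> 0} \<subseteq> \<Omega>"

definition weak_pderiv ::
  "(real^'d) set \<Rightarrow> 'd \<Rightarrow> (real^'d \<Rightarrow> 'b::euclidean_space) \<Rightarrow> (real^'d \<Rightarrow> 'b) \<Rightarrow> bool" where
  "weak_pderiv \<Omega> j u g \<longleftrightarrow> (\<forall>\<phi> :: real^'d \<Rightarrow> real. test_function \<Omega> \<phi> \<longrightarrow>
     (LINT x:\<Omega>|lborel. pderiv_at j \<phi> x *\<^sub>R u x) = - (LINT x:\<Omega>|lborel. \<phi> x *\<^sub>R g x))"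

definition H1 :: "(real^'d) set \<Rightarrow> (real^'d \<Rightarrow> 'b::euclidean_space) set" where
  "H1 \<Omega> = {u \<in> L2 \<Omega>. \<forall>j. \<exists>g \<in> L2 \<Omega>. weak_pderiv \<Omega> j u g}"

text \<open>The weak partial derivative is unique up to null sets; \<open>wd\<close> picks a representative.\<close>

definition wd :: "(real^'d) set \<Rightarrow> 'd \<Rightarrow> (real^'d \<Rightarrow> 'b::euclidean_space) \<Rightarrow> real^'d \<Rightarrow> 'b" where
  "wd \<Omega> j u = (SOME g. g \<in> L2 \<Omega> \<and> weak_pderiv \<Omega> j u g)"

definition H1_norm :: "(real^'d) set \<Rightarrow> (real^'d \<Rightarrow> 'b::euclidean_space) \<Rightarrow> real" where
  "H1_norm \<Omega> u = sqrt ((L2_norm \<Omega> u)\<^sup>2 + (\<Sum>j\<in>UNIV. (L2_norm \<Omega> (wd \<Omega> j u))\<^sup>2))"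

definition H2 :: "(real^'d) set \<Rightarrow> (real^'d \<Rightarrow> 'b::euclidean_space) set" where
  "H2 \<Omega> = {u \<in> H1 \<Omega>. \<forall>j. wd \<Omega> j u \<in> H1 \<Omega>}"

definition H10 :: "(real^'d) set \<Rightarrow> (real^'d \<Rightarrow> 'b::euclidean_space) set" where
  "H10 \<Omega> = {u \<in> H1 \<Omega>. \<exists>\<phi>. (\<forall>m. test_function \<Omega> (\<phi> m)) \<and>
     (\<lambda>m::nat. H1_norm \<Omega> (\<lambda>x. \<phi> m x - u x)) \<longlonglongrightarrow> 0}"

definition convex_polygonal_domain :: "(real^'d) set \<Rightarrow> bool" where
  "convex_polygonal_domain \<Omega> \<longleftrightarrow> \<Omega> \<noteq> {} \<and> open \<Omega> \<and> convex \<Omega> \<and> polytope (closure \<Omega>)"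


section \<open>The elliptic operator and its bilinear form\<close>

type_synonym 'd vfield = "real^'d \<Rightarrow> real^'d"

text \<open>
  A linear second order operator on vector fields with bounded coefficients,
  \<open>(A u)\<^sub>i = - \<Sum>\<^sub>j\<^sub>k\<^sub>l c2\<^sub>i\<^sub>j\<^sub>k\<^sub>l \<partial>\<^sub>j \<partial>\<^sub>l u\<^sub>k + \<Sum>\<^sub>k\<^sub>l c1\<^sub>i\<^sub>k\<^sub>l \<partial>\<^sub>l u\<^sub>k + \<Sum>\<^sub>k c0\<^sub>i\<^sub>k u\<^sub>k\<close>.
  Uniform ellipticity is the Legendre-Hadamard condition, which covers linear elasticity.
\<close>

definition uniformly_elliptic_op :: "(real^'d) set \<Rightarrow> ('d vfield \<Rightarrow> 'd vfield) \<Rightarrow> bool" where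
  "uniformly_elliptic_op \<Omega> A \<longleftrightarrow>
    (\<exists>(c2 :: real^'d \<Rightarrow> 'd \<Rightarrow> 'd \<Rightarrow> 'd \<Rightarrow> 'd \<Rightarrow> real) (c1 :: real^'d \<Rightarrow> 'd \<Rightarrow> 'd \<Rightarrow> 'd \<Rightarrow> real)
       (c0 :: real^'d \<Rightarrow> 'd \<Rightarrow> 'd \<Rightarrow> real) M \<theta>.
      (\<forall>i j k l. set_borel_measurable lborel \<Omega> (\<lambda>x. c2 x i j k l)) \<and>
      (\<forall>i k l. set_borel_measurable lborel \<Omega> (\<lambda>x. c1 x i k l)) \<and>
      (\<forall>i k. set_borel_measurable lborel \<Omega> (\<lambda>x. c0 x i k)) \<and>
      (\<forall>x\<in>\<Omega>. \<forall>i j k l. \<bar>c2 x i j k l\<bar> \<le> M \<and> \<bar>c1 x i k l\<bar> \<le> M \<and> \<bar>c0 x i k\<bar> \<le> M) \<and>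
      0 < \<theta> \<and>
      (\<forall>x\<in>\<Omega>. \<forall>\<zeta> \<eta> :: real^'d.
         (\<Sum>i\<in>UNIV. \<Sum>j\<in>UNIV. \<Sum>k\<in>UNIV. \<Sum>l\<in>UNIV. c2 x i j k l * \<zeta> $ j * \<zeta> $ l * \<eta> $ i * \<eta> $ k)
           \<ge> \<theta> * (norm \<zeta>)\<^sup>2 * (norm \<eta>)\<^sup>2) \<and>
      (\<forall>u \<in> H2 \<Omega> \<inter> H10 \<Omega>. AE x in lborel. x \<in> \<Omega> \<longrightarrow>
         A u x = (\<chi> i.
           - (\<Sum>j\<in>UNIV. \<Sum>k\<in>UNIV. \<Sum>l\<in>UNIV. c2 x i j k l * wd \<Omega> j (wd \<Omega> l u) x $ k)
           + (\<Sum>k\<in>UNIV. \<Sum>l\<in>UNIV. c1 x i k l * wd \<Omega> l u x $ k)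
           + (\<Sum>k\<in>UNIV. c0 x i k * u x $ k))))"

text \<open>Self-adjointness of an unbounded operator in \<open>L\<^sub>2(\<Omega>)\<^sup>d\<close> with domain \<open>D\<close>: symmetry, and the
  adjoint has no larger domain.\<close>

definition self_adjoint_op :: "(real^'d) set \<Rightarrow> 'd vfield set \<Rightarrow> ('d vfield \<Rightarrow> 'd vfield) \<Rightarrow> bool" where
  "self_adjoint_op \<Omega> D A \<longleftrightarrow>
     (\<forall>u\<in>D. A u \<in> L2 \<Omega>) \<and>
     (\<forall>u\<in>D. \<forall>v\<in>D. L2_inner \<Omega> (A u) v = L2_inner \<Omega> u (A v)) \<and>
     (\<forall>v\<in>L2 \<Omega>. \<forall>g\<in>L2 \<Omega>. (\<forall>u\<in>D. L2_inner \<Omega> (A u) v = L2_inner \<Omega> u g) \<longrightarrow> v \<in> D)"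

definition positive_definite_op :: "(real^'d) set \<Rightarrow> 'd vfield set \<Rightarrow> ('d vfield \<Rightarrow> 'd vfield) \<Rightarrow> bool" where
  "positive_definite_op \<Omega> D A \<longleftrightarrow> (\<exists>c>0. \<forall>u\<in>D. L2_inner \<Omega> (A u) u \<ge> c * (L2_norm \<Omega> u)\<^sup>2)"

text \<open>\<open>a\<close> is the continuous extension of \<open>(A u, v)\<close> to \<open>V \<times> V\<close>; it is unique since
  test functions are dense in \<open>V\<close>.\<close>

definition form_of_op ::
  "(real^'d) set \<Rightarrow> ('d vfield \<Rightarrow> 'd vfield) \<Rightarrow> ('d vfield \<Rightarrow> 'd vfield \<Rightarrow> real) \<Rightarrow> bool" where
  "form_of_op \<Omega> A a \<longleftrightarrow>
     (\<forall>u \<in> H2 \<Omega> \<inter> H10 \<Omega>. \<forall>v \<in> H10 \<Omega>. a u v = L2_inner \<Omega> (A u) v) \<and>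
     (\<forall>u \<in> H10 \<Omega>. \<forall>v \<in> H10 \<Omega>. \<forall>w \<in> H10 \<Omega>. \<forall>b c.
        a (\<lambda>x. b *\<^sub>R u x + c *\<^sub>R v x) w = b * a u w + c * a v w \<and>
        a w (\<lambda>x. b *\<^sub>R u x + c *\<^sub>R v x) = b * a w u + c * a w v) \<and>
     (\<exists>M. \<forall>u \<in> H10 \<Omega>. \<forall>v \<in> H10 \<Omega>. \<bar>a u v\<bar> \<le> M * H1_norm \<Omega> u * H1_norm \<Omega> v)"


section \<open>Projections and powers of operators on finite dimensional spaces\<close>

definition L2_proj :: "(real^'d) set \<Rightarrow> 'd vfield set \<Rightarrow> 'd vfield \<Rightarrow> 'd vfield" where
  "L2_proj \<Omega> W v = (THE w. w \<in> W \<and> (\<forall>y\<in>W. L2_inner \<Omega> w y = L2_inner \<Omega> v y))"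

definition discrete_op ::
  "(real^'d) set \<Rightarrow> ('d vfield \<Rightarrow> 'd vfield \<Rightarrow> real) \<Rightarrow> 'd vfield set \<Rightarrow> 'd vfield \<Rightarrow> 'd vfield" where
  "discrete_op \<Omega> a W v = (THE w. w \<in> W \<and> (\<forall>y\<in>W. a v y = L2_inner \<Omega> w y))"

definition eigenspace :: "'d::finite vfield set \<Rightarrow> ('d vfield \<Rightarrow> 'd vfield) \<Rightarrow> real \<Rightarrow> 'd vfield set" where
  "eigenspace W B \<mu> = {w \<in> W. B w = (\<lambda>x. \<mu> *\<^sub>R w x)}"

definition eigenvalues :: "'d::finite vfield set \<Rightarrow> ('d vfield \<Rightarrow> 'd vfield) \<Rightarrow> real set" where
  "eigenvalues W B = {\<mu>. \<exists>w \<in> eigenspace W B \<mu>. w \<noteq> (\<lambda>x. 0)}"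

text \<open>Real powers of a positive definite self-adjoint \<open>B\<close> on the finite dimensional space \<open>W\<close>, by
  its spectral decomposition \<open>B\<^sup>l = \<Sum>\<^sub>\<mu> \<mu>\<^sup>l E\<^sub>\<mu>\<close>, with \<open>E\<^sub>\<mu>\<close> the \<open>L\<^sub>2\<close>-projection onto the
  eigenspace.\<close>

definition op_power ::
  "(real^'d) set \<Rightarrow> 'd vfield set \<Rightarrow> ('d vfield \<Rightarrow> 'd vfield) \<Rightarrow> real \<Rightarrow> 'd vfield \<Rightarrow> 'd vfield" where
  "op_power \<Omega> W B l v =
     (\<lambda>x. \<Sum>\<mu>\<in>eigenvalues W B. (\<mu> powr l) *\<^sub>R L2_proj \<Omega> (eigenspace W B \<mu>) v x)"


section \<open>Finite elements\<close>

text \<open>A mesh of simplices of full dimension, conforming (library predicate \<open>triangulation\<close>) and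
  covering the domain.\<close>

definition mesh_of :: "(real^'d) set \<Rightarrow> (real^'d) set set \<Rightarrow> bool" where
  "mesh_of \<Omega> \<T> \<longleftrightarrow> triangulation \<T> \<and> (\<forall>K\<in>\<T>. int (CARD('d)) simplex K) \<and> \<Union>\<T> = closure \<Omega>"

text \<open>Continuous vector fields in \<open>V\<close> that are affine on every cell and vanish on the boundary. They
  are extended by zero, so that each element has exactly one representative.\<close>

definition P1_space :: "(real^'d) set \<Rightarrow> (real^'d) set set \<Rightarrow> 'd vfield set" where
  "P1_space \<Omega> \<T> = {v \<in> H10 \<Omega>. continuous_on (closure \<Omega>) v \<and> (\<forall>x. x \<notin> \<Omega> \<longrightarrow> v x = 0) \<and>
     (\<forall>K\<in>\<T>. \<exists>g c. linear g \<and> (\<forall>x\<in>K. v x = g x + c))}"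


section \<open>The discretized problem\<close>

record ('d::finite) cg_data =
  Omega :: "(real^'d) set"
  opA :: "'d vfield \<Rightarrow> 'd vfield"
  aform :: "'d vfield \<Rightarrow> 'd vfield \<Rightarrow> real"
  kern :: "real \<Rightarrow> real"
  nsteps :: nat
  tnode :: "nat \<Rightarrow> real"
  mesh :: "nat \<Rightarrow> (real^'d) set set"

abbreviation tend :: "'d::finite cg_data \<Rightarrow> real" where
  "tend P \<equiv> tnode P (nsteps P)"

definition ip :: "'d::finite cg_data \<Rightarrow> 'd vfield \<Rightarrow> 'd vfield \<Rightarrow> real" where
  "ip P = L2_inner (Omega P)"

text \<open>\<open>tnode 0, \<dots>, tnode N\<close> are the time nodes and \<open>T = tnode N\<close>. The kernel may be singular at 0.\<close>

definition cg_setting :: "real \<Rightarrow> 'd::finite cg_data \<Rightarrow> bool" where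
  "cg_setting \<kappa> P \<longleftrightarrow>
     convex_polygonal_domain (Omega P) \<and>
     uniformly_elliptic_op (Omega P) (opA P) \<and>
     self_adjoint_op (Omega P) (H2 (Omega P) \<inter> H10 (Omega P)) (opA P) \<and>
     positive_definite_op (Omega P) (H2 (Omega P) \<inter> H10 (Omega P)) (opA P) \<and>
     form_of_op (Omega P) (opA P) (aform P) \<and>
     (\<forall>t>0. kern P t \<ge> 0) \<and>
     (\<forall>t>0. \<exists>D\<le>0. (kern P has_real_derivative D) (at t)) \<and>
     set_integrable lborel {0<..} (kern P) \<and>
     (LINT s:{0<..}|lborel. \<bar>kern P s\<bar>) = \<kappa> \<and> \<kappa> < 1 \<and>
     tnode P 0 = 0 \<and> 0 < tend P \<and> (\<forall>n<nsteps P. tnode P n < tnode P (Suc n)) \<and>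
     (\<forall>n\<le>nsteps P. mesh_of (Omega P) (mesh P n))"

definition xi :: "'d::finite cg_data \<Rightarrow> real \<Rightarrow> real" where
  "xi P t = (LINT s:{t<..}|lborel. kern P s)"

definition Vh :: "'d::finite cg_data \<Rightarrow> nat \<Rightarrow> 'd vfield set" where
  "Vh P n = P1_space (Omega P) (mesh P n)"

definition Vbar :: "'d::finite cg_data \<Rightarrow> nat \<Rightarrow> 'd vfield set" where
  "Vbar P n = P1_space (Omega P) {K \<inter> K' |K K'. K \<in> mesh P (n - 1) \<and> K' \<in> mesh P n}"

abbreviation I_open :: "'d::finite cg_data \<Rightarrow> nat \<Rightarrow> real set" where
  "I_open P n \<equiv> {tnode P (n - 1)<..<tnode P n}"

definition Uhk :: "'d::finite cg_data \<Rightarrow> ((real \<Rightarrow> 'd vfield) \<times> (real \<Rightarrow> 'd vfield)) set" where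
  "Uhk P = {(U1, U2). \<forall>U\<in>{U1, U2}.
     continuous_on (Omega P \<times> {0..tend P}) (\<lambda>(x, t). U t x) \<and>
     (\<forall>n\<in>{1..nsteps P}. \<exists>p q. \<forall>t\<in>I_open P n. U t = (\<lambda>x. p x + t *\<^sub>R q x)) \<and>
     (\<forall>n\<le>nsteps P. U (tnode P n) \<in> Vh P n) \<and>
     (\<forall>n\<in>{1..nsteps P}. \<forall>t\<in>I_open P n. U t \<in> Vbar P n)}"

definition Vhk :: "'d::finite cg_data \<Rightarrow> ((real \<Rightarrow> 'd vfield) \<times> (real \<Rightarrow> 'd vfield)) set" where
  "Vhk P = {(V1, V2). \<forall>V\<in>{V1, V2}. \<forall>n\<in>{1..nsteps P}. \<exists>y\<in>Vh P n. \<forall>t\<in>I_open P n. V t = y}"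

definition left_lim :: "real \<Rightarrow> (real \<Rightarrow> 'd::finite vfield) \<Rightarrow> 'd vfield" where
  "left_lim t v = (\<lambda>x. Lim (at_left t) (\<lambda>s. v s x))"

definition tderiv :: "(real \<Rightarrow> 'd::finite vfield) \<Rightarrow> real \<Rightarrow> 'd vfield" where
  "tderiv z t = (\<lambda>x. vector_derivative (\<lambda>s. z s x) (at t))"

definition Bstar :: "'d::finite cg_data \<Rightarrow> (real \<Rightarrow> 'd vfield) \<times> (real \<Rightarrow> 'd vfield) \<Rightarrow>
    (real \<Rightarrow> 'd vfield) \<times> (real \<Rightarrow> 'd vfield) \<Rightarrow> real" where
  "Bstar P = (\<lambda>(v1, v2) (z1, z2).
     (LINT t:{0..tend P}|lborel.
        - ip P (v1 t) (tderiv z1 t) + aform P (v1 t) (z2 t)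
        - (LINT s:{t..tend P}|lborel. kern P (s - t) * aform P (v1 t) (z2 s))
        - ip P (v2 t) (tderiv z2 t) - ip P (v2 t) (z1 t))
     + ip P (left_lim (tend P) v1) (z1 (tend P)) + ip P (left_lim (tend P) v2) (z2 (tend P)))"

definition Lstar :: "'d::finite cg_data \<Rightarrow> (real \<Rightarrow> 'd vfield) \<Rightarrow> (real \<Rightarrow> 'd vfield) \<Rightarrow>
    'd vfield \<Rightarrow> 'd vfield \<Rightarrow> (real \<Rightarrow> 'd vfield) \<times> (real \<Rightarrow> 'd vfield) \<Rightarrow> real" where
  "Lstar P j1 j2 z1T z2T = (\<lambda>(v1, v2).
     (LINT t:{0..tend P}|lborel. ip P (v1 t) (j1 t) + ip P (v2 t) (j2 t))
     + ip P (left_lim (tend P) v1) z1T + ip P (left_lim (tend P) v2) z2T)"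

text \<open>Load terms in \<open>L\<^sub>1(0,T; L\<^sub>2(\<Omega>)\<^sup>d)\<close>: all the regularity that is needed for every term below to be
  well defined.\<close>

definition load :: "'d::finite cg_data \<Rightarrow> (real \<Rightarrow> 'd vfield) \<Rightarrow> bool" where
  "load P j \<longleftrightarrow>
     set_borel_measurable (lborel \<Otimes>\<^sub>M lborel) (Omega P \<times> {0..tend P}) (\<lambda>(x, t). j t x) \<and>
     (\<forall>t\<in>{0..tend P}. j t \<in> L2 (Omega P)) \<and>
     set_integrable lborel {0..tend P} (\<lambda>t. L2_norm (Omega P) (j t))"

text \<open>Index of the mesh in force at time \<open>t\<close>: it is \<open>n\<close> both for \<open>t\<close> in \<open>I\<^sub>n\<close> and for \<open>t = t\<^sub>n\<close>.\<close>

definition tidx :: "'d::finite cg_data \<Rightarrow> real \<Rightarrow> nat" where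
  "tidx P t = (LEAST n. t \<le> tnode P n)"

definition Ph :: "'d::finite cg_data \<Rightarrow> real \<Rightarrow> 'd vfield \<Rightarrow> 'd vfield" where
  "Ph P t v = L2_proj (Omega P) (Vh P (tidx P t)) v"

definition Pk :: "'d::finite cg_data \<Rightarrow> (real \<Rightarrow> 'd vfield) \<Rightarrow> real \<Rightarrow> 'd vfield" where
  "Pk P w t = (let n = tidx P t in
     (\<lambda>x. (1 / (tnode P n - tnode P (n - 1))) *\<^sub>R (LINT s:I_open P n|lborel. w s x)))"

definition PkPh :: "'d::finite cg_data \<Rightarrow> (real \<Rightarrow> 'd vfield) \<Rightarrow> real \<Rightarrow> 'd vfield" where
  "PkPh P j = Pk P (\<lambda>t. Ph P t (j t))"

definition An :: "'d::finite cg_data \<Rightarrow> nat \<Rightarrow> 'd vfield \<Rightarrow> 'd vfield" where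
  "An P n = discrete_op (Omega P) (aform P) (Vh P n)"

definition An_pow :: "'d::finite cg_data \<Rightarrow> nat \<Rightarrow> real \<Rightarrow> 'd vfield \<Rightarrow> 'd vfield" where
  "An_pow P n l = op_power (Omega P) (Vh P n) (An P n) l"

text \<open>\<open>Ah_pow P t l\<close> is \<open>A\<^sub>h\<^sup>l\<close> applied to functions living at time \<open>t\<close>, that is \<open>A\<^sub>n\<^sup>l\<close> on \<open>V\<^sub>h\<^sup>n\<close>.\<close>

definition Ah_pow :: "'d::finite cg_data \<Rightarrow> real \<Rightarrow> real \<Rightarrow> 'd vfield \<Rightarrow> 'd vfield" where
  "Ah_pow P t l = An_pow P (tidx P t) l"

definition hnorm :: "'d::finite cg_data \<Rightarrow> real \<Rightarrow> real \<Rightarrow> 'd vfield \<Rightarrow> real" where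
  "hnorm P t l v = L2_norm (Omega P) (Ah_pow P t (l / 2) v)"

text \<open>
  The prescription \<open>A\<^sub>h\<^sup>l v = A\<^sub>n\<^sup>l v\<close> for \<open>v \<in> V\<^sub>h\<^sup>n\<close> assigns one value to every \<open>v\<close>. For \<open>l = 0\<close>, or if
  the spaces do not change, this is automatic. For other \<open>l\<close> and \<open>V\<^sub>h\<^sup>n\<^sup>-\<^sup>1\<close> strictly contained in \<open>V\<^sub>h\<^sup>n\<close>,
  it is a genuine condition: \<open>A\<^sub>n\<^sup>l\<close> has to extend \<open>A\<^sub>n\<^sub>-\<^sub>1\<^sup>l\<close>.
\<close>

definition Ah_pow_well_defined :: "'d::finite cg_data \<Rightarrow> real \<Rightarrow> bool" where
  "Ah_pow_well_defined P l \<longleftrightarrow>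
     (\<forall>m\<le>nsteps P. \<forall>n\<le>nsteps P. \<forall>v \<in> Vh P m \<inter> Vh P n. An_pow P m l v = An_pow P n l v)"

end

(* Idea. On each time interval the equations are tested with A_h^l applied to the slope of Z_2 and to
   the mean P_k P_h j_2 of the load; by the second equation their sum is minus the mean of Z_1, so all
   terms become differences of squares except the memory term. Since xi' = - K and
   xi(0) = kappa, integration by parts in both time variables turns the memory term into the double
   integral with kernel xi, which gives the identity after summation over the intervals.
   The kernel xi is nonnegative, nonincreasing and convex, hence of positive type, so the double integral
   can be dropped. Evaluating the identity at the time node where the sum of the two norms is maximal
   bounds the square of that maximum by the maximum times the data.
   Weak derivatives are unique and test functions lie in the domain of A, so by density the form a is
   symmetric and coercive on H^1_0; the spectral theorem on V_h^n then yields the powers of A_n. *)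
theory Submission
  imports Defs "HOL-Library.Function_Algebras"
begin

text \<open>Elements of function spaces are plain functions, so the L2 product is only semidefinite
  and \<open>wd\<close> is linear only almost everywhere. Definiteness returns on the finite element
  spaces: their elements are continuous on \<Omega> and vanish outside, so a null function there is
  the zero function. Nestedness makes the slopes of the solution admissible test functions, and the
  consistency of the powers A_n^l lets all discrete norms come from two fixed forms on the largest
  space, so that contributions of neighbouring intervals telescope. The kernel may be singular at 0.
  The function \<xi> is still continuous there, but its derivative is available only for positive
  arguments; hence integrations by parts use the fundamental theorem with interior derivatives.
  Positive type is proved without Fourier transforms: a nonnegative, nonincreasing, convex sequence
  is a nonnegative combination of a constant and of tents, tents give sums of squares, and Riemann
  sums carry this over to the integral.\<close>

instantiation "fun" :: (type, real_vector) real_vector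
begin

text \<open>Makes subspaces, spans and independence from the library available for sets of
  functions, on top of the pointwise group structure from \<open>Function_Algebras\<close>.\<close>

definition scaleR_fun :: "real \<Rightarrow> ('a \<Rightarrow> 'b) \<Rightarrow> 'a \<Rightarrow> 'b" where
  "scaleR_fun c f = (\<lambda>x. c *\<^sub>R f x)"

instance
  by standard (auto simp: scaleR_fun_def fun_eq_iff scaleR_add_right scaleR_add_left)

end

lemma scaleR_fun_apply [simp]: "(c *\<^sub>R f) x = c *\<^sub>R f x"
  by (simp add: scaleR_fun_def)

lemma sum_fun_apply [simp]: "(\<Sum>i\<in>S. f i) x = (\<Sum>i\<in>S. f i x)"
  by (induction S rule: infinite_finite_induct) auto

section \<open>Positive semidefinite forms\<close>

text \<open>One interface for all forms that occur: the L2 and H1 products, \<open>a\<close>, the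
  forms behind the discrete norms, and \<mu> g(u, v) - g(B u, v) in the eigenvector argument. The
  first two are only semidefinite, because functions are not identified almost everywhere.\<close>

locale psd_form =
  fixes W :: "'a::real_vector set" and g :: "'a \<Rightarrow> 'a \<Rightarrow> real"
  assumes subspace_W: "subspace W"
    and form_sym: "u \<in> W \<Longrightarrow> v \<in> W \<Longrightarrow> g u v = g v u"
    and form_add_left: "u \<in> W \<Longrightarrow> v \<in> W \<Longrightarrow> w \<in> W \<Longrightarrow> g (u + v) w = g u w + g v w"
    and form_scale_left: "u \<in> W \<Longrightarrow> w \<in> W \<Longrightarrow> g (c *\<^sub>R u) w = c * g u w"
    and form_nonneg: "u \<in> W \<Longrightarrow> 0 \<le> g u u"
begin

lemmas mem_add = subspace_add[OF subspace_W]
lemmas mem_diff = subspace_diff[OF subspace_W]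
lemmas mem_scale = subspace_scale[OF subspace_W]
lemmas mem_zero = subspace_0[OF subspace_W]

lemma mem_sum: "(\<And>i. i \<in> S \<Longrightarrow> f i \<in> W) \<Longrightarrow> (\<Sum>i\<in>S. f i) \<in> W"
  by (rule subspace_sum[OF subspace_W])

lemma form_add_right: "u \<in> W \<Longrightarrow> v \<in> W \<Longrightarrow> w \<in> W \<Longrightarrow> g w (u + v) = g w u + g w v"
  using form_add_left[of u v w] form_sym by (simp add: mem_add)

lemma form_scale_right: "u \<in> W \<Longrightarrow> w \<in> W \<Longrightarrow> g w (c *\<^sub>R u) = c * g w u"
  using form_scale_left[of u w c] form_sym by (simp add: mem_scale)

lemma form_zero_left: "w \<in> W \<Longrightarrow> g 0 w = 0"
  using form_scale_left[of 0 w 0] mem_zero by simp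

lemma form_diff_left: "u \<in> W \<Longrightarrow> v \<in> W \<Longrightarrow> w \<in> W \<Longrightarrow> g (u - v) w = g u w - g v w"
  using form_add_left[of "u - v" v w] by (simp add: mem_diff)

lemma form_sum_left:
  "(\<And>i. i \<in> S \<Longrightarrow> f i \<in> W) \<Longrightarrow> w \<in> W \<Longrightarrow> g (\<Sum>i\<in>S. f i) w = (\<Sum>i\<in>S. g (f i) w)"
proof (induction S rule: infinite_finite_induct)
  case (insert x F)
  then have "g (f x + sum f F) w = g (f x) w + g (sum f F) w"
    by (intro form_add_left mem_sum) auto
  with insert show ?case by simp
qed (auto simp: form_zero_left)

lemma form_sum_right:
  "(\<And>i. i \<in> S \<Longrightarrow> f i \<in> W) \<Longrightarrow> w \<in> W \<Longrightarrow> g w (\<Sum>i\<in>S. f i) = (\<Sum>i\<in>S. g w (f i))"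
  using form_sum_left[of S f w] form_sym[of w] by (simp add: mem_sum)

lemma form_expand_left:
  "(\<And>i. i \<in> S \<Longrightarrow> f i \<in> W) \<Longrightarrow> w \<in> W \<Longrightarrow> g (\<Sum>i\<in>S. c i *\<^sub>R f i) w = (\<Sum>i\<in>S. c i * g (f i) w)"
  by (subst form_sum_left) (auto simp: mem_scale form_scale_left intro!: sum.cong)

lemma form_expand_right:
  "(\<And>i. i \<in> S \<Longrightarrow> f i \<in> W) \<Longrightarrow> w \<in> W \<Longrightarrow> g w (\<Sum>i\<in>S. c i *\<^sub>R f i) = (\<Sum>i\<in>S. c i * g w (f i))"
  by (subst form_sum_right) (auto simp: mem_scale form_scale_right intro!: sum.cong)

lemma cauchy_schwarz_square:
  assumes u: "u \<in> W" and v: "v \<in> W"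
  shows "(g u v)\<^sup>2 \<le> g u u * g v v"
proof -
  have expand: "g (u + t *\<^sub>R v) (u + t *\<^sub>R v) = g u u + 2 * t * g u v + t\<^sup>2 * g v v" for t
    using u v by (simp add: form_add_left form_add_right form_scale_left form_scale_right mem_add
        mem_scale form_sym[of v u] power2_eq_square algebra_simps)
  have pos: "0 \<le> g u u + 2 * t * g u v + t\<^sup>2 * g v v" for t
    using form_nonneg[of "u + t *\<^sub>R v"] u v by (simp add: expand mem_add mem_scale)
  show ?thesis
  proof (cases "g v v = 0")
    case False
    with form_nonneg[OF v] have gv: "g v v > 0" by simp
    \<comment> \<open>The minimizer of the quadratic polynomial in t.\<close>
    show ?thesis using pos[of "- g u v / g v v"] gv
      by (simp add: power2_eq_square field_simps)
  next
    case True
    have "g u v = 0"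
    proof (rule ccontr)
      assume ne: "g u v \<noteq> 0"
      \<comment> \<open>Without its quadratic term the polynomial is affine in t; at this t it
        equals -1.\<close>
      show False using pos[of "- (g u u + 1) / (2 * g u v)"] True ne by (simp add: field_simps)
    qed
    with True show ?thesis by simp
  qed
qed

lemma cauchy_schwarz: "u \<in> W \<Longrightarrow> v \<in> W \<Longrightarrow> \<bar>g u v\<bar> \<le> sqrt (g u u) * sqrt (g v v)"
  using real_sqrt_le_mono[OF cauchy_schwarz_square[of u v]] by (simp add: real_sqrt_mult)

text \<open>Zeros of the quadratic form lie in the radical of the form. This is what turns a
  maximizer of the Rayleigh quotient into an eigenvector.\<close>

lemma form_null: "u \<in> W \<Longrightarrow> v \<in> W \<Longrightarrow> g u u = 0 \<Longrightarrow> g u v = 0"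
  using cauchy_schwarz_square[of u v] by simp

lemma triangle:
  assumes u: "u \<in> W" and v: "v \<in> W"
  shows "sqrt (g (u + v) (u + v)) \<le> sqrt (g u u) + sqrt (g v v)"
proof (rule real_le_lsqrt)
  have "g (u + v) (u + v) = g u u + 2 * g u v + g v v"
    using u v by (simp add: form_add_left form_add_right mem_add form_sym[of v u])
  also have "\<dots> \<le> g u u + 2 * (sqrt (g u u) * sqrt (g v v)) + g v v"
    using cauchy_schwarz[OF u v] by simp
  also have "\<dots> = (sqrt (g u u) + sqrt (g v v))\<^sup>2"
    using form_nonneg u v by (simp add: power2_sum)
  finally show "g (u + v) (u + v) \<le> (sqrt (g u u) + sqrt (g v v))\<^sup>2" .
qed (use form_nonneg u v in auto)

lemma norm_scale: "u \<in> W \<Longrightarrow> sqrt (g (c *\<^sub>R u) (c *\<^sub>R u)) = \<bar>c\<bar> * sqrt (g u u)"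
  by (simp add: form_scale_left form_scale_right mem_scale real_sqrt_mult flip: mult.assoc)

lemma psd_form_subset: "subspace U \<Longrightarrow> U \<subseteq> W \<Longrightarrow> psd_form U g"
  by unfold_locales (auto intro: form_sym form_add_left form_scale_left form_nonneg)

end

section \<open>Finite dimensional inner product spaces\<close>

locale fin_ip_space = psd_form W g for W :: "'a::real_vector set" and g +
  assumes finite_spanning: "\<exists>B. finite B \<and> W \<subseteq> span B"
    and form_definite: "u \<in> W \<Longrightarrow> g u u = 0 \<Longrightarrow> u = 0"
begin

definition orthonormal :: "'a set \<Rightarrow> bool" where
  "orthonormal E \<longleftrightarrow> E \<subseteq> W \<and> (\<forall>e\<in>E. \<forall>f\<in>E. g e f = (if e = f then 1 else 0))"

lemma eq_by_testing: "u \<in> W \<Longrightarrow> v \<in> W \<Longrightarrow> (\<And>w. w \<in> W \<Longrightarrow> g u w = g v w) \<Longrightarrow> u = v"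
  using form_definite[of "u - v"] mem_diff by (simp add: form_diff_left)

lemma orthonormal_coeff:
  assumes "orthonormal E" "finite F" "F \<subseteq> E" "e \<in> F"
  shows "g (\<Sum>f\<in>F. c f *\<^sub>R f) e = c e"
proof -
  have "g (\<Sum>f\<in>F. c f *\<^sub>R f) e = (\<Sum>f\<in>F. c f * g f e)"
    using assms by (intro form_expand_left) (auto simp: orthonormal_def)
  also have "\<dots> = (\<Sum>f\<in>F. if f = e then c e else 0)"
    using assms by (intro sum.cong) (auto simp: orthonormal_def subset_iff)
  finally show ?thesis using assms by simp
qed

lemma orthonormal_independent:
  assumes "orthonormal E" shows "independent E"
  unfolding real_vector.independent_explicit_module
proof (intro allI impI)
  fix F c e assume F: "finite F" "F \<subseteq> E" "(\<Sum>v\<in>F. c v *\<^sub>R v) = 0" "e \<in> F"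
  then have "g 0 e = c e" using orthonormal_coeff[OF assms F(1,2,4), of c] by simp
  with F assms show "c e = 0" using form_zero_left[of e] by (auto simp: orthonormal_def)
qed

lemma orthonormal_card_bound: "\<exists>n. \<forall>E. orthonormal E \<longrightarrow> finite E \<and> card E \<le> n"
proof -
  obtain B where B: "finite B" "W \<subseteq> span B" using finite_spanning by blast
  show ?thesis
    using real_vector.independent_span_bound[OF B(1)] orthonormal_independent B(2)
    by (intro exI[of _ "card B"]) (auto simp: orthonormal_def)
qed

text \<open>Orthonormal sets are independent, so their size is bounded and one of largest size
  exists. The set S is arbitrary because the lemma is used twice: with a subspace it leads to an
  orthonormal basis, with the set of eigenvectors to an eigenbasis.\<close>

lemma maximal_orthonormal:
  obtains E where "orthonormal E" "E \<subseteq> S" "finite E"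
    "\<And>v. v \<in> S \<Longrightarrow> orthonormal (insert v E) \<Longrightarrow> v \<in> E"
proof -
  obtain n where n: "\<And>E. orthonormal E \<Longrightarrow> finite E \<and> card E \<le> n"
    using orthonormal_card_bound by blast
  have "\<exists>E. (orthonormal E \<and> E \<subseteq> S) \<and> (\<forall>F. orthonormal F \<and> F \<subseteq> S \<longrightarrow> card F \<le> card E)"
    by (rule ex_has_greatest_nat[of _ "{}" _ "Suc n"])
      (use n in \<open>auto simp: less_Suc_eq_le\<close>, auto simp: orthonormal_def)
  then obtain E where E: "orthonormal E" "E \<subseteq> S" and
    max: "\<And>F. orthonormal F \<Longrightarrow> F \<subseteq> S \<Longrightarrow> card F \<le> card E" by blast
  show ?thesis
  proof (rule that[OF E])
    show "finite E" using n E by blast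
    fix v assume v: "v \<in> S" "orthonormal (insert v E)"
    show "v \<in> E"
    proof (rule ccontr)
      assume "v \<notin> E"
      with \<open>finite E\<close> max[OF v(2)] v(1) E(2) show False by simp
    qed
  qed
qed

lemma residual_orthogonal:
  assumes E: "orthonormal E" "finite E" and v: "v \<in> W" and e: "e \<in> E"
  shows "g (v - (\<Sum>f\<in>E. g v f *\<^sub>R f)) e = 0"
proof -
  have "(\<Sum>f\<in>E. g v f *\<^sub>R f) \<in> W"
    using E by (intro mem_sum mem_scale) (auto simp: orthonormal_def)
  then show ?thesis
    using orthonormal_coeff[OF E(1,2) order_refl e, of "g v"] v e E
    by (subst form_diff_left) (auto simp: orthonormal_def)
qed

lemma normalized_insert:
  assumes E: "orthonormal E" and w: "w \<in> W" "w \<noteq> 0" "\<And>e. e \<in> E \<Longrightarrow> g w e = 0"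
  shows "orthonormal (insert ((1 / sqrt (g w w)) *\<^sub>R w) E)" "(1 / sqrt (g w w)) *\<^sub>R w \<notin> E"
proof -
  let ?c = "1 / sqrt (g w w)"
  have pos: "g w w > 0" using w form_nonneg[of w] form_definite[of w] by fastforce
  have "g (?c *\<^sub>R w) (?c *\<^sub>R w) = ?c * (?c * g w w)"
    using w by (simp add: form_scale_left form_scale_right mem_scale)
  also have "\<dots> = 1" using pos by (simp add: field_simps)
  finally have one: "g (?c *\<^sub>R w) (?c *\<^sub>R w) = 1" .
  have orth: "g (?c *\<^sub>R w) e = 0" "g e (?c *\<^sub>R w) = 0" if "e \<in> E" for e
    using w that E form_sym[of e w]
    by (auto simp: form_scale_left form_scale_right mem_scale orthonormal_def)
  show "?c *\<^sub>R w \<notin> E" using orth one by fastforce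
  show "orthonormal (insert (?c *\<^sub>R w) E)"
    using E one orth w \<open>?c *\<^sub>R w \<notin> E\<close> by (auto simp: orthonormal_def mem_scale)
qed

text \<open>A vector that differs from its expansion in a maximal orthonormal set leaves a nonzero
  residual orthogonal to that set, and the normalized residual would enlarge it.\<close>

lemma orthonormal_basis_exists:
  assumes U: "subspace U" "U \<subseteq> W"
  obtains E where "orthonormal E" "E \<subseteq> U" "finite E" "\<And>v. v \<in> U \<Longrightarrow> v = (\<Sum>e\<in>E. g v e *\<^sub>R e)"
proof -
  obtain E where E: "orthonormal E" "E \<subseteq> U" "finite E"
    and max: "\<And>v. v \<in> U \<Longrightarrow> orthonormal (insert v E) \<Longrightarrow> v \<in> E"
    using maximal_orthonormal by blast
  have "v = (\<Sum>e\<in>E. g v e *\<^sub>R e)" if v: "v \<in> U" for v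
  proof (rule ccontr)
    let ?w = "v - (\<Sum>e\<in>E. g v e *\<^sub>R e)"
    assume "v \<noteq> (\<Sum>e\<in>E. g v e *\<^sub>R e)"
    then have ne: "?w \<noteq> 0" by simp
    have wU: "?w \<in> U"
      using v E by (intro subspace_diff[OF U(1)] subspace_sum[OF U(1)] subspace_scale[OF U(1)]) auto
    have "?w \<in> W" using wU U by auto
    from normalized_insert[OF E(1) this ne residual_orthogonal[OF E(1,3)]] U v
    have "orthonormal (insert ((1 / sqrt (g ?w ?w)) *\<^sub>R ?w) E)" "(1 / sqrt (g ?w ?w)) *\<^sub>R ?w \<notin> E"
      by auto
    with max[OF subspace_scale[OF U(1) wU]] show False by blast
  qed
  with E that show thesis by blast
qed

text \<open>Stated as unique existence so that the definite descriptions in \<open>L2_proj\<close>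
  and \<open>discrete_op\<close> denote. The coefficients of the representing vector are the values
  of F on an orthonormal basis.\<close>

lemma riesz:
  assumes add: "\<And>u v. u \<in> W \<Longrightarrow> v \<in> W \<Longrightarrow> F (u + v) = F u + F v"
    and scale: "\<And>c u. u \<in> W \<Longrightarrow> F (c *\<^sub>R u) = c * (F u :: real)"
  shows "\<exists>!w. w \<in> W \<and> (\<forall>y\<in>W. g w y = F y)"
proof -
  obtain E where E: "orthonormal E" "E \<subseteq> W" "finite E" "\<And>v. v \<in> W \<Longrightarrow> v = (\<Sum>e\<in>E. g v e *\<^sub>R e)"
    using orthonormal_basis_exists[OF subspace_W] by blast
  have F0: "F 0 = 0" using scale[of 0 0] mem_zero by simp
  have Fsum: "F (\<Sum>e\<in>S. c e *\<^sub>R e) = (\<Sum>e\<in>S. c e * F e)" if "finite S" "S \<subseteq> W" for S c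
    using that
  proof (induction S)
    case (insert e S)
    then have "(\<Sum>e\<in>S. c e *\<^sub>R e) \<in> W" by (intro mem_sum mem_scale) auto
    with insert show ?case using add[of "c e *\<^sub>R e" "\<Sum>e\<in>S. c e *\<^sub>R e"] by (auto simp: mem_scale scale)
  qed (auto simp: F0)
  let ?w = "\<Sum>e\<in>E. F e *\<^sub>R e"
  have wW: "?w \<in> W" using E by (intro mem_sum mem_scale) auto
  have "g ?w y = F y" if y: "y \<in> W" for y
  proof -
    have "g ?w y = (\<Sum>e\<in>E. F e * g e y)" using E y by (intro form_expand_left) auto
    also have "\<dots> = (\<Sum>e\<in>E. g y e * F e)" using E y by (intro sum.cong) (auto simp: form_sym)
    also have "\<dots> = F y" using Fsum[of E "g y"] E(2,3) E(4)[OF y] by simp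
    finally show ?thesis .
  qed
  with wW show ?thesis by (intro ex1I[of _ ?w]) (auto intro!: eq_by_testing)
qed

end

text \<open>The unit sphere of coefficient vectors. The abstract space W carries no topology, so the
  Rayleigh quotient is maximized over coefficients, which form a closed subset of a product of
  compact intervals.\<close>

lemma compact_sphere_fun:
  assumes "finite E"
  shows "compact {c::'a \<Rightarrow> real. (\<forall>e. e \<notin> E \<longrightarrow> c e = 0) \<and> (\<Sum>e\<in>E. (c e)\<^sup>2) = 1}" (is "compact ?S")
proof -
  let ?X = "\<lambda>e. if e \<in> E then {-1..1::real} else {0}"
  have "compactin (product_topology (\<lambda>_. euclidean) UNIV) (PiE UNIV ?X)"
    by (subst compactin_PiE) auto
  then have "compact (PiE UNIV ?X)"
    by (simp add: euclidean_product_topology)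
  moreover have "closed {c::'a \<Rightarrow> real. (\<Sum>e\<in>E. (c e)\<^sup>2) = 1}"
    by (intro closed_Collect_eq continuous_intros continuous_on_product_coordinates)
  ultimately have "compact (PiE UNIV ?X \<inter> {c. (\<Sum>e\<in>E. (c e)\<^sup>2) = 1})"
    by (rule compact_Int_closed)
  moreover have "PiE UNIV ?X \<inter> {c. (\<Sum>e\<in>E. (c e)\<^sup>2) = 1} = ?S"
  proof (intro set_eqI iffI)
    fix c assume "c \<in> PiE UNIV ?X \<inter> {c. (\<Sum>e\<in>E. (c e)\<^sup>2) = 1}"
    then have "\<forall>e. c e \<in> ?X e" "(\<Sum>e\<in>E. (c e)\<^sup>2) = 1"
      by (auto simp: PiE_UNIV_domain Pi_def)
    then show "c \<in> ?S" by (auto split: if_splits)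
  next
    fix c :: "'a \<Rightarrow> real" assume c: "c \<in> ?S"
    have "(c e)\<^sup>2 \<le> 1" if "e \<in> E" for e
      using c member_le_sum[OF that, of "\<lambda>e. (c e)\<^sup>2"] assms by auto
    then have "\<bar>c e\<bar> \<le> 1" if "e \<in> E" for e using that by (simp add: abs_square_le_1)
    with c show "c \<in> PiE UNIV ?X \<inter> {c. (\<Sum>e\<in>E. (c e)\<^sup>2) = 1}"
      by (auto simp: PiE_UNIV_domain Pi_def abs_le_iff)
  qed
  ultimately show ?thesis by simp
qed

section \<open>Self-adjoint operators and the spectral theorem\<close>

locale selfadj_op = fin_ip_space W g for W :: "'a::real_vector set" and g +
  fixes B :: "'a \<Rightarrow> 'a"
  assumes op_mem: "u \<in> W \<Longrightarrow> B u \<in> W"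
    and op_add: "u \<in> W \<Longrightarrow> v \<in> W \<Longrightarrow> B (u + v) = B u + B v"
    and op_scale: "u \<in> W \<Longrightarrow> B (c *\<^sub>R u) = c *\<^sub>R B u"
    and op_sym: "u \<in> W \<Longrightarrow> v \<in> W \<Longrightarrow> g (B u) v = g u (B v)"
begin

lemma op_zero: "B 0 = 0"
  using op_scale[of 0 0] mem_zero by simp

lemma op_expand:
  "finite S \<Longrightarrow> (\<And>i. i \<in> S \<Longrightarrow> f i \<in> W) \<Longrightarrow> B (\<Sum>i\<in>S. c i *\<^sub>R f i) = (\<Sum>i\<in>S. c i *\<^sub>R B (f i))"
proof (induction S rule: finite_induct)
  case (insert x F)
  then have "B (c x *\<^sub>R f x + (\<Sum>i\<in>F. c i *\<^sub>R f i)) = B (c x *\<^sub>R f x) + B (\<Sum>i\<in>F. c i *\<^sub>R f i)"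
    by (intro op_add mem_sum mem_scale) auto
  with insert show ?case by (simp add: op_scale)
qed (auto simp: op_zero)

text \<open>A maximizer of the Rayleigh quotient is an eigenvector: the form \<open>\<mu> g(u, v) - g(B u, v)\<close> is
  positive semidefinite and vanishes on the maximizer.\<close>

lemma eigenvector_exists:
  assumes U: "subspace U" "U \<subseteq> W" "U \<noteq> {0}" and inv: "\<And>u. u \<in> U \<Longrightarrow> B u \<in> U"
  obtains v \<mu> where "v \<in> U" "v \<noteq> 0" "B v = \<mu> *\<^sub>R v"
proof -
  obtain E where E: "orthonormal E" "E \<subseteq> U" "finite E" "\<And>v. v \<in> U \<Longrightarrow> v = (\<Sum>e\<in>E. g v e *\<^sub>R e)"
    using orthonormal_basis_exists[OF U(1,2)] by blast
  have EW: "\<And>e. e \<in> E \<Longrightarrow> e \<in> W" using E U by auto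
  define x where "x c = (\<Sum>e\<in>E. c e *\<^sub>R e)" for c :: "'a \<Rightarrow> real"
  have xU: "x c \<in> U" for c
    unfolding x_def using E by (intro subspace_sum[OF U(1)] subspace_scale[OF U(1)]) auto
  have xW: "x c \<in> W" for c using xU U by auto
  have gxx: "g (x c) (x c) = (\<Sum>e\<in>E. (c e)\<^sup>2)" for c
  proof -
    have "g (x c) (x c) = (\<Sum>e\<in>E. c e * g (x c) e)"
      unfolding x_def[of c] by (rule form_expand_right) (use EW xW in \<open>auto simp: x_def[symmetric]\<close>)
    also have "\<dots> = (\<Sum>e\<in>E. (c e)\<^sup>2)"
      unfolding x_def using orthonormal_coeff[OF E(1,3) order_refl]
      by (intro sum.cong) (auto simp: power2_eq_square)
    finally show ?thesis .
  qed
  define R where "R c = g (B (x c)) (x c)" for c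
  \<comment> \<open>In coordinates the quotient is a polynomial in finitely many variables, hence
    continuous for the product topology.\<close>
  have R_eq: "R c = (\<Sum>f\<in>E. c f * (\<Sum>e\<in>E. c e * g (B e) f))" for c
  proof -
    have "R c = (\<Sum>f\<in>E. c f * g (B (x c)) f)"
      unfolding R_def by (subst (2) x_def, rule form_expand_right) (use EW xW op_mem in auto)
    also have "\<dots> = (\<Sum>f\<in>E. c f * (\<Sum>e\<in>E. c e * g (B e) f))"
      using E(3) EW op_mem unfolding x_def
      by (intro sum.cong refl arg_cong2[where f="(*)"]) (subst op_expand; auto intro!: form_expand_left)
    finally show ?thesis .
  qed
  let ?S = "{c::'a \<Rightarrow> real. (\<forall>e. e \<notin> E \<longrightarrow> c e = 0) \<and> (\<Sum>e\<in>E. (c e)\<^sup>2) = 1}"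
  have coeffs: "x (\<lambda>e. if e \<in> E then g w e else 0) = w" if "w \<in> U" for w
    using E(4)[OF that] unfolding x_def by simp
  obtain w0 where w0: "w0 \<in> U" "w0 \<noteq> 0" using U subspace_0[OF U(1)] by blast
  have in_S: "(\<lambda>e. if e \<in> E then g w e else 0) \<in> ?S" if "w \<in> U" "g w w = 1" for w
    using gxx[of "\<lambda>e. if e \<in> E then g w e else 0"] coeffs[OF that(1)] that by simp
  have unit: "g ((1 / sqrt (g w w)) *\<^sub>R w) ((1 / sqrt (g w w)) *\<^sub>R w) = 1"
    if "w \<in> U" "w \<noteq> 0" for w
    using normalized_insert(1)[of "{}" w] that U by (auto simp: orthonormal_def)
  have ne_S: "?S \<noteq> {}"
    by (rule ex_in_conv[THEN iffD1], rule exI, rule in_S[OF subspace_scale[OF U(1) w0(1)] unit[OF w0]])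
  have "continuous_on UNIV (\<lambda>c. R c)"
    unfolding R_eq by (intro continuous_intros continuous_on_product_coordinates)
  then have cont_R: "continuous_on ?S R" by (rule continuous_on_subset) simp
  obtain c where c: "c \<in> ?S" and cmax: "\<forall>d\<in>?S. R d \<le> R c"
    by (rule bexE[OF continuous_attains_sup[OF compact_sphere_fun[OF E(3)] ne_S cont_R]])
  define v \<mu> where "v = x c" and "\<mu> = R c"
  have v: "v \<in> U" "g v v = 1" using xU c gxx by (auto simp: v_def)
  have vW: "v \<in> W" using v U by auto
  have bound1: "g (B w) w \<le> \<mu>" if "w \<in> U" "g w w = 1" for w
    using bspec[OF cmax in_S[OF that]] coeffs[OF that(1)] by (simp add: R_def \<mu>_def)
  have bound: "g (B w) w \<le> \<mu> * g w w" if w: "w \<in> U" for w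
  proof (cases "w = 0")
    case True then show ?thesis using mem_zero by (simp add: op_zero form_zero_left)
  next
    case False
    have wW: "w \<in> W" using w U by auto
    have pos: "g w w > 0" using wW False form_nonneg[of w] form_definite[of w] by fastforce
    define k where "k = 1 / sqrt (g w w)"
    have "k * (k * g (B w) w) \<le> \<mu>"
    proof -
      have "g (B (k *\<^sub>R w)) (k *\<^sub>R w) \<le> \<mu>"
        using bound1[OF subspace_scale[OF U(1) w] unit[OF w False]] unfolding k_def .
      moreover have "g (B (k *\<^sub>R w)) (k *\<^sub>R w) = k * (k * g (B w) w)"
        using wW op_mem[OF wW] by (simp only: op_scale form_scale_left form_scale_right mem_scale)
      ultimately show ?thesis by simp
    qed
    moreover have "k * (k * g (B w) w) = g (B w) w / g w w"
      using pos by (simp add: k_def)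
    ultimately show ?thesis using pos by (simp add: pos_divide_le_eq)
  qed
  interpret h: psd_form U "\<lambda>u w. \<mu> * g u w - g (B u) w"
  proof
    fix u w assume "u \<in> U" "w \<in> U"
    then have uw: "u \<in> W" "w \<in> W" using U by auto
    have "g (B u) w = g (B w) u" using op_sym[OF uw] form_sym[of u "B w"] uw op_mem by simp
    then show "\<mu> * g u w - g (B u) w = \<mu> * g w u - g (B w) u" using form_sym[OF uw] by simp
  next
    fix u v w assume "u \<in> U" "v \<in> U" "w \<in> U"
    then have "u \<in> W" "v \<in> W" "w \<in> W" using U by auto
    then show "\<mu> * g (u + v) w - g (B (u + v)) w = \<mu> * g u w - g (B u) w + (\<mu> * g v w - g (B v) w)"
      by (simp add: op_add form_add_left op_mem algebra_simps)
  next
    fix u w c assume "u \<in> U" "w \<in> U"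
    then have "u \<in> W" "w \<in> W" using U by auto
    then show "\<mu> * g (c *\<^sub>R u) w - g (B (c *\<^sub>R u)) w = c * (\<mu> * g u w - g (B u) w)"
      by (simp add: op_scale form_scale_left op_mem algebra_simps)
  qed (use U bound in auto)
  have zero: "\<mu> * g v w - g (B v) w = 0" if "w \<in> U" for w
    by (rule h.form_null[OF v(1) that]) (use v in \<open>simp add: R_def \<mu>_def v_def\<close>)
  let ?d = "\<mu> *\<^sub>R v - B v"
  have dU: "?d \<in> U" using v inv subspace_diff[OF U(1)] subspace_scale[OF U(1)] by auto
  have "g ?d ?d = 0"
    using zero[OF dU] dU U vW op_mem by (subst form_diff_left) (auto simp: form_scale_left mem_scale)
  then have "?d = 0" using form_definite[of ?d] dU U(2) by blast
  then have "B v = \<mu> *\<^sub>R v" by simp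
  moreover have "v \<noteq> 0" using v form_zero_left mem_zero by fastforce
  ultimately show thesis using that v by blast
qed

text \<open>By self-adjointness the orthogonal complement of a maximal orthonormal set of
  eigenvectors is invariant under B. If it were nonzero, it would contain one more eigenvector,
  against maximality.\<close>

theorem eigenbasis_exists:
  obtains E \<nu> where "orthonormal E" "finite E" "\<And>e. e \<in> E \<Longrightarrow> B e = \<nu> e *\<^sub>R e"
    "\<And>v. v \<in> W \<Longrightarrow> v = (\<Sum>e\<in>E. g v e *\<^sub>R e)"
proof -
  obtain E where E: "orthonormal E" "E \<subseteq> {v. \<exists>\<mu>. B v = \<mu> *\<^sub>R v}" "finite E"
    and max: "\<And>v. v \<in> {v. \<exists>\<mu>. B v = \<mu> *\<^sub>R v} \<Longrightarrow> orthonormal (insert v E) \<Longrightarrow> v \<in> E"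
    using maximal_orthonormal by blast
  from E(2) have "\<forall>e\<in>E. \<exists>\<mu>. B e = \<mu> *\<^sub>R e" by blast
  then obtain \<nu> where \<nu>: "\<And>e. e \<in> E \<Longrightarrow> B e = \<nu> e *\<^sub>R e" by metis
  have EW: "\<And>e. e \<in> E \<Longrightarrow> e \<in> W" using E by (auto simp: orthonormal_def)
  have "v = (\<Sum>e\<in>E. g v e *\<^sub>R e)" if v: "v \<in> W" for v
  proof (rule ccontr)
    let ?w = "v - (\<Sum>e\<in>E. g v e *\<^sub>R e)"
    assume "v \<noteq> (\<Sum>e\<in>E. g v e *\<^sub>R e)"
    then have ne: "?w \<noteq> 0" by simp
    define U where "U = {u \<in> W. \<forall>e\<in>E. g u e = 0}"
    have U: "subspace U" "U \<subseteq> W"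
      unfolding U_def subspace_def using EW
      by (auto simp: mem_zero mem_add mem_scale form_zero_left form_add_left form_scale_left)
    have wU: "?w \<in> U"
      unfolding U_def using v EW residual_orthogonal[OF E(1,3) v] by (auto intro!: mem_diff mem_sum mem_scale)
    have inv: "B u \<in> U" if "u \<in> U" for u
      using that EW op_mem \<nu> by (auto simp: U_def op_sym form_scale_right)
    obtain z \<mu> where z: "z \<in> U" "z \<noteq> 0" "B z = \<mu> *\<^sub>R z"
      using eigenvector_exists[OF U _ inv] wU ne by blast
    let ?z = "(1 / sqrt (g z z)) *\<^sub>R z"
    have zW: "z \<in> W" and "\<And>e. e \<in> E \<Longrightarrow> g z e = 0" using z by (auto simp: U_def)
    from normalized_insert[OF E(1) zW z(2) this(2)]
    have "orthonormal (insert ?z E)" "?z \<notin> E" by auto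
    moreover have "B ?z = \<mu> *\<^sub>R ?z" using z zW by (simp add: op_scale)
    ultimately show False using max by blast
  qed
  with E \<nu> that show thesis by blast
qed

end

section \<open>Square integrable functions\<close>

lemma L2_measurable: "u \<in> L2 \<Omega> \<Longrightarrow> set_borel_measurable lborel \<Omega> u"
  by (simp add: L2_def)

lemma set_borel_measurable_inner:
  fixes u v :: "'a \<Rightarrow> 'b::euclidean_space"
  assumes "set_borel_measurable M \<Omega> u" "set_borel_measurable M \<Omega> v"
  shows "set_borel_measurable M \<Omega> (\<lambda>x. u x \<bullet> v x)"
proof -
  have "(\<lambda>x. (indicator \<Omega> x *\<^sub>R u x) \<bullet> (indicator \<Omega> x *\<^sub>R v x)) \<in> borel_measurable M"
    using assms unfolding set_borel_measurable_def by (rule borel_measurable_inner)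
  also have "(\<lambda>x. (indicator \<Omega> x *\<^sub>R u x) \<bullet> (indicator \<Omega> x *\<^sub>R v x)) = (\<lambda>x. indicator \<Omega> x *\<^sub>R (u x \<bullet> v x))"
    by (auto simp: indicator_def)
  finally show ?thesis by (simp add: set_borel_measurable_def)
qed

lemma set_borel_measurable_scaleR_fun:
  fixes u :: "'a \<Rightarrow> real" and v :: "'a \<Rightarrow> 'b::euclidean_space"
  assumes "set_borel_measurable M \<Omega> u" "set_borel_measurable M \<Omega> v"
  shows "set_borel_measurable M \<Omega> (\<lambda>x. u x *\<^sub>R v x)"
proof -
  have "(\<lambda>x. (indicator \<Omega> x *\<^sub>R u x) *\<^sub>R (indicator \<Omega> x *\<^sub>R v x)) \<in> borel_measurable M"
    using assms unfolding set_borel_measurable_def by (rule borel_measurable_scaleR)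
  also have "(\<lambda>x. (indicator \<Omega> x *\<^sub>R u x) *\<^sub>R (indicator \<Omega> x *\<^sub>R v x)) = (\<lambda>x. indicator \<Omega> x *\<^sub>R (u x *\<^sub>R v x))"
    by (auto simp: indicator_def)
  finally show ?thesis by (simp add: set_borel_measurable_def)
qed

lemma set_borel_measurable_lincomb:
  fixes u v :: "'a \<Rightarrow> 'b::euclidean_space"
  assumes "set_borel_measurable M \<Omega> u" "set_borel_measurable M \<Omega> v"
  shows "set_borel_measurable M \<Omega> (b *\<^sub>R u + c *\<^sub>R v)"
proof -
  have "(\<lambda>x. b *\<^sub>R (indicator \<Omega> x *\<^sub>R u x) + c *\<^sub>R (indicator \<Omega> x *\<^sub>R v x)) \<in> borel_measurable M"
    using assms unfolding set_borel_measurable_def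
    by (intro borel_measurable_add[OF borel_measurable_scaleR borel_measurable_scaleR] borel_measurable_const)
  also have "(\<lambda>x. b *\<^sub>R (indicator \<Omega> x *\<^sub>R u x) + c *\<^sub>R (indicator \<Omega> x *\<^sub>R v x)) = (\<lambda>x. indicator \<Omega> x *\<^sub>R ((b *\<^sub>R u + c *\<^sub>R v) x))"
    by (auto simp: indicator_def)
  finally show ?thesis by (simp add: set_borel_measurable_def)
qed

lemma L2_square_sum_integrable:
  "u \<in> L2 \<Omega> \<Longrightarrow> v \<in> L2 \<Omega> \<Longrightarrow> set_integrable lborel \<Omega> (\<lambda>x. (norm (u x))\<^sup>2 + (norm (v x))\<^sup>2)"
  unfolding L2_def by (intro set_integral_add(1)) auto

lemma norm_mult_le_squares: "norm a * norm b \<le> (norm a)\<^sup>2 + (norm b)\<^sup>2"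
proof -
  have "0 \<le> norm a * norm b" by simp
  then show ?thesis using sum_squares_bound[of "norm a" "norm b"] by linarith
qed

lemma L2_inner_integrable:
  assumes "u \<in> L2 \<Omega>" "v \<in> L2 \<Omega>" shows "set_integrable lborel \<Omega> (\<lambda>x. u x \<bullet> v x)"
proof (rule set_integrable_bound[OF L2_square_sum_integrable[OF assms]])
  show "set_borel_measurable lborel \<Omega> (\<lambda>x. u x \<bullet> v x)"
    using assms by (intro set_borel_measurable_inner L2_measurable)
  show "AE x in lborel. x \<in> \<Omega> \<longrightarrow> norm (u x \<bullet> v x) \<le> norm ((norm (u x))\<^sup>2 + (norm (v x))\<^sup>2)"
    using Cauchy_Schwarz_ineq2[of "u x" "v x" for x] norm_mult_le_squares[of "u x" "v x" for x]
    by (intro AE_I2) (fastforce intro: order_trans)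
qed

lemma L2_scaleR_integrable:
  fixes u :: "real^'d \<Rightarrow> real" and v :: "real^'d \<Rightarrow> 'b::euclidean_space"
  assumes "u \<in> L2 \<Omega>" "v \<in> L2 \<Omega>" shows "set_integrable lborel \<Omega> (\<lambda>x. u x *\<^sub>R v x)"
proof (rule set_integrable_bound)
  show "set_integrable lborel \<Omega> (\<lambda>x. (norm (u x))\<^sup>2 + (norm (v x))\<^sup>2)"
    using assms unfolding L2_def by (intro set_integral_add(1)) auto
  show "set_borel_measurable lborel \<Omega> (\<lambda>x. u x *\<^sub>R v x)"
    using assms by (intro set_borel_measurable_scaleR_fun L2_measurable)
  show "AE x in lborel. x \<in> \<Omega> \<longrightarrow> norm (u x *\<^sub>R v x) \<le> norm ((norm (u x))\<^sup>2 + (norm (v x))\<^sup>2)"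
    using norm_mult_le_squares[of "u x" "v x" for x] by (intro AE_I2) simp
qed

lemma L2_lincomb:
  assumes u: "u \<in> L2 \<Omega>" and v: "v \<in> L2 \<Omega>"
  shows "b *\<^sub>R u + c *\<^sub>R v \<in> L2 \<Omega>"
proof -
  have meas: "set_borel_measurable lborel \<Omega> (b *\<^sub>R u + c *\<^sub>R v)"
    using u v by (intro set_borel_measurable_lincomb L2_measurable)
  have "set_integrable lborel \<Omega> (\<lambda>x. (norm ((b *\<^sub>R u + c *\<^sub>R v) x))\<^sup>2)"
  proof (rule set_integrable_bound)
    show "set_integrable lborel \<Omega> (\<lambda>x. 2 * b\<^sup>2 * (norm (u x))\<^sup>2 + 2 * c\<^sup>2 * (norm (v x))\<^sup>2)"
      using u v unfolding L2_def by (intro set_integral_add(1) set_integrable_mult_right) auto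
    show "set_borel_measurable lborel \<Omega> (\<lambda>x. (norm ((b *\<^sub>R u + c *\<^sub>R v) x))\<^sup>2)"
      using set_borel_measurable_inner[OF meas meas] by (simp only: power2_norm_eq_inner)
    show "AE x in lborel. x \<in> \<Omega> \<longrightarrow> norm ((norm ((b *\<^sub>R u + c *\<^sub>R v) x))\<^sup>2)
      \<le> norm (2 * b\<^sup>2 * (norm (u x))\<^sup>2 + 2 * c\<^sup>2 * (norm (v x))\<^sup>2)"
    proof (intro AE_I2 impI)
      fix x
      have "(norm (b *\<^sub>R u x + c *\<^sub>R v x))\<^sup>2 \<le> (\<bar>b\<bar> * norm (u x) + \<bar>c\<bar> * norm (v x))\<^sup>2"
        using norm_triangle_ineq[of "b *\<^sub>R u x" "c *\<^sub>R v x"] by (intro power_mono) auto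
      also have "\<dots> \<le> 2 * (\<bar>b\<bar> * norm (u x))\<^sup>2 + 2 * (\<bar>c\<bar> * norm (v x))\<^sup>2"
        using sum_squares_bound[of "\<bar>b\<bar> * norm (u x)" "\<bar>c\<bar> * norm (v x)"] by (simp add: power2_sum)
      finally show "norm ((norm ((b *\<^sub>R u + c *\<^sub>R v) x))\<^sup>2)
          \<le> norm (2 * b\<^sup>2 * (norm (u x))\<^sup>2 + 2 * c\<^sup>2 * (norm (v x))\<^sup>2)"
        by (simp add: power_mult_distrib)
    qed
  qed
  with meas show ?thesis by (simp add: L2_def)
qed

lemma L2_zero: "(0 :: real^'d \<Rightarrow> 'b::euclidean_space) \<in> L2 \<Omega>"
  by (simp add: L2_def set_borel_measurable_def set_integrable_def)

lemma subspace_L2: "subspace (L2 \<Omega> :: (real^'d \<Rightarrow> 'b::euclidean_space) set)"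
  unfolding subspace_def
proof (intro conjI ballI allI)
  fix u v :: "real^'d \<Rightarrow> 'b" and c assume u: "u \<in> L2 \<Omega>"
  show "c *\<^sub>R u \<in> L2 \<Omega>" using L2_lincomb[OF u u, of c 0] by simp
  assume v: "v \<in> L2 \<Omega>"
  show "u + v \<in> L2 \<Omega>" using L2_lincomb[OF u v, of 1 1] by simp
qed (rule L2_zero)

lemma L2_inner_commute: "L2_inner \<Omega> u v = L2_inner \<Omega> v u"
  by (simp add: L2_inner_def inner_commute)

interpretation L2: psd_form "L2 \<Omega> :: (real^'d \<Rightarrow> 'b::euclidean_space) set" "L2_inner \<Omega>"
proof
  fix u v w :: "real^'d \<Rightarrow> 'b" and c
  assume u: "u \<in> L2 \<Omega>" and w: "w \<in> L2 \<Omega>"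
  show "L2_inner \<Omega> (c *\<^sub>R u) w = c * L2_inner \<Omega> u w"
    by (simp add: L2_inner_def)
  show "0 \<le> L2_inner \<Omega> u u"
    by (simp add: L2_inner_def set_lebesgue_integral_def)
  assume v: "v \<in> L2 \<Omega>"
  show "L2_inner \<Omega> (u + v) w = L2_inner \<Omega> u w + L2_inner \<Omega> v w"
    using L2_inner_integrable[OF u w] L2_inner_integrable[OF v w]
    by (simp add: L2_inner_def inner_add_left set_integral_add(2))
qed (auto simp: L2_inner_commute subspace_L2)

text \<open>The representatives chosen by \<open>wd\<close> depend linearly on the function only up
  to null sets; this lemma lets such identities be used inside inner products.\<close>

lemma L2_inner_cong_AE:
  assumes "u \<in> L2 \<Omega>" "u' \<in> L2 \<Omega>" "v \<in> L2 \<Omega>" "AE x in lborel. x \<in> \<Omega> \<longrightarrow> u x = u' x"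
  shows "L2_inner \<Omega> u v = L2_inner \<Omega> u' v"
  unfolding L2_inner_def set_lebesgue_integral_def
proof (rule integral_cong_AE)
  show "(\<lambda>x. indicator \<Omega> x *\<^sub>R (u x \<bullet> v x)) \<in> borel_measurable lborel"
    "(\<lambda>x. indicator \<Omega> x *\<^sub>R (u' x \<bullet> v x)) \<in> borel_measurable lborel"
    using L2_inner_integrable[of _ \<Omega> v] assms unfolding set_integrable_def by auto
  show "AE x in lborel. indicator \<Omega> x *\<^sub>R (u x \<bullet> v x) = indicator \<Omega> x *\<^sub>R (u' x \<bullet> v x)"
    using assms(4) by eventually_elim (auto simp: indicator_def)
qed

section \<open>Test functions\<close>

lemma pderiv_at_eq: "(f has_derivative f') (at x) \<Longrightarrow> pderiv_at j f x = f' (axis j 1)"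
  unfolding pderiv_at_def by (simp flip: frechet_derivative_at)

lemma differentiable_UNIV_has_derivative:
  "f differentiable_on UNIV \<Longrightarrow> (f has_derivative frechet_derivative f (at x)) (at x)"
  by (simp add: differentiable_on_def frechet_derivative_works)

lemma pderiv_at_lincomb:
  fixes f g :: "real^'d \<Rightarrow> 'b::euclidean_space"
  assumes "f differentiable_on UNIV" "g differentiable_on UNIV"
  shows "pderiv_at j (b *\<^sub>R f + c *\<^sub>R g) = b *\<^sub>R pderiv_at j f + c *\<^sub>R pderiv_at j g"
proof
  fix x
  have "((\<lambda>x. b *\<^sub>R f x + c *\<^sub>R g x) has_derivative
      (\<lambda>h. b *\<^sub>R frechet_derivative f (at x) h + c *\<^sub>R frechet_derivative g (at x) h)) (at x)"
    using assms[THEN differentiable_UNIV_has_derivative] by (intro derivative_intros) auto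
  moreover have "(\<lambda>x. b *\<^sub>R f x + c *\<^sub>R g x) = b *\<^sub>R f + c *\<^sub>R g" by (simp add: fun_eq_iff)
  ultimately show "pderiv_at j (b *\<^sub>R f + c *\<^sub>R g) x = (b *\<^sub>R pderiv_at j f + c *\<^sub>R pderiv_at j g) x"
    using pderiv_at_eq[of "b *\<^sub>R f + c *\<^sub>R g"] by (simp add: pderiv_at_def)
qed

lemma pderiv_at_scaleR:
  fixes f :: "real^'d \<Rightarrow> real" and g :: "real^'d \<Rightarrow> 'b::euclidean_space"
  assumes "f differentiable_on UNIV" "g differentiable_on UNIV"
  shows "pderiv_at j (\<lambda>x. f x *\<^sub>R g x) = (\<lambda>x. f x *\<^sub>R pderiv_at j g x + pderiv_at j f x *\<^sub>R g x)"
proof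
  fix x
  have "((\<lambda>x. f x *\<^sub>R g x) has_derivative
      (\<lambda>h. f x *\<^sub>R frechet_derivative g (at x) h + frechet_derivative f (at x) h *\<^sub>R g x)) (at x)"
    using assms[THEN differentiable_UNIV_has_derivative] by (intro derivative_intros) auto
  then show "pderiv_at j (\<lambda>x. f x *\<^sub>R g x) x = f x *\<^sub>R pderiv_at j g x + pderiv_at j f x *\<^sub>R g x"
    by (simp add: pderiv_at_eq) (simp add: pderiv_at_def)
qed

lemma differentiable_lincomb:
  fixes f g :: "real^'d \<Rightarrow> 'b::euclidean_space"
  assumes "f differentiable_on UNIV" "g differentiable_on UNIV"
  shows "b *\<^sub>R f + c *\<^sub>R g differentiable_on UNIV"
proof -
  have "(\<lambda>x. b *\<^sub>R f x + c *\<^sub>R g x) differentiable_on UNIV"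
    using assms unfolding differentiable_on_def
    by (auto intro!: differentiable_add differentiable_scaleR)
  moreover have "(\<lambda>x. b *\<^sub>R f x + c *\<^sub>R g x) = b *\<^sub>R f + c *\<^sub>R g" by (simp add: fun_eq_iff)
  ultimately show ?thesis by simp
qed

lemma Ck_lincomb: "Ck k f \<Longrightarrow> Ck k g \<Longrightarrow> Ck k (b *\<^sub>R f + c *\<^sub>R g)"
proof (induction k arbitrary: f g)
  case 0
  then have "continuous_on UNIV (\<lambda>x. b *\<^sub>R f x + c *\<^sub>R g x)" by (auto intro!: continuous_intros)
  moreover have "(\<lambda>x. b *\<^sub>R f x + c *\<^sub>R g x) = b *\<^sub>R f + c *\<^sub>R g" by (simp add: fun_eq_iff)
  ultimately show ?case by simp
qed (auto simp: differentiable_lincomb pderiv_at_lincomb)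

lemma Ck_lower: "Ck (Suc k) f \<Longrightarrow> Ck k f"
proof (induction k arbitrary: f)
  case 0 then show ?case by (auto intro: differentiable_imp_continuous_on)
next
  case (Suc k) from Suc.prems Suc.IH show ?case by (simp only: Ck.simps(2)) blast
qed

text \<open>Induction on the order by the Leibniz rule: both summands of a partial derivative are
  products of functions of one order less.\<close>

lemma Ck_scaleR:
  fixes f :: "real^'d \<Rightarrow> real" and g :: "real^'d \<Rightarrow> 'b::euclidean_space"
  shows "Ck k f \<Longrightarrow> Ck k g \<Longrightarrow> Ck k (\<lambda>x. f x *\<^sub>R g x)"
proof (induction k arbitrary: f g)
  case 0 then show ?case by (auto intro!: continuous_intros)
next
  case (Suc k)
  then have d: "f differentiable_on UNIV" "g differentiable_on UNIV" by auto
  have "(\<lambda>x. f x *\<^sub>R g x) differentiable_on UNIV"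
    using d by (auto simp: differentiable_on_def intro!: differentiable_scaleR)
  moreover have "Ck k (pderiv_at j (\<lambda>x. f x *\<^sub>R g x))" for j
  proof -
    have eq: "pderiv_at j (\<lambda>x. f x *\<^sub>R g x) = 1 *\<^sub>R (\<lambda>x. f x *\<^sub>R pderiv_at j g x) + 1 *\<^sub>R (\<lambda>x. pderiv_at j f x *\<^sub>R g x)"
      unfolding pderiv_at_scaleR[OF d, of j] by (simp add: fun_eq_iff)
    have "Ck k f" "Ck k g" using Suc.prems by (auto intro: Ck_lower)
    moreover have "Ck k (pderiv_at j f)" "Ck k (pderiv_at j g)" using Suc.prems by auto
    ultimately show ?thesis unfolding eq by (intro Ck_lincomb Suc.IH)
  qed
  ultimately show ?case by simp
qed

lemma Ck_mult:
  fixes f g :: "real^'d \<Rightarrow> real"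
  shows "Ck k f \<Longrightarrow> Ck k g \<Longrightarrow> Ck k (\<lambda>x. f x * g x)"
  using Ck_scaleR[of k f g] by simp

lemma Ck_const: "Ck k (\<lambda>x::real^'d. c::'b::euclidean_space)"
proof (induction k arbitrary: c)
  case (Suc k)
  have "pderiv_at j (\<lambda>x::real^'d. c) = (\<lambda>x. 0)" for j
    by (rule ext, rule pderiv_at_eq[OF has_derivative_const])
  with Suc show ?case by simp
qed simp

lemma Ck_prod:
  fixes f :: "'i \<Rightarrow> real^'d \<Rightarrow> real"
  shows "(\<And>i. i \<in> S \<Longrightarrow> Ck k (f i)) \<Longrightarrow> Ck k (\<lambda>x. \<Prod>i\<in>S. f i x)"
  by (induction S rule: infinite_finite_induct) (auto simp: Ck_const intro!: Ck_mult)

text \<open>The derivatives of \<open>exp (- \<epsilon> / t)\<close> on the half line are combinations of these functions.\<close>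

definition cutoff :: "real \<Rightarrow> nat \<Rightarrow> real \<Rightarrow> real" where
  "cutoff \<epsilon> n t = (if t > 0 then (1 / t) ^ n * exp (- \<epsilon> / t) else 0)"

lemma power_over_fact_le_exp: "0 \<le> (y::real) \<Longrightarrow> y ^ n / fact n \<le> exp y"
  using sum_le_suminf[OF summable_exp_generic[of y], of "{n}"]
  by (simp add: exp_def divide_inverse mult.commute)

text \<open>Take y = \<epsilon> / t in y^(n+1) / (n+1)! \<le> exp y. One power more than n is spent
  so that the bound is linear in t and forces the limit 0 at the origin.\<close>

lemma cutoff_bound:
  assumes "\<epsilon> > 0" shows "\<bar>cutoff \<epsilon> n t\<bar> \<le> fact (Suc n) / \<epsilon> ^ Suc n * \<bar>t\<bar>"
proof (cases "t > 0")
  case True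
  let ?F = "fact (Suc n) :: real"
  have pos: "(\<epsilon> / t) ^ Suc n > 0" using True assms by simp
  have "(\<epsilon> / t) ^ Suc n \<le> exp (\<epsilon> / t) * ?F"
    using power_over_fact_le_exp[of "\<epsilon> / t" "Suc n"] True assms by (simp add: pos_divide_le_eq del: power_Suc fact_Suc)
  moreover have "inverse E \<le> F / y" if "y \<le> E * F" "y > 0" "E > 0" for E F y :: real
    using that by (simp add: field_simps)
  ultimately have "exp (- (\<epsilon> / t)) \<le> ?F / (\<epsilon> / t) ^ Suc n"
    using pos unfolding exp_minus by (metis exp_gt_zero)
  then have "(1 / t) ^ n * exp (- (\<epsilon> / t)) \<le> (1 / t) ^ n * (?F / (\<epsilon> / t) ^ Suc n)"
    using True by (intro mult_left_mono) auto
  also have "\<dots> = ?F / \<epsilon> ^ Suc n * t"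
    using True assms by (simp add: power_divide field_simps del: fact_Suc)
  finally show ?thesis using True by (simp add: cutoff_def del: power_Suc fact_Suc)
next
  case False
  have "0 \<le> fact (Suc n) / \<epsilon> ^ Suc n * \<bar>t\<bar>"
    using assms by (intro mult_nonneg_nonneg) auto
  with False show ?thesis by (simp add: cutoff_def)
qed

text \<open>The derivative stays in the linear span of the family, also at 0, so smoothness of all
  orders follows by induction on the order with n arbitrary.\<close>

lemma cutoff_DERIV:
  assumes "\<epsilon> > 0"
  shows "(cutoff \<epsilon> n has_real_derivative \<epsilon> * cutoff \<epsilon> (n + 2) t - real n * cutoff \<epsilon> (n + 1) t) (at t)"
proof -
  consider "t > 0" | "t < 0" | "t = 0" by linarith
  then show ?thesis
  proof cases
    case 1
    have inv: "((\<lambda>t. 1 / t) has_real_derivative - (1 / t\<^sup>2)) (at t)"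
      using 1 by (auto intro!: derivative_eq_intros simp: power2_eq_square)
    have "real n * (- (1 / t\<^sup>2) * (1 / t) ^ (n - Suc 0)) = - (real n * (1 / t) ^ (n + 1))"
      by (cases n) (auto simp: power2_eq_square)
    with DERIV_power[OF inv, of n]
    have "((\<lambda>t. (1 / t) ^ n) has_real_derivative - (real n * (1 / t) ^ (n + 1))) (at t)" by simp
    moreover have "((\<lambda>t. exp (- \<epsilon> / t)) has_real_derivative exp (- \<epsilon> / t) * (\<epsilon> * (1 / t) ^ 2)) (at t)"
      using 1 by (auto intro!: derivative_eq_intros simp: power2_eq_square)
    ultimately have "((\<lambda>t. (1 / t) ^ n * exp (- \<epsilon> / t)) has_real_derivative
       - (real n * (1 / t) ^ (n + 1)) * exp (- \<epsilon> / t) + exp (- \<epsilon> / t) * (\<epsilon> * (1 / t) ^ 2) * (1 / t) ^ n) (at t)"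
      by (rule DERIV_mult)
    moreover have "- (real n * (1 / t) ^ (n + 1)) * exp (- \<epsilon> / t) + exp (- \<epsilon> / t) * (\<epsilon> * (1 / t) ^ 2) * (1 / t) ^ n
        = \<epsilon> * cutoff \<epsilon> (n + 2) t - real n * cutoff \<epsilon> (n + 1) t"
      using 1 by (simp add: cutoff_def power_add power2_eq_square algebra_simps)
    ultimately have "((\<lambda>t. (1 / t) ^ n * exp (- \<epsilon> / t)) has_real_derivative
       \<epsilon> * cutoff \<epsilon> (n + 2) t - real n * cutoff \<epsilon> (n + 1) t) (at t)" by simp
    then show ?thesis
      by (rule has_field_derivative_transform_within_open[of _ _ _ "{0<..}"])
        (use 1 in \<open>auto simp: cutoff_def\<close>)
  next
    case 2
    have "((\<lambda>t. 0) has_real_derivative 0) (at t)" by simp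
    then have "(cutoff \<epsilon> n has_real_derivative 0) (at t)"
      by (rule has_field_derivative_transform_within_open[of _ _ _ "{..<0}"])
        (use 2 in \<open>auto simp: cutoff_def\<close>)
    with 2 show ?thesis using assms by (simp add: cutoff_def)
  next
    case 3
    have "((\<lambda>h. cutoff \<epsilon> (Suc n) h) \<longlongrightarrow> 0) (at 0)"
    proof (rule Lim_null_comparison)
      show "\<forall>\<^sub>F h in at 0. norm (cutoff \<epsilon> (Suc n) h) \<le> fact (Suc (Suc n)) / \<epsilon> ^ Suc (Suc n) * \<bar>h\<bar>"
        by (intro always_eventually allI) (simp only: real_norm_def cutoff_bound[OF assms])
      show "((\<lambda>h::real. fact (Suc (Suc n)) / \<epsilon> ^ Suc (Suc n) * \<bar>h\<bar>) \<longlongrightarrow> 0) (at 0)"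
        using assms by (auto intro!: tendsto_eq_intros)
    qed
    \<comment> \<open>The difference quotient at 0 is again a member of the family, with one more
      factor 1 / t.\<close>
    moreover have "cutoff \<epsilon> (Suc n) h = (cutoff \<epsilon> n (0 + h) - cutoff \<epsilon> n 0) / h" for h
      by (simp add: cutoff_def)
    ultimately show ?thesis using 3 by (simp add: DERIV_def cutoff_def)
  qed
qed

lemma Ck_cutoff:
  assumes "\<epsilon> > 0"
  shows "Ck k (\<lambda>x::real^'d. cutoff \<epsilon> n (s * x $ i + d))"
proof (induction k arbitrary: n)
  case 0
  have "continuous_on UNIV (cutoff \<epsilon> n)"
    using cutoff_DERIV[OF assms] by (auto intro!: DERIV_continuous_on)
  then show ?case
    by (auto intro!: continuous_on_compose2[of UNIV "cutoff \<epsilon> n"] continuous_intros)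
next
  case (Suc k)
  let ?F = "\<lambda>n (x::real^'d). cutoff \<epsilon> n (s * x $ i + d)"
  have der: "(?F n has_derivative (\<lambda>h. (\<epsilon> * ?F (n + 2) x - real n * ?F (n + 1) x) * (s * h $ i))) (at x)" for x
  proof -
    have "((\<lambda>x. s * x $ i + d) has_derivative (\<lambda>h::real^'d. s * h $ i)) (at x)"
      by (auto intro!: derivative_eq_intros bounded_linear_imp_has_derivative bounded_linear_vec_nth)
    from has_derivative_compose[OF this has_field_derivative_imp_has_derivative[OF cutoff_DERIV[OF assms]]]
    show ?thesis by simp
  qed
  have "?F n differentiable_on UNIV"
    using der unfolding differentiable_on_def differentiable_def by blast
  moreover have "Ck k (pderiv_at j (?F n))" for j
  proof -
    define q :: real where "q = (if j = i then s else 0)"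
    have "pderiv_at j (?F n) = (\<epsilon> * q) *\<^sub>R ?F (n + 2) + (- real n * q) *\<^sub>R ?F (n + 1)"
    proof
      fix x
      show "pderiv_at j (?F n) x = ((\<epsilon> * q) *\<^sub>R ?F (n + 2) + (- real n * q) *\<^sub>R ?F (n + 1)) x"
        unfolding pderiv_at_eq[OF der] by (simp add: q_def axis_def algebra_simps)
    qed
    then show ?thesis using Ck_lincomb[OF Suc.IH Suc.IH] by (simp only:)
  qed
  ultimately show ?case by simp
qed

text \<open>No convolution is used: each face of the box contributes a factor exp (- \<epsilon> /
  distance), and \<epsilon> tending to 0 gives the indicator of the open box while the support stays
  in the same closed box.\<close>

definition bump :: "real \<Rightarrow> real^'d \<Rightarrow> real^'d \<Rightarrow> real^'d \<Rightarrow> real" where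
  "bump \<epsilon> a b x = (\<Prod>i\<in>UNIV. cutoff \<epsilon> 0 (x $ i - a $ i) * cutoff \<epsilon> 0 (b $ i - x $ i))"

lemma bump_zero: "x \<notin> box a b \<Longrightarrow> bump \<epsilon> a b x = 0"
  unfolding bump_def by (rule prod_zero) (auto simp: mem_box_cart cutoff_def)

lemma bump_range: "\<epsilon> > 0 \<Longrightarrow> 0 \<le> bump \<epsilon> a b x \<and> bump \<epsilon> a b x \<le> 1"
  unfolding bump_def by (auto intro!: prod_nonneg prod_le_1 mult_le_one simp: cutoff_def)

lemma test_function_bump:
  assumes "\<epsilon> > 0" "cbox a b \<subseteq> \<Omega>" shows "test_function \<Omega> (bump \<epsilon> a b)"
proof -
  have sub: "closure {x. bump \<epsilon> a b x \<noteq> 0} \<subseteq> cbox a b"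
    using bump_zero[of _ a b \<epsilon>] box_subset_cbox[of a b] by (intro closure_minimal) auto
  then have "compact (closure {x. bump \<epsilon> a b x \<noteq> 0})"
    by (meson bounded_cbox bounded_subset closed_closure compact_eq_bounded_closed)
  moreover have "Ck k (bump \<epsilon> a b)" for k
    unfolding bump_def using Ck_cutoff[OF assms(1), of k 0 1 _ "- a $ i" for i] Ck_cutoff[OF assms(1), of k 0 "-1" _ "b $ i" for i]
    by (intro Ck_prod Ck_mult) auto
  ultimately show ?thesis using sub assms unfolding test_function_def by auto
qed

lemma bump_limit:
  fixes a b :: "real^'d"
  shows "(\<lambda>m. bump (1 / real (Suc m)) a b x) \<longlonglongrightarrow> indicator (box a b) x"
proof (cases "x \<in> box a b")
  case False then show ?thesis by (simp add: bump_zero)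
next
  case True
  have *: "(\<lambda>m. cutoff (1 / real (Suc m)) 0 t) \<longlonglongrightarrow> 1" if "t > 0" for t
  proof -
    have "(\<lambda>m. exp (- (1 / real (Suc m)) / t)) \<longlonglongrightarrow> exp (- 0 / t)"
      using LIMSEQ_inverse_real_of_nat that by (intro tendsto_intros) (auto simp: inverse_eq_divide)
    with that show ?thesis by (simp add: cutoff_def)
  qed
  have factors: "(\<lambda>m. cutoff (1 / real (Suc m)) 0 (x $ i - a $ i) * cutoff (1 / real (Suc m)) 0 (b $ i - x $ i))
      \<longlonglongrightarrow> 1 * 1" for i
    using True by (intro tendsto_mult *) (auto simp: mem_box_cart)
  have "(\<lambda>m. bump (1 / real (Suc m)) a b x) \<longlonglongrightarrow> (\<Prod>i\<in>(UNIV::'d set). 1 * 1)"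
    unfolding bump_def by (rule tendsto_prod) (rule factors)
  with True show ?thesis by simp
qed

section \<open>The fundamental lemma of the calculus of variations\<close>

lemma integrable_zero_on_boxes_imp_AE_zero:
  fixes g :: "'a::euclidean_space \<Rightarrow> 'b::euclidean_space"
  assumes g: "integrable lborel g" and boxes: "\<And>a b. (LINT x:box a b|lborel. g x) = 0"
  shows "AE x in lborel. g x = 0"
proof (rule sigma_finite_measure.density_zero[OF lborel.sigma_finite_measure_axioms g])
  let ?G = "range (\<lambda>(a, b). box a b :: 'a set)"
  have borel: "sets (borel :: 'a measure) = sigma_sets UNIV ?G"
    by (subst borel_eq_box, rule sets_measure_of) simp
  have int: "set_integrable lborel A g" if "A \<in> sets borel" for A
    unfolding set_integrable_def using g that by (intro integrable_mult_indicator) auto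
  \<comment> \<open>The whole space is not a box, but growing boxes exhaust it. Its integral is
    needed for the complements in the induction below.\<close>
  have total: "(LINT x|lborel. g x) = 0"
  proof -
    define b where "b n = (\<Sum>i\<in>Basis. real n *\<^sub>R i :: 'a)" for n
    have "(\<lambda>n. LINT x:box (- b n) (b n)|lborel. g x) \<longlonglongrightarrow> (LINT x|lborel. g x)"
      unfolding set_lebesgue_integral_def
    proof (rule integral_dominated_convergence)
      show "integrable lborel (\<lambda>x. norm (g x))" using g by simp
      show "AE x in lborel. (\<lambda>n. indicat_real (box (- b n) (b n)) x *\<^sub>R g x) \<longlonglongrightarrow> g x"
      proof (intro AE_I2 tendsto_eventually)
        fix x :: 'a
        obtain N where N: "norm x < real N" using reals_Archimedean2 by blast
        show "\<forall>\<^sub>F n in sequentially. indicat_real (box (- b n) (b n)) x *\<^sub>R g x = g x"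
          using eventually_ge_at_top[of N]
        proof eventually_elim
          case (elim n)
          have "x \<in> box (- b n) (b n)"
            unfolding mem_box
          proof (intro ballI)
            fix i :: 'a assume i: "i \<in> Basis"
            have "\<bar>x \<bullet> i\<bar> < real n" using Basis_le_norm[OF i, of x] N elim by linarith
            then show "(- b n) \<bullet> i < x \<bullet> i \<and> x \<bullet> i < b n \<bullet> i"
              using i by (simp add: b_def abs_less_iff)
          qed
          then show ?case by simp
        qed
      qed
    qed (use g in \<open>auto simp: indicator_def\<close>)
    then show ?thesis by (simp add: boxes LIMSEQ_const_iff)
  qed
  fix A :: "'a set" assume "A \<in> sets lborel"
  then have A: "A \<in> sigma_sets UNIV ?G" by (simp add: borel)
  \<comment> \<open>Open boxes are stable under intersection and generate the Borel sets, so it is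
    enough that the sets of integral zero form a Dynkin system.\<close>
  have "Int_stable ?G" by (auto simp: Int_stable_def box_Int_box)
  moreover have "?G \<subseteq> Pow UNIV" by simp
  ultimately show "(LINT x:A|lborel. g x) = 0"
    using A
  proof (induction rule: sigma_sets_induct_disjoint)
    case (basic A) then show ?case by (auto simp: boxes)
  next
    case empty show ?case by (simp add: set_lebesgue_integral_def)
  next
    case (compl A)
    then have A: "A \<in> sets borel" by (simp add: borel)
    have "(UNIV - A) \<inter> A = {}" by auto
    from set_integral_Un[OF this int int] A
    have "(LINT x:UNIV - A|lborel. g x) + (LINT x:A|lborel. g x) = (LINT x:UNIV|lborel. g x)" by simp
    also have "\<dots> = 0" using total by (simp add: set_lebesgue_integral_def)
    finally show ?case using compl by simp
  next
    case (union A)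
    then have A: "A i \<in> sets borel" for i by (auto simp: borel)
    have "(LINT x:(\<Union>i. A i)|lborel. g x) = (\<Sum>i. LINT x:A i|lborel. g x)"
      using A union(1) by (intro lebesgue_integral_countable_add int) (auto simp: disjoint_family_on_def)
    with union show ?case by simp
  qed
qed

lemma test_function_bounded:
  fixes \<phi> :: "real^'d \<Rightarrow> 'b::euclidean_space"
  assumes "test_function \<Omega> \<phi>" obtains M where "\<And>x. norm (\<phi> x) \<le> M"
proof -
  let ?K = "closure {x. \<phi> x \<noteq> 0}"
  have "continuous_on UNIV \<phi>" using assms unfolding test_function_def by (metis Ck.simps(1))
  then have "compact (\<phi> ` ?K)"
    using assms unfolding test_function_def by (intro compact_continuous_image) (auto intro: continuous_on_subset)
  then obtain M where M: "\<And>y. y \<in> \<phi> ` ?K \<Longrightarrow> norm y \<le> M"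
    using compact_imp_bounded bounded_iff by metis
  have "norm (\<phi> x) \<le> max M 0" for x
    using M[of "\<phi> x"] closure_subset[of "{x. \<phi> x \<noteq> 0}"] by (cases "\<phi> x = 0") (auto simp: le_max_iff_disj)
  then show thesis by (rule that)
qed

lemma test_function_continuous: "test_function \<Omega> \<phi> \<Longrightarrow> continuous_on UNIV \<phi>"
  unfolding test_function_def by (metis Ck.simps(1))

lemma test_function_zero_outside: "test_function \<Omega> \<phi> \<Longrightarrow> x \<notin> \<Omega> \<Longrightarrow> \<phi> x = 0"
  unfolding test_function_def using closure_subset[of "{x. \<phi> x \<noteq> 0}"] by auto

lemma set_borel_measurable_continuous:
  fixes f :: "'a::euclidean_space \<Rightarrow> 'b::euclidean_space"
  assumes "A \<in> sets borel" "f \<in> borel_measurable borel"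
  shows "set_borel_measurable lborel A f"
  unfolding set_borel_measurable_def using assms by measurable

lemma test_function_L2:
  fixes \<phi> :: "real^'d \<Rightarrow> 'b::euclidean_space"
  assumes \<phi>: "test_function \<Omega> \<phi>" and \<Omega>: "\<Omega> \<in> sets borel" shows "\<phi> \<in> L2 \<Omega>"
proof -
  let ?K = "closure {x. \<phi> x \<noteq> 0}"
  obtain M where M: "\<And>x. norm (\<phi> x) \<le> M" using test_function_bounded[OF \<phi>] by blast
  have meas: "\<phi> \<in> borel_measurable borel"
    using test_function_continuous[OF \<phi>] by (rule borel_measurable_continuous_onI)
  have K: "compact ?K" using \<phi> by (simp add: test_function_def)
  have "set_integrable lborel \<Omega> (\<lambda>x. (norm (\<phi> x))\<^sup>2)"
  proof (rule set_integrable_bound)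
    have "integrable lborel (indicat_real ?K)"
      using emeasure_compact_finite[OF K] by (intro integrable_real_indicator) auto
    then have "integrable lborel (\<lambda>x. indicat_real \<Omega> x *\<^sub>R indicat_real ?K x)"
      using \<Omega> by (intro integrable_mult_indicator) auto
    then show "set_integrable lborel \<Omega> (\<lambda>x. M\<^sup>2 * indicat_real ?K x)"
      unfolding set_integrable_def
      by (simp add: mult.left_commute[of _ "M\<^sup>2"])
    show "set_borel_measurable lborel \<Omega> (\<lambda>x. (norm (\<phi> x))\<^sup>2)"
      using meas by (intro set_borel_measurable_continuous[OF \<Omega>]) measurable
    show "AE x in lborel. x \<in> \<Omega> \<longrightarrow> norm ((norm (\<phi> x))\<^sup>2) \<le> norm (M\<^sup>2 * indicat_real ?K x)"
    proof (intro AE_I2 impI)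
      fix x
      show "norm ((norm (\<phi> x))\<^sup>2) \<le> norm (M\<^sup>2 * indicat_real ?K x)"
        using M[of x] closure_subset[of "{x. \<phi> x \<noteq> 0}"] power_mono[OF M[of x], of 2]
        by (cases "\<phi> x = 0") (auto simp: indicator_def)
    qed
  qed
  with meas \<Omega> show ?thesis by (simp add: L2_def set_borel_measurable_continuous)
qed

text \<open>Bumps converge dominatedly to indicators of boxes, so g integrates to zero over every
  box with closure in \<Omega>. Countably many closed boxes cover \<Omega>, and
  \<open>integrable_zero_on_boxes_imp_AE_zero\<close> applies in each of them.\<close>

theorem fundamental_lemma:
  fixes g :: "real^'d \<Rightarrow> 'b::euclidean_space"
  assumes \<Omega>: "open \<Omega>" and g: "g \<in> L2 \<Omega>"
    and test: "\<And>\<phi>::real^'d \<Rightarrow> real. test_function \<Omega> \<phi> \<Longrightarrow> (LINT x:\<Omega>|lborel. \<phi> x *\<^sub>R g x) = 0"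
  shows "AE x in lborel. x \<in> \<Omega> \<longrightarrow> g x = 0"
proof -
  have \<Omega>b: "\<Omega> \<in> sets borel" using \<Omega> by simp
  have gm: "(\<lambda>x. indicat_real \<Omega> x *\<^sub>R g x) \<in> borel_measurable lborel"
    using g by (simp add: L2_def set_borel_measurable_def)
  \<comment> \<open>g is only square integrable, but a box has finite volume and norm (g x) is at
    most 1 + (norm (g x))^2.\<close>
  have box_int: "integrable lborel (\<lambda>x. indicat_real (box a b) x *\<^sub>R g x)" if "cbox a b \<subseteq> \<Omega>" for a b
  proof (rule Bochner_Integration.integrable_bound)
    have "integrable lborel (indicat_real (box a b))"
      by (intro integrable_real_indicator) (use emeasure_lborel_box_finite in auto)
    moreover have "integrable lborel (\<lambda>x. indicat_real \<Omega> x *\<^sub>R (norm (g x))\<^sup>2)"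
      using g by (simp add: L2_def set_integrable_def)
    ultimately show "integrable lborel (\<lambda>x. indicat_real (box a b) x + indicat_real \<Omega> x *\<^sub>R (norm (g x))\<^sup>2)"
      by (rule Bochner_Integration.integrable_add)
    have sub: "box a b \<subseteq> \<Omega>" using that box_subset_cbox by blast
    have "(\<lambda>x. indicat_real (box a b) x *\<^sub>R g x) = (\<lambda>x. indicat_real (box a b) x *\<^sub>R (indicat_real \<Omega> x *\<^sub>R g x))"
      using sub by (auto simp: indicator_def fun_eq_iff)
    moreover have "(\<lambda>x. indicat_real (box a b) x *\<^sub>R (indicat_real \<Omega> x *\<^sub>R g x)) \<in> borel_measurable lborel"
      by (intro borel_measurable_scaleR[OF _ gm]) simp
    ultimately show "(\<lambda>x. indicat_real (box a b) x *\<^sub>R g x) \<in> borel_measurable lborel"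
      by (simp only:)
    show "AE x in lborel. norm (indicat_real (box a b) x *\<^sub>R g x) \<le> norm (indicat_real (box a b) x + indicat_real \<Omega> x *\<^sub>R (norm (g x))\<^sup>2)"
    proof (intro AE_I2)
      fix x
      have "2 * norm (g x) \<le> 1 + (norm (g x))\<^sup>2" using sum_squares_bound[of 1 "norm (g x)"] by simp
      then have "norm (g x) \<le> 1 + (norm (g x))\<^sup>2" using norm_ge_zero[of "g x"] by linarith
      then show "norm (indicat_real (box a b) x *\<^sub>R g x) \<le> norm (indicat_real (box a b) x + indicat_real \<Omega> x *\<^sub>R (norm (g x))\<^sup>2)"
        using sub by (auto simp: indicator_def)
    qed
  qed
  have box_zero: "(LINT x:box a b|lborel. g x) = 0" if ab: "cbox a b \<subseteq> \<Omega>" for a b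
  proof -
    let ?\<beta> = "\<lambda>m. bump (1 / real (Suc m)) a b"
    have sub: "box a b \<subseteq> \<Omega>" using that box_subset_cbox by blast
    have b_test: "test_function \<Omega> (?\<beta> m)" for m by (rule test_function_bump[OF _ ab]) simp
    have "(\<lambda>m. LINT x:\<Omega>|lborel. ?\<beta> m x *\<^sub>R g x) \<longlonglongrightarrow> (LINT x:box a b|lborel. g x)"
      unfolding set_lebesgue_integral_def
    proof (rule integral_dominated_convergence)
      show "(\<lambda>x. indicat_real (box a b) x *\<^sub>R g x) \<in> borel_measurable lborel"
        using box_int[OF ab] by simp
      show "(\<lambda>x. indicat_real \<Omega> x *\<^sub>R ?\<beta> m x *\<^sub>R g x) \<in> borel_measurable lborel" for m
        using L2_scaleR_integrable[OF test_function_L2[OF b_test \<Omega>b] g] by (simp add: set_integrable_def)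
      show "integrable lborel (\<lambda>x. norm (indicat_real (box a b) x *\<^sub>R g x))"
        by (rule integrable_norm[OF box_int[OF ab]])
      show "AE x in lborel. (\<lambda>m. indicat_real \<Omega> x *\<^sub>R ?\<beta> m x *\<^sub>R g x) \<longlonglongrightarrow> indicat_real (box a b) x *\<^sub>R g x"
      proof (intro AE_I2)
        fix x
        have "(\<lambda>m. indicat_real \<Omega> x *\<^sub>R ?\<beta> m x *\<^sub>R g x) \<longlonglongrightarrow> indicat_real \<Omega> x *\<^sub>R indicat_real (box a b) x *\<^sub>R g x"
          by (intro tendsto_intros bump_limit)
        moreover have "indicat_real \<Omega> x *\<^sub>R indicat_real (box a b) x *\<^sub>R g x = indicat_real (box a b) x *\<^sub>R g x"
          using sub by (auto simp: indicator_def)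
        ultimately show "(\<lambda>m. indicat_real \<Omega> x *\<^sub>R ?\<beta> m x *\<^sub>R g x) \<longlonglongrightarrow> indicat_real (box a b) x *\<^sub>R g x" by (simp only:)
      qed
      show "AE x in lborel. norm (indicat_real \<Omega> x *\<^sub>R ?\<beta> m x *\<^sub>R g x) \<le> norm (indicat_real (box a b) x *\<^sub>R g x)" for m
      proof (intro AE_I2)
        fix x
        show "norm (indicat_real \<Omega> x *\<^sub>R ?\<beta> m x *\<^sub>R g x) \<le> norm (indicat_real (box a b) x *\<^sub>R g x)"
        proof (cases "x \<in> box a b")
          case True
          then show ?thesis using bump_range[of "1 / real (Suc m)" a b x] sub
            by (auto simp: mult_left_le_one_le)
        qed (simp add: bump_zero)
      qed
    qed
    then show ?thesis unfolding test[OF b_test] LIMSEQ_const_iff by (rule sym)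
  qed
  obtain \<D> where \<D>: "countable \<D>" "\<D> \<subseteq> Pow \<Omega>" "\<And>X. X \<in> \<D> \<Longrightarrow> \<exists>a b. X = cbox a b" "\<Union>\<D> = \<Omega>"
    using open_countable_Union_open_cbox[OF \<Omega>] by metis
  have "AE x in lborel. x \<in> X \<longrightarrow> g x = 0" if X: "X \<in> \<D>" for X
  proof -
    obtain a b where ab: "X = cbox a b" "cbox a b \<subseteq> \<Omega>" using \<D> X by blast
    have "AE x in lborel. indicat_real (box a b) x *\<^sub>R g x = 0"
    proof (rule integrable_zero_on_boxes_imp_AE_zero[OF box_int[OF ab(2)]])
      fix c d
      obtain p q where pq: "box c d \<inter> box a b = box p q" "cbox c d \<inter> cbox a b = cbox p q"
        by (rule that[OF box_Int_box Int_interval])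
      have "(LINT x:box c d|lborel. indicat_real (box a b) x *\<^sub>R g x) = (LINT x:box p q|lborel. g x)"
        unfolding set_lebesgue_integral_def pq(1)[symmetric] by (simp add: indicator_inter_arith)
      also have "\<dots> = 0" using ab pq by (intro box_zero) auto
      finally show "(LINT x:box c d|lborel. indicat_real (box a b) x *\<^sub>R g x) = 0" .
    qed
    \<comment> \<open>The faces are null because the open and the closed box have the same
      volume.\<close>
    moreover have "AE x in lborel. x \<notin> cbox a b - box a b"
    proof (rule AE_not_in, rule null_setsI)
      have "emeasure lborel (cbox a b - box a b) = emeasure lborel (cbox a b) - emeasure lborel (box a b)"
        using emeasure_lborel_box_finite[of a b] box_subset_cbox[of a b] by (intro emeasure_Diff) auto
      also have "\<dots> = 0" using emeasure_lborel_box_finite[of a b]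
        by (simp add: emeasure_lborel_box_eq emeasure_lborel_cbox_eq diff_eq_0_iff_ennreal)
      finally show "emeasure lborel (cbox a b - box a b) = 0" .
    qed simp
    ultimately show ?thesis by eventually_elim (auto simp: ab indicator_def)
  qed
  then have "AE x in lborel. \<forall>X\<in>\<D>. x \<in> X \<longrightarrow> g x = 0"
    unfolding AE_ball_countable[OF \<D>(1)] by blast
  then show ?thesis by eventually_elim (use \<D>(4) in auto)
qed

section \<open>Weak derivatives\<close>

lemma test_function_pderiv:
  fixes \<phi> :: "real^'d \<Rightarrow> 'b::euclidean_space"
  assumes \<phi>: "test_function \<Omega> \<phi>" shows "test_function \<Omega> (pderiv_at j \<phi>)"
proof -
  let ?S = "closure {x. \<phi> x \<noteq> 0}"
  have zero: "pderiv_at j \<phi> x = 0" if "x \<notin> ?S" for x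
  proof -
    have "(\<phi> has_derivative (\<lambda>h. 0)) (at x)"
      by (rule has_derivative_transform_within_open[OF has_derivative_const[of 0], of "- ?S"])
        (use that closure_subset[of "{x. \<phi> x \<noteq> 0}"] in auto)
    then show ?thesis by (simp add: pderiv_at_eq)
  qed
  then have sub: "closure {x. pderiv_at j \<phi> x \<noteq> 0} \<subseteq> ?S" by (intro closure_minimal) auto
  moreover have "Ck k (pderiv_at j \<phi>)" for k
  proof -
    have "Ck (Suc k) \<phi>" using \<phi> unfolding test_function_def by blast
    then show ?thesis by simp
  qed
  ultimately show ?thesis using \<phi> unfolding test_function_def
    by (meson compact_closure bounded_subset closure_subset compact_imp_bounded order_trans)
qed

lemma test_function_lincomb:
  fixes \<phi> \<psi> :: "real^'d \<Rightarrow> 'b::euclidean_space"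
  assumes \<phi>: "test_function \<Omega> \<phi>" and \<psi>: "test_function \<Omega> \<psi>"
  shows "test_function \<Omega> (b *\<^sub>R \<phi> + c *\<^sub>R \<psi>)"
proof -
  let ?S = "closure {x. \<phi> x \<noteq> 0} \<union> closure {x. \<psi> x \<noteq> 0}"
  have "closure {x. (b *\<^sub>R \<phi> + c *\<^sub>R \<psi>) x \<noteq> 0} \<subseteq> ?S"
  proof (intro closure_minimal subsetI)
    fix x assume "x \<in> {x. (b *\<^sub>R \<phi> + c *\<^sub>R \<psi>) x \<noteq> 0}"
    then have "\<phi> x \<noteq> 0 \<or> \<psi> x \<noteq> 0" by auto
    then show "x \<in> ?S"
      using closure_subset[of "{x. \<phi> x \<noteq> 0}"] closure_subset[of "{x. \<psi> x \<noteq> 0}"] by blast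
  qed (intro closed_Un closed_closure)
  moreover have "compact ?S" "?S \<subseteq> \<Omega>" using \<phi> \<psi> unfolding test_function_def by auto
  moreover have "Ck k (b *\<^sub>R \<phi> + c *\<^sub>R \<psi>)" for k
    using \<phi> \<psi> unfolding test_function_def by (intro Ck_lincomb) auto
  ultimately show ?thesis unfolding test_function_def
    by (meson compact_closure bounded_subset closure_subset compact_imp_bounded order_trans)
qed

lemma test_function_differentiable: "test_function \<Omega> \<phi> \<Longrightarrow> \<phi> differentiable_on UNIV"
  unfolding test_function_def by (metis Ck.simps(2))

lemma set_integral_test_lincomb:
  fixes \<phi> :: "real^'d \<Rightarrow> real" and u v :: "real^'d \<Rightarrow> 'b::euclidean_space"
  assumes "\<phi> \<in> L2 \<Omega>" "u \<in> L2 \<Omega>" "v \<in> L2 \<Omega>"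
  shows "(LINT x:\<Omega>|lborel. \<phi> x *\<^sub>R (b *\<^sub>R u + c *\<^sub>R v) x)
    = b *\<^sub>R (LINT x:\<Omega>|lborel. \<phi> x *\<^sub>R u x) + c *\<^sub>R (LINT x:\<Omega>|lborel. \<phi> x *\<^sub>R v x)"
proof -
  have int: "set_integrable lborel \<Omega> (\<lambda>x. b *\<^sub>R (\<phi> x *\<^sub>R u x))" "set_integrable lborel \<Omega> (\<lambda>x. c *\<^sub>R (\<phi> x *\<^sub>R v x))"
    using assms by - (intro set_integrable_scaleR_right L2_scaleR_integrable; assumption)+
  have "(LINT x:\<Omega>|lborel. \<phi> x *\<^sub>R (b *\<^sub>R u + c *\<^sub>R v) x)
      = (LINT x:\<Omega>|lborel. b *\<^sub>R (\<phi> x *\<^sub>R u x) + c *\<^sub>R (\<phi> x *\<^sub>R v x))"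
    by (simp add: algebra_simps)
  also have "\<dots> = b *\<^sub>R (LINT x:\<Omega>|lborel. \<phi> x *\<^sub>R u x) + c *\<^sub>R (LINT x:\<Omega>|lborel. \<phi> x *\<^sub>R v x)"
    by (subst set_integral_add(2)[OF int]) (simp only: set_integral_scaleR_right)
  finally show ?thesis .
qed

lemma weak_pderiv_lincomb:
  fixes u v :: "real^'d \<Rightarrow> 'b::euclidean_space"
  assumes \<Omega>: "\<Omega> \<in> sets borel" and mem: "u \<in> L2 \<Omega>" "v \<in> L2 \<Omega>" "g \<in> L2 \<Omega>" "h \<in> L2 \<Omega>"
    and weak: "weak_pderiv \<Omega> j u g" "weak_pderiv \<Omega> j v h"
  shows "weak_pderiv \<Omega> j (b *\<^sub>R u + c *\<^sub>R v) (b *\<^sub>R g + c *\<^sub>R h)"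
  unfolding weak_pderiv_def
proof (intro allI impI)
  fix \<phi> :: "real^'d \<Rightarrow> real" assume \<phi>: "test_function \<Omega> \<phi>"
  then have L: "\<phi> \<in> L2 \<Omega>" "pderiv_at j \<phi> \<in> L2 \<Omega>"
    using test_function_L2[OF _ \<Omega>] test_function_pderiv by blast+
  have "(LINT x:\<Omega>|lborel. pderiv_at j \<phi> x *\<^sub>R u x) = - (LINT x:\<Omega>|lborel. \<phi> x *\<^sub>R g x)"
    "(LINT x:\<Omega>|lborel. pderiv_at j \<phi> x *\<^sub>R v x) = - (LINT x:\<Omega>|lborel. \<phi> x *\<^sub>R h x)"
    using weak \<phi> unfolding weak_pderiv_def by blast+
  then show "(LINT x:\<Omega>|lborel. pderiv_at j \<phi> x *\<^sub>R (b *\<^sub>R u + c *\<^sub>R v) x)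
    = - (LINT x:\<Omega>|lborel. \<phi> x *\<^sub>R (b *\<^sub>R g + c *\<^sub>R h) x)"
    unfolding set_integral_test_lincomb[OF L(1) mem(3,4)] set_integral_test_lincomb[OF L(2) mem(1,2)] by simp
qed

lemma weak_pderiv_unique:
  fixes u g h :: "real^'d \<Rightarrow> 'b::euclidean_space"
  assumes \<Omega>: "open \<Omega>" and mem: "g \<in> L2 \<Omega>" "h \<in> L2 \<Omega>"
    and weak: "weak_pderiv \<Omega> j u g" "weak_pderiv \<Omega> j u h"
  shows "AE x in lborel. x \<in> \<Omega> \<longrightarrow> g x = h x"
proof -
  have "AE x in lborel. x \<in> \<Omega> \<longrightarrow> (1 *\<^sub>R g + (-1) *\<^sub>R h) x = 0"
  proof (rule fundamental_lemma[OF \<Omega> L2_lincomb[OF mem]])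
    fix \<phi> :: "real^'d \<Rightarrow> real" assume \<phi>: "test_function \<Omega> \<phi>"
    then have L: "\<phi> \<in> L2 \<Omega>" by (rule test_function_L2[OF _ borel_open[OF \<Omega>]])
    have "- (LINT x:\<Omega>|lborel. \<phi> x *\<^sub>R g x) = - (LINT x:\<Omega>|lborel. \<phi> x *\<^sub>R h x)"
      using weak \<phi> unfolding weak_pderiv_def by metis
    then show "(LINT x:\<Omega>|lborel. \<phi> x *\<^sub>R (1 *\<^sub>R g + (-1) *\<^sub>R h) x) = 0"
      unfolding set_integral_test_lincomb[OF L mem] by simp
  qed
  then show ?thesis by eventually_elim simp
qed

lemma H1_wd:
  assumes "u \<in> H1 \<Omega>" shows "wd \<Omega> j u \<in> L2 \<Omega> \<and> weak_pderiv \<Omega> j u (wd \<Omega> j u)"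
proof -
  have "\<exists>g. g \<in> L2 \<Omega> \<and> weak_pderiv \<Omega> j u g" using assms by (auto simp: H1_def)
  then show ?thesis unfolding wd_def by (rule someI_ex)
qed

lemma H1_L2: "u \<in> H1 \<Omega> \<Longrightarrow> u \<in> L2 \<Omega>"
  by (simp add: H1_def)

lemma wd_AE:
  "open \<Omega> \<Longrightarrow> u \<in> H1 \<Omega> \<Longrightarrow> g \<in> L2 \<Omega> \<Longrightarrow> weak_pderiv \<Omega> j u g \<Longrightarrow>
    AE x in lborel. x \<in> \<Omega> \<longrightarrow> wd \<Omega> j u x = g x"
  using weak_pderiv_unique H1_wd by blast

lemma H1_lincomb:
  fixes u v :: "real^'d \<Rightarrow> 'b::euclidean_space"
  assumes \<Omega>: "open \<Omega>" and u: "u \<in> H1 \<Omega>" and v: "v \<in> H1 \<Omega>"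
  shows "b *\<^sub>R u + c *\<^sub>R v \<in> H1 \<Omega>"
    and "AE x in lborel. x \<in> \<Omega> \<longrightarrow> wd \<Omega> j (b *\<^sub>R u + c *\<^sub>R v) x = (b *\<^sub>R wd \<Omega> j u + c *\<^sub>R wd \<Omega> j v) x"
proof -
  have mem: "u \<in> L2 \<Omega>" "v \<in> L2 \<Omega>" "wd \<Omega> j u \<in> L2 \<Omega>" "wd \<Omega> j v \<in> L2 \<Omega>" for j
    using u v H1_wd[OF u] H1_wd[OF v] by (auto intro: H1_L2)
  have weak: "weak_pderiv \<Omega> j (b *\<^sub>R u + c *\<^sub>R v) (b *\<^sub>R wd \<Omega> j u + c *\<^sub>R wd \<Omega> j v)" for j
    using \<Omega> mem H1_wd[OF u] H1_wd[OF v] by (intro weak_pderiv_lincomb) auto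
  then show H: "b *\<^sub>R u + c *\<^sub>R v \<in> H1 \<Omega>"
    using L2_lincomb[OF mem(1,2)] L2_lincomb[OF mem(3,4)] unfolding H1_def by blast
  show "AE x in lborel. x \<in> \<Omega> \<longrightarrow> wd \<Omega> j (b *\<^sub>R u + c *\<^sub>R v) x = (b *\<^sub>R wd \<Omega> j u + c *\<^sub>R wd \<Omega> j v) x"
    using wd_AE[OF \<Omega> H _ weak] L2_lincomb[OF mem(3,4)] by blast
qed

lemma subspaceI_lincomb:
  assumes "0 \<in> S" "\<And>u v b c. u \<in> S \<Longrightarrow> v \<in> S \<Longrightarrow> b *\<^sub>R u + c *\<^sub>R v \<in> S"
  shows "subspace S"
  unfolding subspace_def using assms(1) assms(2)[of _ _ 1 1] assms(2)[of _ _ _ 0] by fastforce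

lemma H1_zero: "(0 :: real^'d \<Rightarrow> 'b::euclidean_space) \<in> H1 \<Omega>"
  unfolding H1_def weak_pderiv_def using L2_zero by (auto intro!: bexI[of _ 0])

section \<open>The inner product behind the H^1 norm\<close>

definition H1_inner :: "(real^'d) set \<Rightarrow> (real^'d \<Rightarrow> 'b::euclidean_space) \<Rightarrow> (real^'d \<Rightarrow> 'b) \<Rightarrow> real" where
  "H1_inner \<Omega> u v = L2_inner \<Omega> u v + (\<Sum>j\<in>UNIV. L2_inner \<Omega> (wd \<Omega> j u) (wd \<Omega> j v))"

lemma H1_inner_psd_form:
  assumes \<Omega>: "open \<Omega>"
  shows "psd_form (H1 \<Omega> :: (real^'d \<Rightarrow> 'b::euclidean_space) set) (H1_inner \<Omega>)"
proof
  show "subspace (H1 \<Omega> :: (real^'d \<Rightarrow> 'b) set)"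
    by (rule subspaceI_lincomb[OF H1_zero H1_lincomb(1)[OF \<Omega>]])
  fix u v w :: "real^'d \<Rightarrow> 'b" and c
  assume u: "u \<in> H1 \<Omega>"
  show "0 \<le> H1_inner \<Omega> u u"
    unfolding H1_inner_def using u H1_wd H1_L2 by (intro add_nonneg_nonneg sum_nonneg L2.form_nonneg) auto
  assume w: "w \<in> H1 \<Omega>"
  have lin: "L2_inner \<Omega> (wd \<Omega> j (b *\<^sub>R u + c *\<^sub>R v)) (wd \<Omega> j w)
    = b * L2_inner \<Omega> (wd \<Omega> j u) (wd \<Omega> j w) + c * L2_inner \<Omega> (wd \<Omega> j v) (wd \<Omega> j w)"
    if v: "v \<in> H1 \<Omega>" for v b c j
  proof -
    have mem: "wd \<Omega> j u \<in> L2 \<Omega>" "wd \<Omega> j v \<in> L2 \<Omega>" "wd \<Omega> j w \<in> L2 \<Omega>"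
      "wd \<Omega> j (b *\<^sub>R u + c *\<^sub>R v) \<in> L2 \<Omega>"
      using u v w H1_wd H1_lincomb(1)[OF \<Omega> u v] by blast+
    have "L2_inner \<Omega> (wd \<Omega> j (b *\<^sub>R u + c *\<^sub>R v)) (wd \<Omega> j w)
      = L2_inner \<Omega> (b *\<^sub>R wd \<Omega> j u + c *\<^sub>R wd \<Omega> j v) (wd \<Omega> j w)"
      using mem L2_lincomb H1_lincomb(2)[OF \<Omega> u v] by (intro L2_inner_cong_AE) auto
    then show ?thesis using mem by (simp add: L2.form_add_left L2.form_scale_left L2.mem_scale)
  qed
  show "H1_inner \<Omega> (c *\<^sub>R u) w = c * H1_inner \<Omega> u w"
    using lin[OF u, of _ c 0] u w
    by (simp add: H1_inner_def L2.form_scale_left H1_L2 sum_distrib_left algebra_simps)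
  assume v: "v \<in> H1 \<Omega>"
  show "H1_inner \<Omega> (u + v) w = H1_inner \<Omega> u w + H1_inner \<Omega> v w"
    using lin[OF v, of _ 1 1] u v w
    by (simp add: H1_inner_def L2.form_add_left H1_L2 sum.distrib)
qed (auto simp: H1_inner_def L2_inner_commute)

lemma H1_norm_eq:
  fixes u :: "real^'d \<Rightarrow> 'b::euclidean_space"
  assumes "u \<in> H1 \<Omega>" shows "H1_norm \<Omega> u = sqrt (H1_inner \<Omega> u u)"
proof -
  have "(L2_norm \<Omega> v)\<^sup>2 = L2_inner \<Omega> v v" if "v \<in> L2 \<Omega>" for v :: "real^'d \<Rightarrow> 'b"
    using L2.form_nonneg[OF that] by (simp add: L2_norm_def)
  moreover have "wd \<Omega> j u \<in> L2 \<Omega>" for j using H1_wd[OF assms] by blast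
  ultimately show ?thesis using H1_L2[OF assms] by (simp add: H1_norm_def H1_inner_def)
qed

lemma H1_norm_lincomb_le:
  fixes u v :: "real^'d \<Rightarrow> 'b::euclidean_space"
  assumes \<Omega>: "open \<Omega>" and u: "u \<in> H1 \<Omega>" and v: "v \<in> H1 \<Omega>"
  shows "H1_norm \<Omega> (b *\<^sub>R u + c *\<^sub>R v) \<le> \<bar>b\<bar> * H1_norm \<Omega> u + \<bar>c\<bar> * H1_norm \<Omega> v"
proof -
  interpret h: psd_form "H1 \<Omega> :: (real^'d \<Rightarrow> 'b) set" "H1_inner \<Omega>" by (rule H1_inner_psd_form[OF \<Omega>])
  show ?thesis
    using h.triangle[of "b *\<^sub>R u" "c *\<^sub>R v"] u v
    by (simp add: H1_norm_eq h.mem_add h.mem_scale h.norm_scale)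
qed

lemma L2_norm_le_H1_norm:
  assumes "u \<in> H1 \<Omega>" shows "L2_norm \<Omega> u \<le> H1_norm \<Omega> u"
  unfolding H1_norm_eq[OF assms] L2_norm_def H1_inner_def
  using assms H1_wd by (auto intro!: sum_nonneg L2.form_nonneg)

section \<open>Integration by parts: classical derivatives of test functions are weak
  derivatives\<close>

lemma integral_pderiv_zero:
  fixes f :: "real^'d \<Rightarrow> 'b::euclidean_space"
  assumes f: "test_function UNIV f"
  shows "(LINT x|lborel. pderiv_at j f x) = 0"
proof -
  define e :: "real^'d" where "e = axis j 1"
  let ?D = "pderiv_at j f"
  have der: "(f has_derivative frechet_derivative f (at x)) (at x)" for x
    by (rule differentiable_UNIV_has_derivative[OF test_function_differentiable[OF f]])
  have fc: "continuous_on UNIV f" by (rule test_function_continuous[OF f])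
  have fL: "integrable lborel f" if "test_function UNIV f" for f :: "real^'d \<Rightarrow> 'b"
  proof (rule Bochner_Integration.integrable_bound)
    have "continuous_on (closure {x. f x \<noteq> 0}) f" "compact (closure {x. f x \<noteq> 0})"
      using test_function_continuous[OF that] that
      by (auto simp: test_function_def intro: continuous_on_subset)
    from borel_integrable_compact[OF this(2,1)]
    show "integrable lborel (\<lambda>x. indicat_real (closure {x. f x \<noteq> 0}) x *\<^sub>R f x)"
      .
    show "f \<in> borel_measurable lborel"
      using borel_measurable_continuous_onI[OF test_function_continuous[OF that]] by simp
    show "AE x in lborel. norm (f x) \<le> norm (indicat_real (closure {x. f x \<noteq> 0}) x *\<^sub>R f x)"
      using closure_subset[of "{x. f x \<noteq> 0}"] by (intro AE_I2) (auto simp: indicator_def)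
  qed
  obtain B where B: "\<And>x. norm (?D x) \<le> B"
    using test_function_bounded[OF test_function_pderiv[OF f]] by blast
  have B0: "0 \<le> B" using B[of 0] norm_ge_zero order_trans by blast
  obtain R where R: "\<And>x. f x \<noteq> 0 \<Longrightarrow> norm x \<le> R"
  proof -
    have "bounded {x. f x \<noteq> 0}"
      using f by (metis test_function_def compact_imp_bounded bounded_subset closure_subset)
    then show thesis using that by (auto simp: bounded_iff)
  qed
  have line: "((\<lambda>t. f (x + t *\<^sub>R e)) has_vector_derivative ?D (x + t *\<^sub>R e)) (at t within S)" for x t S
  proof -
    have "((\<lambda>t. x + t *\<^sub>R e) has_derivative (\<lambda>h. h *\<^sub>R e)) (at t within S)"
      by (auto intro!: derivative_eq_intros)
    from has_derivative_compose[OF this der]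
    have "((\<lambda>t. f (x + t *\<^sub>R e)) has_derivative (\<lambda>h. frechet_derivative f (at (x + t *\<^sub>R e)) (h *\<^sub>R e))) (at t within S)" .
    moreover have "frechet_derivative f (at y) (h *\<^sub>R e) = h *\<^sub>R ?D y" for h y
      using linear_scale[OF has_derivative_linear[OF der]] by (simp add: pderiv_at_def e_def)
    ultimately show ?thesis by (simp add: has_vector_derivative_def)
  qed
  have lip: "norm (f (x + h *\<^sub>R e) - f x) \<le> B * h" if "h \<ge> 0" for x h
  proof -
    have "norm (f (x + h *\<^sub>R e) - f (x + 0 *\<^sub>R e)) \<le> B * norm (h - 0)"
    proof (rule differentiable_bound[where S = UNIV and f = "\<lambda>t. f (x + t *\<^sub>R e)"])
      show "((\<lambda>t. f (x + t *\<^sub>R e)) has_derivative (\<lambda>h. h *\<^sub>R ?D (x + t *\<^sub>R e))) (at t)" for t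
        using line[of x t UNIV] by (simp add: has_vector_derivative_def)
      show "onorm (\<lambda>h. h *\<^sub>R ?D (x + t *\<^sub>R e)) \<le> B" for t
        using B by (intro onorm_le) (simp add: mult.commute[of B] mult_left_mono)
    qed auto
    then show ?thesis using that by (simp add: mult.commute)
  qed
  \<comment> \<open>Each difference quotient has integral zero by translation invariance of Lebesgue
    measure. Dominated convergence to the partial derivative then gives the claim without iterated
    integrals.\<close>
  define s where "s m x = real (Suc m) *\<^sub>R (f (x + (1 / real (Suc m)) *\<^sub>R e) - f x)" for m x
  have shift: "integrable lborel (\<lambda>x. f (x + c))" "(LINT x|lborel. f (x + c)) = (LINT x|lborel. f x)" for c
  proof -
    have m: "f \<in> borel_measurable borel" using fL[OF f] by simp
    have "integrable (distr lborel borel ((+) c)) f" using fL[OF f] by (simp add: lborel_distr_plus)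
    then show "integrable lborel (\<lambda>x. f (x + c))"
      using m by (subst (asm) integrable_distr_eq) (auto simp: add.commute)
    have "(LINT x|distr lborel borel ((+) c). f x) = (LINT x|lborel. f (c + x))"
      using m by (intro integral_distr) auto
    then show "(LINT x|lborel. f (x + c)) = (LINT x|lborel. f x)"
      by (simp add: lborel_distr_plus add.commute)
  qed
  have s0: "(LINT x|lborel. s m x) = 0" for m
    unfolding s_def using shift fL[OF f] by simp
  have "(\<lambda>m. LINT x|lborel. s m x) \<longlonglongrightarrow> (LINT x|lborel. ?D x)"
  proof (rule integral_dominated_convergence)
    show "?D \<in> borel_measurable lborel"
      using borel_measurable_integrable[OF fL[OF test_function_pderiv[OF f]]] .
    show "s m \<in> borel_measurable lborel" for m
      unfolding s_def using shift(1) fL[OF f]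
      by (intro borel_measurable_scaleR borel_measurable_diff borel_measurable_integrable) auto
    \<comment> \<open>The support lies in the ball of radius R and is moved by at most norm e; B
      bounds the quotient by the mean value inequality.\<close>
    show "integrable lborel (\<lambda>x. B * indicat_real (cball 0 (R + norm e)) x)"
      by (intro integrable_mult_right integrable_real_indicator) (use emeasure_lborel_cball_finite[of 0 "R + norm e"] in auto)
    show "AE x in lborel. (\<lambda>m. s m x) \<longlonglongrightarrow> ?D x"
    proof (intro AE_I2)
      fix x
      have "((\<lambda>h. (f (x + h *\<^sub>R e) - f x) /\<^sub>R h) \<longlongrightarrow> ?D x) (at 0)"
              proof (rule LIM_zero_cancel, rule tendsto_norm_zero_cancel)
        have "(\<lambda>h. norm (f (x + h *\<^sub>R e) - f x - h *\<^sub>R ?D x) / norm h) \<midarrow>0\<rightarrow> 0"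
          using line[of x 0 UNIV] by (simp add: has_vector_derivative_def has_derivative_at)
        moreover have "norm ((f (x + h *\<^sub>R e) - f x) /\<^sub>R h - ?D x) = norm (f (x + h *\<^sub>R e) - f x - h *\<^sub>R ?D x) / norm h"
          if "h \<noteq> 0" for h
        proof -
          have "(f (x + h *\<^sub>R e) - f x) /\<^sub>R h - ?D x = (f (x + h *\<^sub>R e) - f x - h *\<^sub>R ?D x) /\<^sub>R h"
            using that by (simp add: scaleR_diff_right)
          then show ?thesis by (simp add: divide_inverse mult.commute)
        qed
        ultimately show "(\<lambda>h. norm ((f (x + h *\<^sub>R e) - f x) /\<^sub>R h - ?D x)) \<midarrow>0\<rightarrow> 0"
          by (subst Lim_cong_within[OF refl refl refl]) auto
      qed
      then have "(\<lambda>m. (f (x + inverse (real (Suc m)) *\<^sub>R e) - f x) /\<^sub>R inverse (real (Suc m))) \<longlonglongrightarrow> ?D x"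
        by (rule filterlim_compose) (auto simp: filterlim_at LIMSEQ_inverse_real_of_nat simp del: of_nat_Suc)
      then show "(\<lambda>m. s m x) \<longlonglongrightarrow> ?D x" by (simp add: s_def inverse_eq_divide)
    qed
    show "AE x in lborel. norm (s m x) \<le> B * indicat_real (cball 0 (R + norm e)) x" for m
    proof (intro AE_I2)
      fix x
      let ?h = "1 / real (Suc m)"
      show "norm (s m x) \<le> B * indicat_real (cball 0 (R + norm e)) x"
      proof (cases "norm x \<le> R + norm e")
        case True
        have "norm (s m x) = real (Suc m) * norm (f (x + ?h *\<^sub>R e) - f x)" by (simp add: s_def)
        also have "\<dots> \<le> real (Suc m) * (B * ?h)" by (intro mult_left_mono lip) auto
        also have "\<dots> = B" by simp
        finally show ?thesis using True by simp
      next
        case False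
        have "norm (?h *\<^sub>R e) \<le> norm e" by (simp add: divide_le_eq algebra_simps)
        with False norm_diff_ineq[of x "?h *\<^sub>R e"] have "norm (x + ?h *\<^sub>R e) > R" by linarith
        moreover have "norm x > R" using False norm_ge_zero[of e] by linarith
        ultimately have "f (x + ?h *\<^sub>R e) = 0" "f x = 0" using R not_less by blast+
        then show ?thesis using B0 by (simp add: s_def)
      qed
    qed
  qed
  then show ?thesis by (simp add: s0 LIMSEQ_const_iff)
qed

lemma test_function_scaleR:
  fixes \<phi> :: "real^'d \<Rightarrow> real" and \<psi> :: "real^'d \<Rightarrow> 'b::euclidean_space"
  assumes \<phi>: "test_function \<Omega> \<phi>" and \<psi>: "test_function \<Omega> \<psi>"
  shows "test_function \<Omega> (\<lambda>x. \<phi> x *\<^sub>R \<psi> x)"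
proof -
  have "Ck k (\<lambda>x. \<phi> x *\<^sub>R \<psi> x)" for k
    using \<phi> \<psi> unfolding test_function_def by (intro Ck_scaleR) auto
  moreover have "closure {x. \<phi> x *\<^sub>R \<psi> x \<noteq> 0} \<subseteq> closure {x. \<psi> x \<noteq> 0}"
    by (intro closure_mono) auto
  ultimately show ?thesis using \<psi> unfolding test_function_def
    by (meson compact_closure bounded_subset closure_subset compact_imp_bounded order_trans)
qed

text \<open>The product \<phi> \<psi> is a test function on the whole space, so the integral of its
  derivative vanishes; the Leibniz rule splits that integral into the two sides of the
  claim.\<close>

lemma test_function_weak_pderiv:
  fixes \<psi> :: "real^'d \<Rightarrow> 'b::euclidean_space"
  assumes \<Omega>: "open \<Omega>" and \<psi>: "test_function \<Omega> \<psi>"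
  shows "weak_pderiv \<Omega> j \<psi> (pderiv_at j \<psi>)"
  unfolding weak_pderiv_def
proof (intro allI impI)
  fix \<phi> :: "real^'d \<Rightarrow> real" assume \<phi>: "test_function \<Omega> \<phi>"
  have \<Omega>b: "\<Omega> \<in> sets borel" using \<Omega> by simp
  have prod: "test_function UNIV (\<lambda>x. \<phi> x *\<^sub>R \<psi> x)"
    using test_function_scaleR[OF \<phi> \<psi>] unfolding test_function_def by blast
  note d\<phi> = test_function_pderiv[OF \<phi>, of j] and d\<psi> = test_function_pderiv[OF \<psi>, of j]
  have int: "set_integrable lborel \<Omega> (\<lambda>x. \<phi> x *\<^sub>R pderiv_at j \<psi> x)"
    "set_integrable lborel \<Omega> (\<lambda>x. pderiv_at j \<phi> x *\<^sub>R \<psi> x)"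
    using \<phi> \<psi> d\<phi> d\<psi> \<Omega>b by (auto intro!: L2_scaleR_integrable test_function_L2)
  have "(LINT x:\<Omega>|lborel. \<phi> x *\<^sub>R pderiv_at j \<psi> x) + (LINT x:\<Omega>|lborel. pderiv_at j \<phi> x *\<^sub>R \<psi> x)
      = (LINT x:\<Omega>|lborel. pderiv_at j (\<lambda>x. \<phi> x *\<^sub>R \<psi> x) x)"
    unfolding pderiv_at_scaleR[OF test_function_differentiable[OF \<phi>] test_function_differentiable[OF \<psi>]]
    by (rule set_integral_add(2)[OF int, symmetric])
  \<comment> \<open>Outside \<Omega> both factors vanish, and each summand of the Leibniz expression
    contains one of them undifferentiated.\<close>
  also have "\<dots> = (LINT x|lborel. pderiv_at j (\<lambda>x. \<phi> x *\<^sub>R \<psi> x) x)"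
    unfolding set_lebesgue_integral_def
    by (intro Bochner_Integration.integral_cong refl)
      (simp add: pderiv_at_scaleR[OF test_function_differentiable[OF \<phi>] test_function_differentiable[OF \<psi>]]
        indicator_def test_function_zero_outside[OF \<phi>] test_function_zero_outside[OF \<psi>])
  also have "\<dots> = 0" by (rule integral_pderiv_zero[OF prod])
  finally show "(LINT x:\<Omega>|lborel. pderiv_at j \<phi> x *\<^sub>R \<psi> x) = - (LINT x:\<Omega>|lborel. \<phi> x *\<^sub>R pderiv_at j \<psi> x)"
    by (simp add: add_eq_0_iff)
qed

lemma test_function_H1:
  fixes \<psi> :: "real^'d \<Rightarrow> 'b::euclidean_space"
  assumes \<Omega>: "open \<Omega>" and \<psi>: "test_function \<Omega> \<psi>" shows "\<psi> \<in> H1 \<Omega>"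
  unfolding H1_def
  using test_function_L2[OF _ borel_open[OF \<Omega>]] test_function_weak_pderiv[OF \<Omega> \<psi>] test_function_pderiv[OF \<psi>] \<psi>
  by blast

text \<open>\<open>wd\<close> is an arbitrary representative, but its weak derivative only depends on its pairing with test
  functions, which is that of the classical derivative.\<close>

lemma test_function_H2:
  fixes \<psi> :: "real^'d \<Rightarrow> 'b::euclidean_space"
  assumes \<Omega>: "open \<Omega>" and \<psi>: "test_function \<Omega> \<psi>" shows "\<psi> \<in> H2 \<Omega>"
proof -
  have H1: "\<psi> \<in> H1 \<Omega>" by (rule test_function_H1[OF \<Omega> \<psi>])
  have L2: "\<phi> \<in> L2 \<Omega>" if "test_function \<Omega> \<phi>" for \<phi> :: "real^'d \<Rightarrow> 'b"
    by (rule test_function_L2[OF that borel_open[OF \<Omega>]])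
  have "wd \<Omega> j \<psi> \<in> H1 \<Omega>" for j
  proof -
    have d: "test_function \<Omega> (pderiv_at j \<psi>)" by (rule test_function_pderiv[OF \<psi>])
    have "weak_pderiv \<Omega> k (wd \<Omega> j \<psi>) (pderiv_at k (pderiv_at j \<psi>))" for k
      unfolding weak_pderiv_def
    proof (intro allI impI)
      fix \<phi> :: "real^'d \<Rightarrow> real" assume \<phi>: "test_function \<Omega> \<phi>"
      have "- (LINT x:\<Omega>|lborel. pderiv_at k \<phi> x *\<^sub>R wd \<Omega> j \<psi> x) = - (LINT x:\<Omega>|lborel. pderiv_at k \<phi> x *\<^sub>R pderiv_at j \<psi> x)"
        using H1_wd[OF H1, of j] test_function_weak_pderiv[OF \<Omega> \<psi>, of j] test_function_pderiv[OF \<phi>, of k]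
        unfolding weak_pderiv_def by metis
      then have "(LINT x:\<Omega>|lborel. pderiv_at k \<phi> x *\<^sub>R wd \<Omega> j \<psi> x) = (LINT x:\<Omega>|lborel. pderiv_at k \<phi> x *\<^sub>R pderiv_at j \<psi> x)"
        by (simp only: neg_equal_iff_equal)
      also have "\<dots> = - (LINT x:\<Omega>|lborel. \<phi> x *\<^sub>R pderiv_at k (pderiv_at j \<psi>) x)"
        using test_function_weak_pderiv[OF \<Omega> d, of k] \<phi> unfolding weak_pderiv_def by blast
      finally show "(LINT x:\<Omega>|lborel. pderiv_at k \<phi> x *\<^sub>R wd \<Omega> j \<psi> x) = - (LINT x:\<Omega>|lborel. \<phi> x *\<^sub>R pderiv_at k (pderiv_at j \<psi>) x)" .
    qed
    then show ?thesis using H1_wd[OF H1, of j] L2[OF test_function_pderiv[OF d]] unfolding H1_def by blast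
  qed
  with H1 show ?thesis by (simp add: H2_def)
qed

section \<open>The form of the operator\<close>

lemma H1_norm_zero: "open \<Omega> \<Longrightarrow> H1_norm \<Omega> (0 :: real^'d \<Rightarrow> 'b::euclidean_space) = 0"
  using psd_form.form_zero_left[OF H1_inner_psd_form H1_zero] by (simp add: H1_norm_eq H1_zero)

lemma test_function_H10:
  fixes \<psi> :: "real^'d \<Rightarrow> 'b::euclidean_space"
  assumes \<Omega>: "open \<Omega>" and \<psi>: "test_function \<Omega> \<psi>" shows "\<psi> \<in> H10 \<Omega>"
proof -
  have "(\<lambda>x::real^'d. 0::'b) = 0" by (simp add: fun_eq_iff)
  then show ?thesis
    unfolding H10_def using test_function_H1[OF \<Omega> \<psi>] \<psi> H1_norm_zero[OF \<Omega>, where 'b='b]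
    by (auto intro!: exI[of _ "\<lambda>m. \<psi>"])
qed

lemma H10_obtain:
  assumes "u \<in> H10 \<Omega>"
  obtains \<phi> where "\<And>m. test_function \<Omega> (\<phi> m)" "(\<lambda>m::nat. H1_norm \<Omega> (\<phi> m - u)) \<longlonglongrightarrow> 0"
proof -
  have "(\<lambda>x. \<phi> m x - u x) = \<phi> m - u" for \<phi> and m :: nat by (simp add: fun_eq_iff)
  with assms that show thesis unfolding H10_def by force
qed

lemma H10_H1: "u \<in> H10 \<Omega> \<Longrightarrow> u \<in> H1 \<Omega>"
  by (simp add: H10_def)

lemma subspace_H10:
  assumes \<Omega>: "open \<Omega>" shows "subspace (H10 \<Omega> :: (real^'d \<Rightarrow> 'b::euclidean_space) set)"
proof (rule subspaceI_lincomb)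
  have "test_function \<Omega> (\<lambda>x::real^'d. 0::'b)" by (simp add: test_function_def Ck_const)
  then have "(\<lambda>x::real^'d. 0::'b) \<in> H10 \<Omega>" by (rule test_function_H10[OF \<Omega>])
  then show "(0 :: real^'d \<Rightarrow> 'b) \<in> H10 \<Omega>" by (simp add: zero_fun_def)
  fix u v :: "real^'d \<Rightarrow> 'b" and b c
  assume u: "u \<in> H10 \<Omega>" and v: "v \<in> H10 \<Omega>"
  obtain \<phi> where \<phi>: "\<And>m. test_function \<Omega> (\<phi> m)" "(\<lambda>m. H1_norm \<Omega> (\<phi> m - u)) \<longlonglongrightarrow> 0"
    using H10_obtain[OF u] by blast
  obtain \<psi> where \<psi>: "\<And>m. test_function \<Omega> (\<psi> m)" "(\<lambda>m. H1_norm \<Omega> (\<psi> m - v)) \<longlonglongrightarrow> 0"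
    using H10_obtain[OF v] by blast
  interpret h: psd_form "H1 \<Omega> :: (real^'d \<Rightarrow> 'b) set" "H1_inner \<Omega>" by (rule H1_inner_psd_form[OF \<Omega>])
  have mem: "\<phi> m - u \<in> H1 \<Omega>" "\<psi> m - v \<in> H1 \<Omega>" for m
    using H10_H1[OF u] H10_H1[OF v] test_function_H1[OF \<Omega> \<phi>(1)] test_function_H1[OF \<Omega> \<psi>(1)]
    by (simp_all add: h.mem_diff)
  let ?\<chi> = "\<lambda>m. b *\<^sub>R \<phi> m + c *\<^sub>R \<psi> m"
  have eq: "?\<chi> m - (b *\<^sub>R u + c *\<^sub>R v) = b *\<^sub>R (\<phi> m - u) + c *\<^sub>R (\<psi> m - v)" for m
    by (simp add: algebra_simps)
  have lim: "(\<lambda>m. H1_norm \<Omega> (?\<chi> m - (b *\<^sub>R u + c *\<^sub>R v))) \<longlonglongrightarrow> 0"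
  proof (rule tendsto_sandwich[OF always_eventually always_eventually tendsto_const])
    show "\<forall>m. 0 \<le> H1_norm \<Omega> (?\<chi> m - (b *\<^sub>R u + c *\<^sub>R v))"
      unfolding eq using mem by (auto simp: H1_norm_eq h.mem_add h.mem_scale h.form_nonneg)
    show "\<forall>m. H1_norm \<Omega> (?\<chi> m - (b *\<^sub>R u + c *\<^sub>R v)) \<le> \<bar>b\<bar> * H1_norm \<Omega> (\<phi> m - u) + \<bar>c\<bar> * H1_norm \<Omega> (\<psi> m - v)"
      unfolding eq using H1_norm_lincomb_le[OF \<Omega> mem] by blast
    show "(\<lambda>m. \<bar>b\<bar> * H1_norm \<Omega> (\<phi> m - u) + \<bar>c\<bar> * H1_norm \<Omega> (\<psi> m - v)) \<longlonglongrightarrow> 0"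
      using tendsto_add[OF tendsto_mult_left[OF \<phi>(2)] tendsto_mult_left[OF \<psi>(2)]] by simp
  qed
  have fe: "(\<lambda>x. ?\<chi> m x - (b *\<^sub>R u + c *\<^sub>R v) x) = ?\<chi> m - (b *\<^sub>R u + c *\<^sub>R v)" for m
    by (simp add: fun_eq_iff)
  have "b *\<^sub>R u + c *\<^sub>R v \<in> H1 \<Omega>" using u v by (intro h.mem_add h.mem_scale H10_H1)
  then show "b *\<^sub>R u + c *\<^sub>R v \<in> H10 \<Omega>"
    unfolding H10_def using lim test_function_lincomb[OF \<phi>(1) \<psi>(1)]
    by (auto intro!: exI[of _ ?\<chi>] simp only: fe mem_Collect_eq)
qed

section \<open>The bilinear form on H^1_0\<close>

locale elliptic_form =
  fixes \<Omega> :: "(real^'d::finite) set" and A :: "'d vfield \<Rightarrow> 'd vfield" and a :: "'d vfield \<Rightarrow> 'd vfield \<Rightarrow> real"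
  assumes open_domain: "open \<Omega>"
    and self_adjoint: "self_adjoint_op \<Omega> (H2 \<Omega> \<inter> H10 \<Omega>) A"
    and positive_definite: "positive_definite_op \<Omega> (H2 \<Omega> \<inter> H10 \<Omega>) A"
    and form: "form_of_op \<Omega> A a"
begin

lemma a_lincomb:
  assumes "u \<in> H10 \<Omega>" "v \<in> H10 \<Omega>" "w \<in> H10 \<Omega>"
  shows a_lincomb_left: "a (b *\<^sub>R u + c *\<^sub>R v) w = b * a u w + c * a v w"
    and a_lincomb_right: "a w (b *\<^sub>R u + c *\<^sub>R v) = b * a w u + c * a w v"
proof -
  have eq: "(\<lambda>x. b *\<^sub>R u x + c *\<^sub>R v x) = b *\<^sub>R u + c *\<^sub>R v" by (simp add: fun_eq_iff)
  have "\<forall>u\<in>H10 \<Omega>. \<forall>v\<in>H10 \<Omega>. \<forall>w\<in>H10 \<Omega>. \<forall>b c.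
        a (\<lambda>x. b *\<^sub>R u x + c *\<^sub>R v x) w = b * a u w + c * a v w \<and>
        a w (\<lambda>x. b *\<^sub>R u x + c *\<^sub>R v x) = b * a w u + c * a w v"
    using form unfolding form_of_op_def by (elim conjE)
  from this[rule_format, OF assms, of b c]
  show "a (b *\<^sub>R u + c *\<^sub>R v) w = b * a u w + c * a v w"
    "a w (b *\<^sub>R u + c *\<^sub>R v) = b * a w u + c * a w v" unfolding eq by auto
qed

text \<open>Joint continuity in the H1 norm, from the boundedness of \<open>a\<close>. It carries
  what is known for A on test functions over to all of H^1_0.\<close>

lemma a_limit:
  assumes u: "u \<in> H10 \<Omega>" and v: "v \<in> H10 \<Omega>"
    and \<phi>: "\<And>m. \<phi> m \<in> H10 \<Omega>" "(\<lambda>m. H1_norm \<Omega> (\<phi> m - u)) \<longlonglongrightarrow> 0"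
    and \<psi>: "\<And>m. \<psi> m \<in> H10 \<Omega>" "(\<lambda>m. H1_norm \<Omega> (\<psi> m - v)) \<longlonglongrightarrow> 0"
  shows "(\<lambda>m. a (\<phi> m) (\<psi> m)) \<longlonglongrightarrow> a u v"
proof -
  obtain M where M: "\<And>u v. u \<in> H10 \<Omega> \<Longrightarrow> v \<in> H10 \<Omega> \<Longrightarrow> \<bar>a u v\<bar> \<le> M * H1_norm \<Omega> u * H1_norm \<Omega> v"
    using form unfolding form_of_op_def by blast
  have mem: "\<phi> m - u \<in> H10 \<Omega>" "\<psi> m - v \<in> H10 \<Omega>" for m
    using \<phi> \<psi> u v subspace_diff[OF subspace_H10[OF open_domain]] by blast+
  have null: "(\<lambda>m. a (x m) (y m)) \<longlonglongrightarrow> 0"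
    if "\<And>m. x m \<in> H10 \<Omega>" "\<And>m. y m \<in> H10 \<Omega>" "(\<lambda>m. H1_norm \<Omega> (x m) * H1_norm \<Omega> (y m)) \<longlonglongrightarrow> 0" for x y
  proof (rule Lim_null_comparison)
    show "\<forall>\<^sub>F m in sequentially. norm (a (x m) (y m)) \<le> M * (H1_norm \<Omega> (x m) * H1_norm \<Omega> (y m))"
      using M[OF that(1,2)] by (simp add: mult.assoc)
    show "(\<lambda>m. M * (H1_norm \<Omega> (x m) * H1_norm \<Omega> (y m))) \<longlonglongrightarrow> 0"
      using tendsto_mult_left[OF that(3), of M] by simp
  qed
  have "(\<lambda>m. a (\<phi> m - u) (\<psi> m - v)) \<longlonglongrightarrow> 0" "(\<lambda>m. a (\<phi> m - u) v) \<longlonglongrightarrow> 0" "(\<lambda>m. a u (\<psi> m - v)) \<longlonglongrightarrow> 0"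
    using tendsto_mult[OF \<phi>(2) \<psi>(2)] tendsto_mult_right[OF \<phi>(2), of "H1_norm \<Omega> v"]
      tendsto_mult_left[OF \<psi>(2), of "H1_norm \<Omega> u"] mem u v
    by (intro null; simp)+
  then have "(\<lambda>m. a (\<phi> m - u) (\<psi> m - v) + a (\<phi> m - u) v + a u (\<psi> m - v) + a u v) \<longlonglongrightarrow> 0 + 0 + 0 + a u v"
    by (intro tendsto_intros)
  moreover have "a (\<phi> m - u) (\<psi> m - v) + a (\<phi> m - u) v + a u (\<psi> m - v) + a u v = a (\<phi> m) (\<psi> m)" for m
  proof -
    have "a (\<phi> m) w = a (\<phi> m - u) w + a u w" if "w \<in> H10 \<Omega>" for w
      using a_lincomb_left[OF mem(1) u that, of 1 m 1] by simp
    moreover have "a w (\<psi> m) = a w (\<psi> m - v) + a w v" if "w \<in> H10 \<Omega>" for w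
      using a_lincomb_right[OF mem(2) v that, of 1 m 1] by simp
    ultimately show ?thesis using mem u v \<phi> \<psi> by simp
  qed
  ultimately show ?thesis by simp
qed

lemma test_function_form:
  assumes "test_function \<Omega> \<phi>" "v \<in> H10 \<Omega>" shows "a \<phi> v = L2_inner \<Omega> (A \<phi>) v"
  using form assms test_function_H2[OF open_domain] test_function_H10[OF open_domain]
  unfolding form_of_op_def by blast

lemma a_sym:
  assumes u: "u \<in> H10 \<Omega>" and v: "v \<in> H10 \<Omega>" shows "a u v = a v u"
proof -
  obtain \<phi> where \<phi>: "\<And>m. test_function \<Omega> (\<phi> m)" "(\<lambda>m. H1_norm \<Omega> (\<phi> m - u)) \<longlonglongrightarrow> 0"
    using H10_obtain[OF u] by blast
  obtain \<psi> where \<psi>: "\<And>m. test_function \<Omega> (\<psi> m)" "(\<lambda>m. H1_norm \<Omega> (\<psi> m - v)) \<longlonglongrightarrow> 0"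
    using H10_obtain[OF v] by blast
  note H = test_function_H10[OF open_domain]
  have "a (\<phi> m) (\<psi> m) = a (\<psi> m) (\<phi> m)" for m
    using self_adjoint test_function_form[OF \<phi>(1) H[OF \<psi>(1)]] test_function_form[OF \<psi>(1) H[OF \<phi>(1)]]
      H[OF \<phi>(1)] H[OF \<psi>(1)] test_function_H2[OF open_domain \<phi>(1)] test_function_H2[OF open_domain \<psi>(1)]
    unfolding self_adjoint_op_def by (simp add: L2_inner_commute)
  then show ?thesis
    using LIMSEQ_unique[OF a_limit[OF u v H[OF \<phi>(1)] \<phi>(2) H[OF \<psi>(1)] \<psi>(2)]]
      a_limit[OF v u H[OF \<psi>(1)] \<psi>(2) H[OF \<phi>(1)] \<phi>(2)] by simp
qed

text \<open>The bound is in the L2 norm, which is what positive definiteness of A supplies; this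
  suffices to make the eigenvalues of the discrete operators positive.\<close>

lemma a_coercive: "\<exists>c>0. \<forall>u\<in>H10 \<Omega>. c * (L2_norm \<Omega> u)\<^sup>2 \<le> a u u"
proof -
  obtain c where c: "c > 0" and cA: "\<And>u. u \<in> H2 \<Omega> \<inter> H10 \<Omega> \<Longrightarrow> L2_inner \<Omega> (A u) u \<ge> c * (L2_norm \<Omega> u)\<^sup>2"
    using positive_definite unfolding positive_definite_op_def by blast
  have "c * (L2_norm \<Omega> u)\<^sup>2 \<le> a u u" if u: "u \<in> H10 \<Omega>" for u
  proof -
    obtain \<phi> where \<phi>: "\<And>m. test_function \<Omega> (\<phi> m)" "(\<lambda>m. H1_norm \<Omega> (\<phi> m - u)) \<longlonglongrightarrow> 0"
      using H10_obtain[OF u] by blast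
    note H = test_function_H10[OF open_domain \<phi>(1)]
    have uL: "u \<in> L2 \<Omega>" and \<phi>L: "\<phi> m \<in> L2 \<Omega>" for m using u H H10_H1 H1_L2 by blast+
    have D: "\<phi> m - u \<in> H1 \<Omega>" for m
      using H10_H1 subspace_diff[OF subspace_H10[OF open_domain] H u] by blast
    \<comment> \<open>The reverse triangle inequality, together with the fact that the H1 norm
      dominates the L2 norm.\<close>
    have "(\<lambda>m. L2_norm \<Omega> (\<phi> m)) \<longlonglongrightarrow> L2_norm \<Omega> u"
    proof (rule Lim_transform[OF tendsto_const], rule Lim_null_comparison[OF _ \<phi>(2)], intro always_eventually allI)
      fix m
      have "L2_norm \<Omega> (\<phi> m) \<le> L2_norm \<Omega> (\<phi> m - u) + L2_norm \<Omega> u"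
        using L2.triangle[of "\<phi> m - u" \<Omega> u] uL \<phi>L by (simp add: L2_norm_def L2.mem_diff)
      moreover have "L2_norm \<Omega> u \<le> L2_norm \<Omega> (\<phi> m - u) + L2_norm \<Omega> (\<phi> m)"
        using L2.triangle[of "(-1) *\<^sub>R (\<phi> m - u)" \<Omega> "\<phi> m"] L2.norm_scale[of "\<phi> m - u" \<Omega> "-1"] uL \<phi>L
        by (simp add: L2_norm_def L2.mem_diff)
      moreover have "L2_norm \<Omega> (\<phi> m - u) \<le> H1_norm \<Omega> (\<phi> m - u)" by (rule L2_norm_le_H1_norm[OF D])
      ultimately show "norm (L2_norm \<Omega> (\<phi> m) - L2_norm \<Omega> u) \<le> H1_norm \<Omega> (\<phi> m - u)" by simp
    qed
    then have "(\<lambda>m. c * (L2_norm \<Omega> (\<phi> m))\<^sup>2) \<longlonglongrightarrow> c * (L2_norm \<Omega> u)\<^sup>2" by (intro tendsto_intros)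
    moreover have "c * (L2_norm \<Omega> (\<phi> m))\<^sup>2 \<le> a (\<phi> m) (\<phi> m)" for m
      using cA[of "\<phi> m"] H test_function_H2[OF open_domain \<phi>(1)] by (simp add: test_function_form[OF \<phi>(1) H])
    ultimately show ?thesis
      using a_limit[OF u u H \<phi>(2) H \<phi>(2)] by (meson LIMSEQ_le)
  qed
  with c show ?thesis by blast
qed

lemma a_psd_form: "psd_form (H10 \<Omega>) a"
proof
  fix u v w :: "'d vfield" and c
  assume u: "u \<in> H10 \<Omega>"
  show "0 \<le> a u u" using a_coercive u by (meson less_imp_le mult_nonneg_nonneg order_trans zero_le_power2)
  assume w: "w \<in> H10 \<Omega>"
  show "a (c *\<^sub>R u) w = c * a u w" using a_lincomb_left[OF u u w, of c 0] by simp
  assume v: "v \<in> H10 \<Omega>"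
  show "a (u + v) w = a u w + a v w" using a_lincomb_left[OF u v w, of 1 1] by simp
qed (auto intro: a_sym subspace_H10[OF open_domain])

end

text \<open>Restriction to S is injective on W and maps it into the span of finitely many functions,
  each supported at one point of S. The image of a basis of W is thus independent in a finitely
  spanned space, so the basis is finite.\<close>

lemma finite_spanning_of_determining_points:
  fixes W :: "('x \<Rightarrow> 'b::euclidean_space) set"
  assumes W: "subspace W" and S: "finite S"
    and det: "\<And>v. v \<in> W \<Longrightarrow> (\<And>x. x \<in> S \<Longrightarrow> v x = 0) \<Longrightarrow> v = 0"
  shows "\<exists>B. finite B \<and> W \<subseteq> span B"
proof -
  define \<delta> where "\<delta> x b = (\<lambda>y. if y = x then b else 0)" for x :: 'x and b :: 'b
  define r where "r v = (\<lambda>x. if x \<in> S then v x else 0)" for v :: "'x \<Rightarrow> 'b"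
  let ?D = "(\<lambda>(x, b). \<delta> x b) ` (S \<times> Basis)"
  have fin: "finite ?D" using S by auto
  have lin: "linear r" by (rule linearI) (auto simp: r_def fun_eq_iff)
  have r_span: "r v \<in> span ?D" for v
  proof -
    have "r v = (\<Sum>x\<in>S. \<Sum>b\<in>Basis. (v x \<bullet> b) *\<^sub>R \<delta> x b)"
    proof
      fix y
      have "(\<Sum>x\<in>S. \<Sum>b\<in>Basis. (v x \<bullet> b) *\<^sub>R \<delta> x b) y = (\<Sum>x\<in>S. if x = y then \<Sum>b\<in>Basis. (v y \<bullet> b) *\<^sub>R b else 0)"
        by (auto simp: \<delta>_def intro!: sum.cong)
      then show "r v y = (\<Sum>x\<in>S. \<Sum>b\<in>Basis. (v x \<bullet> b) *\<^sub>R \<delta> x b) y"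
        using S by (simp add: r_def euclidean_representation)
    qed
    also have "\<dots> \<in> span ?D" by (intro span_sum span_scale span_base) auto
    finally show ?thesis .
  qed
  obtain B where B: "B \<subseteq> W" "independent B" "W \<subseteq> span B"
    using real_vector.maximal_independent_subset[of W] by blast
  have spanB: "span B \<subseteq> W" using B(1) W by (rule span_minimal)
  have inj: "inj_on r (span B)"
  proof (rule inj_onI)
    fix u v assume uv: "u \<in> span B" "v \<in> span B" "r u = r v"
    then have "u - v \<in> W" using spanB subspace_diff[OF W] by blast
    moreover have "(u - v) x = 0" if "x \<in> S" for x
      using fun_cong[OF uv(3), of x] that by (simp add: r_def)
    ultimately have "u - v = 0" by (rule det)
    then show "u = v" by simp
  qed
  interpret r: linear r by (rule lin)
  have "independent (r ` B)"
    using r.independent_injective_image[of B] B(2) inj by (simp add: dependent_raw_def span_raw_def)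
  then have "finite (r ` B)" using real_vector.independent_span_bound[OF fin] r_span by blast
  then have "finite B" using inj inj_on_subset[OF inj span_superset] finite_imageD by blast
  with B show ?thesis by blast
qed

section \<open>Finite element spaces and fractional powers\<close>

text \<open>A continuous function that is nonzero somewhere is nonzero on a nonempty open set, which
  has positive measure. With the extension by zero this makes \<open>L2_inner\<close> definite on
  the finite element spaces.\<close>

lemma AE_zero_continuous_open:
  fixes v :: "'a::euclidean_space \<Rightarrow> 'b::euclidean_space"
  assumes \<Omega>: "open \<Omega>" and cont: "continuous_on \<Omega> v" and AE: "AE x in lborel. x \<in> \<Omega> \<longrightarrow> v x = 0" and x: "x \<in> \<Omega>"
  shows "v x = 0"
proof (rule ccontr)
  assume nz: "v x \<noteq> 0"
  have "open (\<Omega> \<inter> v -` (- {0}))" using cont \<Omega> by (rule continuous_open_preimage) auto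
  moreover have "\<Omega> \<inter> v -` (- {0}) \<noteq> {}" using nz x by auto
  ultimately have "\<not> negligible (\<Omega> \<inter> v -` (- {0}))" by (rule open_not_negligible)
  moreover have "\<Omega> \<inter> v -` (- {0}) \<in> null_sets lborel"
  proof -
    have "AE x in lborel. x \<notin> \<Omega> \<inter> v -` (- {0})" using AE by eventually_elim auto
    with \<open>open (\<Omega> \<inter> v -` (- {0}))\<close> show ?thesis by (subst AE_iff_null_sets) auto
  qed
  then have "negligible (\<Omega> \<inter> v -` (- {0}))"
    by (simp add: negligible_iff_null_sets null_sets_completionI)
  ultimately show False by contradiction
qed

lemma L2_inner_zero_AE:
  fixes v :: "real^'d \<Rightarrow> 'b::euclidean_space"
  assumes v: "v \<in> L2 \<Omega>" and z: "L2_inner \<Omega> v v = 0"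
  shows "AE x in lborel. x \<in> \<Omega> \<longrightarrow> v x = 0"
proof -
  have "AE x in lborel. indicat_real \<Omega> x *\<^sub>R (v x \<bullet> v x) = 0"
    using z L2_inner_integrable[OF v v] unfolding L2_inner_def set_lebesgue_integral_def set_integrable_def
    by (subst (asm) integral_nonneg_eq_0_iff_AE) auto
  then show ?thesis by eventually_elim (auto simp: indicator_def split: if_splits)
qed

section \<open>The finite element space of one mesh\<close>

locale fe_space = elliptic_form \<Omega> A a for \<Omega> :: "(real^'d::finite) set" and A a +
  fixes \<T> :: "(real^'d) set set"
  assumes mesh: "mesh_of \<Omega> \<T>"
begin

abbreviation "W \<equiv> P1_space \<Omega> \<T>"
abbreviation "B \<equiv> discrete_op \<Omega> a W"

lemma W_H10: "v \<in> W \<Longrightarrow> v \<in> H10 \<Omega>" by (simp add: P1_space_def)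
lemma W_L2: "v \<in> W \<Longrightarrow> v \<in> L2 \<Omega>" using W_H10 H10_H1 H1_L2 by blast

lemma subspace_P1: "subspace W"
proof (rule subspaceI_lincomb)
  have "(0 :: 'd vfield) \<in> H10 \<Omega>" by (rule subspace_0[OF subspace_H10[OF open_domain]])
  moreover have "\<exists>g c. linear g \<and> (\<forall>x\<in>K. (0 :: 'd vfield) x = g x + c)" for K
    by (intro exI[of _ "\<lambda>x. 0"]) (auto simp: linear_zero)
  ultimately show "0 \<in> W" by (simp add: P1_space_def zero_fun_def)
  fix u v b c assume u: "u \<in> W" and v: "v \<in> W"
  have "b *\<^sub>R u + c *\<^sub>R v \<in> H10 \<Omega>"
    using u v W_H10 by (intro subspace_add subspace_scale subspace_H10 open_domain) auto
  moreover have "continuous_on (closure \<Omega>) (b *\<^sub>R u + c *\<^sub>R v)"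
  proof -
    have "continuous_on (closure \<Omega>) (\<lambda>x. b *\<^sub>R u x + c *\<^sub>R v x)"
      using u v unfolding P1_space_def by (intro continuous_intros) auto
    then show ?thesis by (rule continuous_on_eq) simp
  qed
  moreover have "\<exists>g d. linear g \<and> (\<forall>x\<in>K. (b *\<^sub>R u + c *\<^sub>R v) x = g x + d)" if K: "K \<in> \<T>" for K
  proof -
    obtain g1 d1 where 1: "linear g1" "\<And>x. x \<in> K \<Longrightarrow> u x = g1 x + d1" using u K unfolding P1_space_def by blast
    obtain g2 d2 where 2: "linear g2" "\<And>x. x \<in> K \<Longrightarrow> v x = g2 x + d2" using v K unfolding P1_space_def by blast
    have "linear (\<lambda>x. b *\<^sub>R g1 x + c *\<^sub>R g2 x)"
      using 1(1) 2(1) by (intro linear_compose_add linear_compose_scale_right)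
    then show ?thesis using 1 2
      by (intro exI[of _ "\<lambda>x. b *\<^sub>R g1 x + c *\<^sub>R g2 x"] exI[of _ "b *\<^sub>R d1 + c *\<^sub>R d2"]) (auto simp: algebra_simps)
  qed
  ultimately show "b *\<^sub>R u + c *\<^sub>R v \<in> W" using u v by (simp add: P1_space_def)
qed

text \<open>The vertices of the simplices are determining points: the zero set of an affine map is
  convex, so it contains a simplex as soon as it contains the vertices.\<close>

lemma P1_finite_spanning: "\<exists>B. finite B \<and> W \<subseteq> span B"
proof -
  have fin: "finite \<T>" and cover: "\<Union>\<T> = closure \<Omega>" and "\<forall>K\<in>\<T>. int CARD('d) simplex K"
    using mesh unfolding mesh_of_def triangulation_def by auto
  then have "\<forall>K\<in>\<T>. \<exists>C. finite C \<and> K = convex hull C" unfolding simplex by blast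
  then obtain C where C: "\<And>K. K \<in> \<T> \<Longrightarrow> finite (C K) \<and> K = convex hull C K" by metis
  show ?thesis
  proof (rule finite_spanning_of_determining_points[OF subspace_P1, of "\<Union>K\<in>\<T>. C K"])
    show "finite (\<Union>K\<in>\<T>. C K)" using fin C by auto
    fix v assume v: "v \<in> W" and zero: "\<And>x. x \<in> (\<Union>K\<in>\<T>. C K) \<Longrightarrow> v x = 0"
    have "v x = 0" for x
    proof (cases "x \<in> \<Omega>")
      case True
      then obtain K where K: "K \<in> \<T>" "x \<in> K" using cover closure_subset by blast
      obtain g c where g: "linear g" "\<And>x. x \<in> K \<Longrightarrow> v x = g x + c" using v K unfolding P1_space_def by blast
      have "convex {y. g y + c = 0}"
      proof -
        have "{y. g y + c = 0} = g -` {- c}" by (auto simp: eq_neg_iff_add_eq_0)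
        then show ?thesis using convex_linear_vimage[OF g(1) convex_singleton] by simp
      qed
      moreover have "C K \<subseteq> {y. g y + c = 0}"
        using zero K C[OF K(1)] g(2) hull_subset[of "C K" convex] by fastforce
      ultimately have "K \<subseteq> {y. g y + c = 0}" using C[OF K(1)] hull_minimal by metis
      then show ?thesis using g(2) K by auto
    qed (use v in \<open>simp add: P1_space_def\<close>)
    then show "v = 0" by (simp add: fun_eq_iff)
  qed
qed

sublocale ip: fin_ip_space W "L2_inner \<Omega>"
proof -
  interpret psd_form W "L2_inner \<Omega>"
    using L2.psd_form_subset[OF subspace_P1] W_L2 by blast
  show "fin_ip_space W (L2_inner \<Omega>)"
  proof
    fix u assume u: "u \<in> W" and z: "L2_inner \<Omega> u u = 0"
    have "continuous_on \<Omega> u"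
      using u unfolding P1_space_def using continuous_on_subset[OF _ closure_subset] by blast
    from AE_zero_continuous_open[OF open_domain this L2_inner_zero_AE[OF W_L2[OF u] z]]
    have "u x = 0" for x using u by (cases "x \<in> \<Omega>") (auto simp: P1_space_def)
    then show "u = 0" by (simp add: fun_eq_iff)
  qed (rule P1_finite_spanning)
qed

lemma a_form: "psd_form W a"
  using psd_form.psd_form_subset[OF a_psd_form subspace_P1] W_H10 by blast

sublocale a: psd_form W a by (rule a_form)

lemma L2_proj_props:
  assumes v: "v \<in> L2 \<Omega>"
  shows L2_proj_mem: "L2_proj \<Omega> W v \<in> W"
    and L2_proj_inner: "y \<in> W \<Longrightarrow> L2_inner \<Omega> (L2_proj \<Omega> W v) y = L2_inner \<Omega> v y"
proof -
  have "\<exists>!w. w \<in> W \<and> (\<forall>y\<in>W. L2_inner \<Omega> w y = L2_inner \<Omega> v y)"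
    using v W_L2 by (intro ip.riesz) (auto simp: L2.form_add_right L2.form_scale_right)
  from theI'[OF this] show "L2_proj \<Omega> W v \<in> W" "y \<in> W \<Longrightarrow> L2_inner \<Omega> (L2_proj \<Omega> W v) y = L2_inner \<Omega> v y"
    unfolding L2_proj_def by auto
qed

lemma discrete_op_props:
  assumes v: "v \<in> W"
  shows discrete_op_mem: "B v \<in> W"
    and discrete_op_inner: "y \<in> W \<Longrightarrow> L2_inner \<Omega> (B v) y = a v y"
proof -
  have "\<exists>!w. w \<in> W \<and> (\<forall>y\<in>W. L2_inner \<Omega> w y = a v y)"
    using v by (intro ip.riesz) (auto simp: a.form_add_right a.form_scale_right)
  then have "\<exists>!w. w \<in> W \<and> (\<forall>y\<in>W. a v y = L2_inner \<Omega> w y)" by (metis (no_types, lifting))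
  from theI'[OF this] show "B v \<in> W" "y \<in> W \<Longrightarrow> L2_inner \<Omega> (B v) y = a v y"
    unfolding discrete_op_def by auto
qed

text \<open>The discrete operator is given only through its pairings with W, so linearity is proved
  by testing; its self-adjointness is the symmetry of \<open>a\<close>.\<close>

sublocale op: selfadj_op W "L2_inner \<Omega>" B
proof
  fix u v c assume u: "u \<in> W"
  show "B u \<in> W" by (rule discrete_op_mem[OF u])
  show "B (c *\<^sub>R u) = c *\<^sub>R B u"
    using u by (intro ip.eq_by_testing)
      (simp_all add: discrete_op_mem discrete_op_inner ip.mem_scale ip.form_scale_left a.form_scale_left)
  assume v: "v \<in> W"
  show "B (u + v) = B u + B v"
    using u v by (intro ip.eq_by_testing)
      (simp_all add: discrete_op_mem discrete_op_inner ip.mem_add ip.form_add_left a.form_add_left)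
  show "L2_inner \<Omega> (B u) v = L2_inner \<Omega> u (B v)"
    using u v a.form_sym[OF u v] ip.form_sym[OF u discrete_op_mem[OF v]] by (simp add: discrete_op_inner)
qed

text \<open>\<open>op_power\<close> is defined by projections onto eigenspaces, hence without
  choosing a basis; calculations are easier in one eigenbasis. Projecting onto an eigenspace keeps
  the basis vectors with that eigenvalue, and regrouping the sum over eigenvalues gives the
  expansion. Positivity of \<nu> comes from the coercivity of \<open>a\<close>.\<close>

lemma op_power_expansion:
  obtains E \<nu> where "ip.orthonormal E" "finite E" "\<And>e. e \<in> E \<Longrightarrow> \<nu> e > 0"
    "\<And>v. v \<in> W \<Longrightarrow> v = (\<Sum>e\<in>E. L2_inner \<Omega> v e *\<^sub>R e)"
    "\<And>e. e \<in> E \<Longrightarrow> B e = \<nu> e *\<^sub>R e"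
    "\<And>l v. v \<in> W \<Longrightarrow> op_power \<Omega> W B l v = (\<Sum>e\<in>E. (\<nu> e powr l * L2_inner \<Omega> v e) *\<^sub>R e)"
proof -
  let ?g = "L2_inner \<Omega>"
  obtain E \<nu> where E: "ip.orthonormal E" "finite E" and eig: "\<And>e. e \<in> E \<Longrightarrow> B e = \<nu> e *\<^sub>R e"
    and basis: "\<And>v. v \<in> W \<Longrightarrow> v = (\<Sum>e\<in>E. ?g v e *\<^sub>R e)"
    using op.eigenbasis_exists by blast
  have EW: "e \<in> W" and one: "?g e e = 1" if "e \<in> E" for e using E that by (auto simp: ip.orthonormal_def)
  have ne: "e \<noteq> 0" if "e \<in> E" for e using one[OF that] ip.form_zero_left[OF ip.mem_zero] by auto
  have pos: "\<nu> e > 0" if e: "e \<in> E" for e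
  proof -
    obtain c where c: "c > 0" "\<And>u. u \<in> H10 \<Omega> \<Longrightarrow> c * (L2_norm \<Omega> u)\<^sup>2 \<le> a u u" using a_coercive by blast
    have "\<nu> e = ?g (B e) e" using eig[OF e] one[OF e] EW[OF e] by (simp add: ip.form_scale_left)
    also have "\<dots> = a e e" by (rule discrete_op_inner[OF EW[OF e] EW[OF e]])
    also have "\<dots> \<ge> c * (L2_norm \<Omega> e)\<^sup>2" using c(2) W_H10[OF EW[OF e]] by blast
    finally show ?thesis using c(1) one[OF e] by (simp add: L2_norm_def)
  qed
  \<comment> \<open>Eigenvectors of a self-adjoint operator for different eigenvalues are
    orthogonal.\<close>
  have coeff_eig: "?g w e = 0" if "w \<in> eigenspace W B \<mu>" "e \<in> E" "\<nu> e \<noteq> \<mu>" for w e \<mu>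
  proof -
    have w: "w \<in> W" "B w = \<mu> *\<^sub>R w" using that by (auto simp: eigenspace_def fun_eq_iff)
    have "\<mu> * ?g w e = ?g (B w) e" using w EW that by (simp add: ip.form_scale_left)
    also have "\<dots> = ?g w (B e)" using w(1) EW that by (intro op.op_sym) auto
    also have "\<dots> = \<nu> e * ?g w e" using w(1) EW that by (simp add: eig ip.form_scale_right)
    finally show ?thesis using that by simp
  qed
  have eigE: "e \<in> eigenspace W B (\<nu> e)" if "e \<in> E" for e
    using that EW eig by (simp add: eigenspace_def fun_eq_iff)
  have evs: "eigenvalues W B = \<nu> ` E"
  proof (intro set_eqI iffI)
    fix \<mu> assume "\<mu> \<in> eigenvalues W B"
    then obtain w where w: "w \<in> eigenspace W B \<mu>" "w \<noteq> 0" by (auto simp: eigenvalues_def zero_fun_def)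
    show "\<mu> \<in> \<nu> ` E"
    proof (rule ccontr)
      assume "\<mu> \<notin> \<nu> ` E"
      then have "?g w e = 0" if "e \<in> E" for e using coeff_eig[OF w(1) that] that by auto
      then have "(\<Sum>e\<in>E. ?g w e *\<^sub>R e) = 0" by simp
      with basis[of w] w show False by (simp add: eigenspace_def)
    qed
  next
    fix \<mu> assume "\<mu> \<in> \<nu> ` E"
    then show "\<mu> \<in> eigenvalues W B" using eigE ne by (auto simp: eigenvalues_def zero_fun_def)
  qed
  have proj: "L2_proj \<Omega> (eigenspace W B \<mu>) v = (\<Sum>e\<in>{e\<in>E. \<nu> e = \<mu>}. ?g v e *\<^sub>R e)" (is "_ = ?p")
    if v: "v \<in> W" for v \<mu>
  proof -
    let ?U = "eigenspace W B \<mu>"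
    have pW: "?p \<in> W" using EW by (intro ip.mem_sum ip.mem_scale) auto
    have "B ?p = (\<Sum>e\<in>{e\<in>E. \<nu> e = \<mu>}. ?g v e *\<^sub>R B e)"
      using E EW by (intro op.op_expand) auto
    also have "\<dots> = \<mu> *\<^sub>R ?p"
      unfolding scaleR_sum_right using eig by (intro sum.cong refl) auto
    finally have pU: "?p \<in> ?U" using pW by (simp add: eigenspace_def fun_eq_iff)
    have test: "?g ?p y = ?g v y" if y: "y \<in> ?U" for y
    proof -
      have yW: "y \<in> W" using y by (simp add: eigenspace_def)
      have "?g v y = ?g v (\<Sum>e\<in>E. ?g y e *\<^sub>R e)" using basis[OF yW] by simp
      also have "\<dots> = (\<Sum>e\<in>E. ?g y e * ?g v e)" using v EW by (intro ip.form_expand_right) auto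
      also have "\<dots> = (\<Sum>e\<in>{e\<in>E. \<nu> e = \<mu>}. ?g y e * ?g v e)"
        using E coeff_eig[OF y] by (intro sum.mono_neutral_right) auto
      also have "\<dots> = (\<Sum>e\<in>{e\<in>E. \<nu> e = \<mu>}. ?g v e * ?g e y)"
        by (intro sum.cong refl) (simp add: L2_inner_commute mult.commute)
      also have "\<dots> = ?g ?p y" using EW yW by (intro ip.form_expand_left[symmetric]) auto
      finally show ?thesis by simp
    qed
    show ?thesis
      unfolding L2_proj_def
    proof (rule the_equality)
      fix w assume w: "w \<in> ?U \<and> (\<forall>y\<in>?U. ?g w y = ?g v y)"
      then have wW: "w \<in> W" by (simp add: eigenspace_def)
      \<comment> \<open>Both candidates lie in the eigenspace, so their difference is itself a test
        vector there.\<close>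
      have "w - ?p \<in> ?U"
      proof -
        have "B (w - ?p) = B w - B ?p" using op.op_add[of "w - ?p" ?p] wW pW by (simp add: ip.mem_diff)
        then show ?thesis using w pU wW pW
          by (simp add: eigenspace_def ip.mem_diff fun_eq_iff scaleR_diff_right del: sum_fun_apply)
      qed
      then have "?g (w - ?p) (w - ?p) = 0"
        using w test[of "w - ?p"] wW pW by (simp add: ip.form_diff_left ip.mem_diff)
      then show "w = ?p" using ip.form_definite[of "w - ?p"] wW pW by (simp add: ip.mem_diff)
    qed (use pU test in auto)
  qed
  have "op_power \<Omega> W B l v = (\<Sum>e\<in>E. (\<nu> e powr l * ?g v e) *\<^sub>R e)" if v: "v \<in> W" for l v
  proof -
    have "op_power \<Omega> W B l v = (\<Sum>\<mu>\<in>\<nu> ` E. \<mu> powr l *\<^sub>R L2_proj \<Omega> (eigenspace W B \<mu>) v)"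
      by (simp add: op_power_def evs fun_eq_iff)
    also have "\<dots> = (\<Sum>\<mu>\<in>\<nu> ` E. \<Sum>e\<in>{e\<in>E. \<nu> e = \<mu>}. (\<nu> e powr l * ?g v e) *\<^sub>R e)"
      unfolding proj[OF v] scaleR_sum_right by (intro sum.cong refl) auto
    also have "\<dots> = (\<Sum>e\<in>E. (\<nu> e powr l * ?g v e) *\<^sub>R e)"
      by (rule sum.image_gen[OF E(2), symmetric])
    finally show ?thesis .
  qed
  with E pos basis eig that show thesis by blast
qed

abbreviation "pw \<equiv> op_power \<Omega> W B"

text \<open>In the eigenbasis \<open>pw l\<close> multiplies the coefficient at e by
  \<open>\<nu> e powr l\<close>, so every law is an identity between coefficients.
  \<open>pw_half\<close> and \<open>pw_Suc\<close> connect the norms of the theorem with the two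
  forms used in the energy argument.\<close>

lemma pw_props:
  shows pw_mem: "u \<in> W \<Longrightarrow> pw l u \<in> W"
    and pw_half: "u \<in> W \<Longrightarrow> L2_inner \<Omega> (pw (l / 2) u) (pw (l / 2) u) = L2_inner \<Omega> (pw l u) u"
    and pw_Suc: "u \<in> W \<Longrightarrow> v \<in> W \<Longrightarrow> L2_inner \<Omega> (pw (l + 1) u) v = a (pw l u) v"
    and pw_zero: "u \<in> W \<Longrightarrow> pw 0 u = u"
    and pw_form: "psd_form W (\<lambda>u v. L2_inner \<Omega> (pw l u) v)"
proof -
  let ?g = "L2_inner \<Omega>"
  obtain E \<nu> where E: "ip.orthonormal E" "finite E" and pos: "\<And>e. e \<in> E \<Longrightarrow> \<nu> e > 0"
    and basis: "\<And>v. v \<in> W \<Longrightarrow> v = (\<Sum>e\<in>E. ?g v e *\<^sub>R e)"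
    and eig: "\<And>e. e \<in> E \<Longrightarrow> B e = \<nu> e *\<^sub>R e"
    and pw: "\<And>l v. v \<in> W \<Longrightarrow> pw l v = (\<Sum>e\<in>E. (\<nu> e powr l * ?g v e) *\<^sub>R e)"
    using op_power_expansion by blast
  have EW: "e \<in> W" if "e \<in> E" for e using E that by (auto simp: ip.orthonormal_def)
  show mem: "pw l u \<in> W" if "u \<in> W" for l u
    unfolding pw[OF that] using EW by (intro ip.mem_sum ip.mem_scale) auto
  have val: "?g (pw l u) v = (\<Sum>e\<in>E. \<nu> e powr l * (?g u e * ?g v e))" if "u \<in> W" "v \<in> W" for l u v
    unfolding pw[OF that(1)] using that EW
    by (subst ip.form_expand_left) (auto simp: L2_inner_commute[of \<Omega> v] mult.assoc)
  have coeff: "?g (pw l u) e = \<nu> e powr l * ?g u e" if "u \<in> W" "e \<in> E" for l u e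
    unfolding pw[OF that(1)] using ip.orthonormal_coeff[OF E order_refl that(2)] .
  show "?g (pw (l / 2) u) (pw (l / 2) u) = ?g (pw l u) u" if u: "u \<in> W" for l u
    unfolding val[OF u mem[OF u]] val[OF u u]
  proof (intro sum.cong refl)
    fix e assume e: "e \<in> E"
    have "\<nu> e powr (l / 2) * \<nu> e powr (l / 2) = \<nu> e powr l"
      by (simp flip: powr_add)
    then show "\<nu> e powr (l / 2) * (?g u e * ?g (pw (l / 2) u) e) = \<nu> e powr l * (?g u e * ?g u e)"
      unfolding coeff[OF u e] by (metis mult.left_commute mult.assoc)
  qed
  show "?g (pw (l + 1) u) v = a (pw l u) v" if u: "u \<in> W" and v: "v \<in> W" for l u v
  proof -
    have "a (pw l u) v = ?g (B (pw l u)) v" by (rule discrete_op_inner[OF mem[OF u] v, symmetric])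
    also have "\<dots> = ?g (pw l u) (B v)" by (rule op.op_sym[OF mem[OF u] v])
    also have "\<dots> = (\<Sum>e\<in>E. \<nu> e powr l * (?g u e * ?g (B v) e))" by (rule val[OF u discrete_op_mem[OF v]])
    also have "\<dots> = (\<Sum>e\<in>E. \<nu> e powr (l + 1) * (?g u e * ?g v e))"
    proof (intro sum.cong refl)
      fix e assume e: "e \<in> E"
      have "?g (B v) e = \<nu> e * ?g v e"
        using op.op_sym[OF v EW[OF e]] eig[OF e] EW[OF e] v by (simp add: ip.form_scale_right)
      then show "\<nu> e powr l * (?g u e * ?g (B v) e) = \<nu> e powr (l + 1) * (?g u e * ?g v e)"
        using pos[OF e] by (simp add: powr_add)
    qed
    finally show ?thesis using val[OF u v] by simp
  qed
  show "pw 0 u = u" if "u \<in> W" for u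
  proof -
    have "pw 0 u = (\<Sum>e\<in>E. ?g u e *\<^sub>R e)"
      \<comment> \<open>Positivity of the eigenvalues matters here, because
        \<open>0 powr 0 = 0\<close>.\<close>
      unfolding pw[OF that] using pos by (intro sum.cong refl) (simp add: less_imp_neq[symmetric])
    then show ?thesis using basis[OF that] by simp
  qed
  show "psd_form W (\<lambda>u v. ?g (pw l u) v)"
  proof
    fix u v w c assume u: "u \<in> W"
    show "0 \<le> ?g (pw l u) u" unfolding val[OF u u] by (intro sum_nonneg) simp
    assume w: "w \<in> W"
    show "?g (pw l (c *\<^sub>R u)) w = c * ?g (pw l u) w"
      unfolding val[OF u w] val[OF ip.mem_scale[OF u] w] using u EW
      by (simp add: ip.form_scale_left sum_distrib_left algebra_simps)
    assume v: "v \<in> W"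
    show "?g (pw l u) v = ?g (pw l v) u"
      unfolding val[OF u v] val[OF v u] by (simp add: mult.commute)
    show "?g (pw l (u + v)) w = ?g (pw l u) w + ?g (pw l v) w"
      unfolding val[OF u w] val[OF v w] val[OF ip.mem_add[OF u v] w] using u v EW
      by (simp add: ip.form_add_left sum.distrib algebra_simps)
  qed (rule subspace_P1)
qed

text \<open>By \<open>pw_Suc\<close> this is the form of the power l + 1, to which
  \<open>pw_form\<close> applies.\<close>

lemma a_pw_form: "psd_form W (\<lambda>u v. a (pw l u) v)"
proof -
  interpret psd_form W "\<lambda>u v. L2_inner \<Omega> (pw (l + 1) u) v" by (rule pw_form)
  show ?thesis
    by unfold_locales
      (auto simp flip: pw_Suc simp: subspace_P1 form_add_left form_scale_left form_nonneg ip.mem_add ip.mem_scale intro: form_sym)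
qed

end

section \<open>Kernels of positive type\<close>

context psd_form
begin

text \<open>The weight \<open>q - \<bar>i - j\<bar>\<close> counts the windows of length \<open>q\<close> that contain both \<open>i\<close> and \<open>j\<close>.\<close>

lemma tent_sum_nonneg:
  fixes c :: "nat \<Rightarrow> 'a"
  assumes c: "\<And>i. i < M \<Longrightarrow> c i \<in> W"
  shows "0 \<le> (\<Sum>i<M. \<Sum>j<M. real (q - (max i j - min i j)) * g (c i) (c j))"
proof -
  \<comment> \<open>\<open>w x i\<close> tells whether i lies in the window of length q with right
    end x; the range x < M + q includes every window that meets the indices below M.\<close>
  define w :: "nat \<Rightarrow> nat \<Rightarrow> real" where "w x i = (if i \<le> x \<and> x < i + q then 1 else 0)" for x i
  define S where "S x = (\<Sum>i<M. w x i *\<^sub>R c i)" for x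
  have SW: "S x \<in> W" for x unfolding S_def using c by (intro mem_sum mem_scale) auto
  have "g (S x) (S x) = (\<Sum>i<M. \<Sum>j<M. w x i * w x j * g (c i) (c j))" for x
  proof -
    have "g (S x) (S x) = (\<Sum>i<M. w x i * g (c i) (S x))"
      using c SW unfolding S_def[of x] by (intro form_expand_left) (auto simp: S_def[symmetric])
    also have "\<dots> = (\<Sum>i<M. w x i * (\<Sum>j<M. w x j * g (c i) (c j)))"
      using c unfolding S_def by (intro sum.cong refl arg_cong2[where f="(*)"] form_expand_right) auto
    finally show ?thesis by (simp add: sum_distrib_left mult.assoc)
  qed
  then have "(\<Sum>x<M+q. g (S x) (S x)) = (\<Sum>x<M+q. \<Sum>i<M. \<Sum>j<M. w x i * w x j * g (c i) (c j))" by simp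
  also have "\<dots> = (\<Sum>i<M. \<Sum>x<M+q. \<Sum>j<M. w x i * w x j * g (c i) (c j))" by (rule sum.swap)
  also have "\<dots> = (\<Sum>i<M. \<Sum>j<M. \<Sum>x<M+q. w x i * w x j * g (c i) (c j))"
    by (intro sum.cong refl sum.swap)
  also have "\<dots> = (\<Sum>i<M. \<Sum>j<M. real (q - (max i j - min i j)) * g (c i) (c j))"
  proof (intro sum.cong refl)
    fix i j assume ij: "i \<in> {..<M}" "j \<in> {..<M}"
    have "(\<Sum>x<M+q. w x i * w x j) = (\<Sum>x\<in>{max i j..<min i j + q}. 1)"
      using ij by (intro sum.mono_neutral_cong_right) (auto simp: w_def)
    \<comment> \<open>Truncated subtraction yields 0 when i and j are too far apart to share a
      window.\<close>
    also have "\<dots> = real (q - (max i j - min i j))"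
      by (simp add: max_def min_def)
    finally show "(\<Sum>x<M+q. w x i * w x j * g (c i) (c j)) = real (q - (max i j - min i j)) * g (c i) (c j)"
      by (simp add: sum_distrib_right[symmetric])
  qed
  finally have "(\<Sum>i<M. \<Sum>j<M. real (q - (max i j - min i j)) * g (c i) (c j)) = (\<Sum>x<M+q. g (S x) (S x))"
    by (rule sym)
  also have "\<dots> \<ge> 0" by (intro sum_nonneg form_nonneg SW)
  finally show ?thesis .
qed

lemma constant_sum_nonneg:
  fixes c :: "nat \<Rightarrow> 'a"
  assumes c: "\<And>i. i < M \<Longrightarrow> c i \<in> W"
  shows "0 \<le> (\<Sum>i<M. \<Sum>j<M. g (c i) (c j))"
proof -
  have SW: "(\<Sum>i<M. c i) \<in> W" using c by (intro mem_sum) auto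
  have "g (\<Sum>i<M. c i) (\<Sum>i<M. c i) = (\<Sum>i<M. g (c i) (\<Sum>j<M. c j))"
    using c SW by (intro form_sum_left) auto
  also have "\<dots> = (\<Sum>i<M. \<Sum>j<M. g (c i) (c j))"
    using c by (intro sum.cong refl form_sum_right) auto
  finally show ?thesis using form_nonneg[OF SW] by simp
qed

text \<open>A discrete form of Polya's criterion: summation by parts, done twice, writes b as a
  combination of the constant sequence and of tents. The coefficients are b M, d M and second
  differences of b, all nonnegative.\<close>

lemma convex_sequence_sum_nonneg:
  fixes c :: "nat \<Rightarrow> 'a" and b :: "nat \<Rightarrow> real"
  assumes c: "\<And>i. i < M \<Longrightarrow> c i \<in> W"
    and b: "\<And>k. 0 \<le> b k" "\<And>k. b (Suc k) \<le> b k" "\<And>k. 2 * b (Suc k) \<le> b k + b (Suc (Suc k))"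
  shows "0 \<le> (\<Sum>i<M. \<Sum>j<M. b (max i j - min i j) * g (c i) (c j))"
proof -
  define d where "d k = b k - b (Suc k)" for k
  \<comment> \<open>The Taylor formula about N for differences. Truncated subtraction turns
    \<open>real (Suc p - k)\<close> into a tent that vanishes for k > p.\<close>
  have rep: "b k = b N + d N * real (N - k) + (\<Sum>p<N. (d p - d (Suc p)) * real (Suc p - k))" if "k \<le> N" for k N
    using that
  proof (induction N)
    case (Suc N)
    show ?case
    proof (cases "k = Suc N")
      case False
      with Suc have "k \<le> N" by simp
      then show ?thesis using Suc.IH by (simp add: d_def of_nat_diff algebra_simps Suc_diff_le)
    qed simp
  qed simp
  have d: "0 \<le> d k" "d (Suc k) \<le> d k" for k using b(2)[of k] b(3)[of k] by (simp_all add: d_def)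
  let ?G = "\<lambda>i j. g (c i) (c j)"
  have "(\<Sum>i<M. \<Sum>j<M. b (max i j - min i j) * ?G i j)
    = (\<Sum>i<M. \<Sum>j<M. b M * ?G i j + d M * (real (M - (max i j - min i j)) * ?G i j)
        + (\<Sum>p<M. (d p - d (Suc p)) * (real (Suc p - (max i j - min i j)) * ?G i j)))"
    by (intro sum.cong refl) (subst rep[of _ M], auto simp: algebra_simps sum_distrib_left sum_distrib_right)
  also have "\<dots> = b M * (\<Sum>i<M. \<Sum>j<M. ?G i j) + d M * (\<Sum>i<M. \<Sum>j<M. real (M - (max i j - min i j)) * ?G i j)
        + (\<Sum>i<M. \<Sum>j<M. \<Sum>p<M. (d p - d (Suc p)) * (real (Suc p - (max i j - min i j)) * ?G i j))"
    by (simp add: sum.distrib sum_distrib_left)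
  also have "(\<Sum>i<M. \<Sum>j<M. \<Sum>p<M. (d p - d (Suc p)) * (real (Suc p - (max i j - min i j)) * ?G i j))
     = (\<Sum>i<M. \<Sum>p<M. \<Sum>j<M. (d p - d (Suc p)) * (real (Suc p - (max i j - min i j)) * ?G i j))"
    by (intro sum.cong refl sum.swap)
  also have "\<dots> = (\<Sum>p<M. \<Sum>i<M. \<Sum>j<M. (d p - d (Suc p)) * (real (Suc p - (max i j - min i j)) * ?G i j))"
    by (rule sum.swap)
  also have "\<dots> = (\<Sum>p<M. (d p - d (Suc p)) * (\<Sum>i<M. \<Sum>j<M. real (Suc p - (max i j - min i j)) * ?G i j))"
    by (simp add: sum_distrib_left)
  finally have eq: "(\<Sum>i<M. \<Sum>j<M. b (max i j - min i j) * ?G i j) =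
      b M * (\<Sum>i<M. \<Sum>j<M. ?G i j) + d M * (\<Sum>i<M. \<Sum>j<M. real (M - (max i j - min i j)) * ?G i j)
      + (\<Sum>p<M. (d p - d (Suc p)) * (\<Sum>i<M. \<Sum>j<M. real (Suc p - (max i j - min i j)) * ?G i j))" .
  show ?thesis
    unfolding eq
  proof (intro add_nonneg_nonneg sum_nonneg)
    show "0 \<le> b M * (\<Sum>i<M. \<Sum>j<M. ?G i j)"
      using b(1) constant_sum_nonneg[of M c, OF c] by simp
    show "0 \<le> d M * (\<Sum>i<M. \<Sum>j<M. real (M - (max i j - min i j)) * ?G i j)"
      using d(1) tent_sum_nonneg[of M c M, OF c] by (intro mult_nonneg_nonneg) auto
    show "0 \<le> (d p - d (Suc p)) * (\<Sum>i<M. \<Sum>j<M. real (Suc p - (max i j - min i j)) * ?G i j)" for p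
      using d(2)[of p] tent_sum_nonneg[of M c "Suc p", OF c] by (intro mult_nonneg_nonneg) auto
  qed
qed

text \<open>Twice the triangle sum is the full symmetric sum plus the diagonal, and both are
  nonnegative.\<close>

lemma convex_sequence_triangle_sum_nonneg:
  fixes c :: "nat \<Rightarrow> 'a" and b :: "nat \<Rightarrow> real"
  assumes c: "\<And>i. i < M \<Longrightarrow> c i \<in> W"
    and b: "\<And>k. 0 \<le> b k" "\<And>k. b (Suc k) \<le> b k" "\<And>k. 2 * b (Suc k) \<le> b k + b (Suc (Suc k))"
  shows "0 \<le> (\<Sum>i<M. \<Sum>j<M. if i \<le> j then b (j - i) * g (c i) (c j) else 0)"
proof -
  let ?H = "\<lambda>i j. if i \<le> j then b (j - i) * g (c i) (c j) else 0"
  have "(\<Sum>i<M. \<Sum>j<M. b (max i j - min i j) * g (c i) (c j)) + (\<Sum>i<M. b 0 * g (c i) (c i))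
      = (\<Sum>i<M. \<Sum>j<M. b (max i j - min i j) * g (c i) (c j) + (if i = j then b 0 * g (c i) (c i) else 0))"
    by (simp add: sum.distrib)
  also have "\<dots> = (\<Sum>i<M. \<Sum>j<M. ?H i j + ?H j i)"
    using c by (intro sum.cong refl) (auto simp: form_sym max_def min_def)
  also have "\<dots> = (\<Sum>i<M. \<Sum>j<M. ?H i j) + (\<Sum>i<M. \<Sum>j<M. ?H j i)" by (simp add: sum.distrib)
  also have "(\<Sum>i<M. \<Sum>j<M. ?H j i) = (\<Sum>i<M. \<Sum>j<M. ?H i j)" by (rule sum.swap)
  finally have "(\<Sum>i<M. \<Sum>j<M. b (max i j - min i j) * g (c i) (c j)) + (\<Sum>i<M. b 0 * g (c i) (c i))
      = 2 * (\<Sum>i<M. \<Sum>j<M. ?H i j)" by simp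
  moreover have "0 \<le> (\<Sum>i<M. b 0 * g (c i) (c i))"
    using b c by (intro sum_nonneg mult_nonneg_nonneg form_nonneg) auto
  ultimately show ?thesis using convex_sequence_sum_nonneg[of M c b, OF c b] by linarith
qed

end

section \<open>Passage from sums to integrals\<close>

lemma eventually_less_limits:
  fixes a b :: "'a::{dense_linorder, linorder_topology}"
  assumes "(f \<longlongrightarrow> a) F" "(g \<longlongrightarrow> b) F" "a < b"
  shows "\<forall>\<^sub>F x in F. f x < g x"
proof -
  obtain c where "a < c" "c < b" using dense[OF assms(3)] by blast
  from order_tendstoD(2)[OF assms(1) this(1)] order_tendstoD(1)[OF assms(2) this(2)]
  show ?thesis by eventually_elim (rule less_trans)
qed

text \<open>The interval is half open so that the cell index stays below M; the point \<beta> itself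
  would get the index M.\<close>

lemma step_integral:
  fixes \<alpha> \<beta> h :: real and M :: nat and G :: "nat \<Rightarrow> real"
  assumes h: "h > 0" "\<beta> = \<alpha> + real M * h"
  shows "has_bochner_integral lborel (\<lambda>t. indicator {\<alpha>..<\<beta>} t * G (nat \<lfloor>(t - \<alpha>) / h\<rfloor>)) (h * (\<Sum>i<M. G i))"
proof -
  have cell: "t \<in> {\<alpha> + real i * h..<\<alpha> + real (Suc i) * h} \<longleftrightarrow> nat \<lfloor>(t - \<alpha>) / h\<rfloor> = i" if "t \<ge> \<alpha>" for t i
  proof -
    have "nat \<lfloor>(t - \<alpha>) / h\<rfloor> = i \<longleftrightarrow> \<lfloor>(t - \<alpha>) / h\<rfloor> = int i" using that h by auto
    also have "\<dots> \<longleftrightarrow> real i \<le> (t - \<alpha>) / h \<and> (t - \<alpha>) / h < real i + 1" by (simp add: floor_eq_iff)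
    also have "\<dots> \<longleftrightarrow> t \<in> {\<alpha> + real i * h..<\<alpha> + real (Suc i) * h}"
      using h by (auto simp: pos_le_divide_eq pos_divide_less_eq algebra_simps)
    finally show ?thesis by blast
  qed
  have eq: "indicator {\<alpha>..<\<beta>} t * G (nat \<lfloor>(t - \<alpha>) / h\<rfloor>)
      = (\<Sum>i<M. G i * indicator {\<alpha> + real i * h..<\<alpha> + real (Suc i) * h} t)" for t
  proof (cases "t \<ge> \<alpha>")
    case True
    define k where "k = nat \<lfloor>(t - \<alpha>) / h\<rfloor>"
    have "(\<Sum>i<M. G i * indicator {\<alpha> + real i * h..<\<alpha> + real (Suc i) * h} t) = (\<Sum>i<M. if i = k then G k else 0)"
      using cell[OF True] by (intro sum.cong refl) (auto simp: indicator_def k_def)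
    also have "\<dots> = (if k < M then G k else 0)" by simp
    also have "k < M \<longleftrightarrow> t < \<beta>"
    proof -
      have t: "\<alpha> + real k * h \<le> t" "t < \<alpha> + real (Suc k) * h" using cell[OF True, of k] by (auto simp: k_def)
      have "t < \<beta>" if "k < M"
      proof -
        have "real (Suc k) * h \<le> real M * h" using that h by (intro mult_right_mono) auto
        with t h show ?thesis by linarith
      qed
      moreover have "\<not> t < \<beta>" if "\<not> k < M"
      proof -
        have "real M * h \<le> real k * h" using that h by (intro mult_right_mono) auto
        with t h show ?thesis by linarith
      qed
      ultimately show ?thesis by blast
    qed
    finally show ?thesis using True by (simp add: k_def indicator_def)
  next
    case False
    then have "t < \<alpha> + real i * h" for i using h by (smt (verit) mult_nonneg_nonneg of_nat_0_le_iff)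
    then have z: "indicat_real {\<alpha> + real i * h..<\<alpha> + real (Suc i) * h} t = 0" for i
      by (simp add: not_le del: of_nat_Suc)
    show ?thesis using False unfolding z by simp
  qed
  have "has_bochner_integral lborel (\<lambda>t. \<Sum>i<M. G i * indicator {\<alpha> + real i * h..<\<alpha> + real (Suc i) * h} t) (\<Sum>i<M. G i * h)"
  proof (intro has_bochner_integral_sum has_bochner_integral_mult_right)
    fix i
    have "has_bochner_integral lborel (indicator {\<alpha> + real i * h..<\<alpha> + real (Suc i) * h})
       (measure lborel {\<alpha> + real i * h..<\<alpha> + real (Suc i) * h})"
      using h by (intro has_bochner_integral_real_indicator) (auto simp: algebra_simps)
    then show "has_bochner_integral lborel (indicat_real {\<alpha> + real i * h..<\<alpha> + real (Suc i) * h}) h"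
      using h by (simp add: algebra_simps)
  qed
  then show ?thesis unfolding eq by (simp add: sum_distrib_left mult.commute)
qed

text \<open>Riemann sums on the grid of width \<open>(\<beta> - \<alpha>) / M\<close> reduce the claim to the discrete one.\<close>

theorem (in psd_form) convex_kernel_positive_type:
  fixes \<phi> :: "real \<Rightarrow> 'a" and \<Xi> :: "real \<Rightarrow> real" and I :: "'i \<Rightarrow> real set"
  assumes \<alpha>\<beta>: "\<alpha> < \<beta>"
    and \<Xi>: "continuous_on UNIV \<Xi>" "\<And>x. 0 \<le> \<Xi> x" "\<And>x. \<Xi> x \<le> \<kappa>"
    and decr: "\<And>x h. 0 \<le> x \<Longrightarrow> 0 \<le> h \<Longrightarrow> \<Xi> (x + h) \<le> \<Xi> x"
    and conv: "\<And>x h. 0 \<le> x \<Longrightarrow> 0 \<le> h \<Longrightarrow> 2 * \<Xi> (x + h) \<le> \<Xi> x + \<Xi> (x + 2 * h)"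
    and S: "finite S" "\<And>m. m \<in> S \<Longrightarrow> c m \<in> W" "\<And>m. m \<in> S \<Longrightarrow> open (I m)"
    and cover: "finite D" "{\<alpha>..\<beta>} \<subseteq> (\<Union>m\<in>S. I m) \<union> D"
    and disj: "\<And>m k t. m \<in> S \<Longrightarrow> k \<in> S \<Longrightarrow> t \<in> I m \<Longrightarrow> t \<in> I k \<Longrightarrow> m = k"
    and \<phi>: "\<phi> = (\<lambda>t. \<Sum>m\<in>S. indicat_real (I m) t *\<^sub>R c m)"
  shows "0 \<le> (LINT t:{\<alpha>..\<beta>}|lborel. LINT s:{t..\<beta>}|lborel. \<Xi> (s - t) * g (\<phi> t) (\<phi> s))"
proof -
  have \<phi>W: "\<phi> t \<in> W" for t unfolding \<phi> using S by (intro mem_sum mem_scale) auto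
  have \<phi>I: "\<phi> t = c m" if m: "m \<in> S" and t: "t \<in> I m" for m t
  proof -
    have ind: "indicat_real (I k) t = (if k = m then 1 else 0)" if "k \<in> S" for k
      using disj[OF that m _ t] t by (cases "t \<in> I k") auto
    have "\<phi> t = (\<Sum>k\<in>S. if k = m then c m else 0)"
      unfolding \<phi> by (intro sum.cong refl) (simp add: ind)
    then show ?thesis using S m by simp
  qed
  have g_expand: "g (\<phi> t) (\<phi> s) = (\<Sum>m\<in>S. \<Sum>k\<in>S. indicat_real (I m) t * indicat_real (I k) s * g (c m) (c k))" for t s
  proof -
    have "g (\<phi> t) (\<phi> s) = (\<Sum>m\<in>S. indicat_real (I m) t * g (c m) (\<phi> s))"
      unfolding \<phi>[THEN fun_cong, of t] using S \<phi>W by (intro form_expand_left) auto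
    also have "\<dots> = (\<Sum>m\<in>S. indicat_real (I m) t * (\<Sum>k\<in>S. indicat_real (I k) s * g (c m) (c k)))"
      unfolding \<phi>[THEN fun_cong, of s] using S by (intro sum.cong refl arg_cong2[where f="(*)"] form_expand_right) auto
    finally show ?thesis by (simp add: sum_distrib_left mult.assoc)
  qed
  define G where "G = (\<Sum>m\<in>S. \<Sum>k\<in>S. \<bar>g (c m) (c k)\<bar>)"
  have G: "\<bar>g (\<phi> t) (\<phi> s)\<bar> \<le> G" for t s
    unfolding g_expand G_def
    by (intro order_trans[OF sum_abs] sum_mono) (auto simp: abs_mult indicator_def)
  have G0: "0 \<le> G" unfolding G_def by (intro sum_nonneg) auto
  have \<kappa>0: "0 \<le> \<kappa>" using \<Xi>(2,3)[of 0] by linarith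
  have [measurable]: "I m \<in> sets borel" if "m \<in> S" for m using S(3)[OF that] by simp
  have \<Xi>m[measurable]: "\<Xi> \<in> borel_measurable borel" using \<Xi>(1) by (rule borel_measurable_continuous_onI)
  have gm: "(\<lambda>(t, s). g (\<phi> t) (\<phi> s)) \<in> borel_measurable (borel \<Otimes>\<^sub>M borel)"
    unfolding g_expand by measurable
  define f where "f t s = indicat_real {\<alpha>..\<beta>} t * (indicat_real {t..\<beta>} s * (\<Xi> (s - t) * g (\<phi> t) (\<phi> s)))" for t s
  have fm: "(\<lambda>(t, s). f t s) \<in> borel_measurable (borel \<Otimes>\<^sub>M borel)"
  proof -
    have "(\<lambda>(t, s). f t s) = (\<lambda>(t, s). indicat_real {\<alpha>..\<beta>} t * ((if t \<le> s \<and> s \<le> \<beta> then 1 else 0) * (\<Xi> (s - t) * g (\<phi> t) (\<phi> s))))"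
      by (auto simp: f_def fun_eq_iff indicator_def)
    also have "\<dots> \<in> borel_measurable (borel \<Otimes>\<^sub>M borel)"
      using gm by measurable
    finally show ?thesis .
  qed
  have f_bound: "\<bar>f t s\<bar> \<le> indicat_real {\<alpha>..\<beta>} s * (\<kappa> * G)" for t s
    using \<Xi>(2)[of "s - t"] \<Xi>(3)[of "s - t"] G[of t s] G0 \<kappa>0
    by (auto simp: f_def indicator_def abs_mult intro!: mult_mono)
  define h where "h M = (\<beta> - \<alpha>) / real M" for M
  define i where "i M t = nat \<lfloor>(t - \<alpha>) / h M\<rfloor>" for M t
  define r where "r M t = \<alpha> + real (i M t) * h M" for M t
  \<comment> \<open>The integrand over the triangle, frozen at the left end points of the cells.
    Diagonal cells are kept entirely, to match the triangle sum with its diagonal.\<close>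
  define F where "F M t s = indicat_real {\<alpha>..<\<beta>} t * (indicat_real {\<alpha>..<\<beta>} s *
    (if i M t \<le> i M s then \<Xi> (real (i M s - i M t) * h M) * g (\<phi> (r M t)) (\<phi> (r M s)) else 0))" for M t s
  have h: "h M > 0" "\<beta> = \<alpha> + real M * h M" if "M > 0" for M
    using that \<alpha>\<beta> by (simp_all add: h_def)
  have inner_F: "has_bochner_integral lborel (F M t) (indicat_real {\<alpha>..<\<beta>} t * (h M * (\<Sum>j<M.
      if i M t \<le> j then \<Xi> (real (j - i M t) * h M) * g (\<phi> (r M t)) (\<phi> (\<alpha> + real j * h M)) else 0)))" if "M > 0" for M t
    unfolding F_def
    using step_integral[OF h[OF that], of "\<lambda>j. if i M t \<le> j then \<Xi> (real (j - i M t) * h M) * g (\<phi> (r M t)) (\<phi> (\<alpha> + real j * h M)) else 0"]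
    unfolding i_def[symmetric] r_def[symmetric] by (intro has_bochner_integral_mult_right)
  have integrable_F: "integrable lborel (F M t)" if "M > 0" for M t
    using inner_F[OF that] by (rule integrable.intros)
  have outer_F: "(LINT t|lborel. LINT s|lborel. F M t s) = h M * (\<Sum>k<M. h M * (\<Sum>j<M.
      if k \<le> j then \<Xi> (real (j - k) * h M) * g (\<phi> (\<alpha> + real k * h M)) (\<phi> (\<alpha> + real j * h M)) else 0))" if "M > 0" for M
    unfolding has_bochner_integral_integral_eq[OF inner_F[OF that]]
    using has_bochner_integral_integral_eq[OF step_integral[OF h[OF that], of "\<lambda>k. h M * (\<Sum>j<M.
      if k \<le> j then \<Xi> (real (j - k) * h M) * g (\<phi> (\<alpha> + real k * h M)) (\<phi> (\<alpha> + real j * h M)) else 0)"]]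
    unfolding i_def[symmetric] r_def .
  have F_nonneg: "0 \<le> (LINT t|lborel. LINT s|lborel. F M t s)" if "M > 0" for M
  proof -
    have "0 \<le> (\<Sum>k<M. \<Sum>j<M. if k \<le> j then \<Xi> (real (j - k) * h M) * g (\<phi> (\<alpha> + real k * h M)) (\<phi> (\<alpha> + real j * h M)) else 0)"
    proof (rule convex_sequence_triangle_sum_nonneg[where b = "\<lambda>k. \<Xi> (real k * h M)" and c = "\<lambda>k. \<phi> (\<alpha> + real k * h M)"])
      show "\<Xi> (real (Suc k) * h M) \<le> \<Xi> (real k * h M)" for k
        using decr[of "real k * h M" "h M"] h(1)[OF that] by (simp add: algebra_simps)
      show "2 * \<Xi> (real (Suc k) * h M) \<le> \<Xi> (real k * h M) + \<Xi> (real (Suc (Suc k)) * h M)" for k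
        using conv[of "real k * h M" "h M"] h(1)[OF that] by (simp add: algebra_simps)
    qed (use \<phi>W \<Xi> in auto)
    then show ?thesis
      unfolding outer_F[OF that] using h(1)[OF that]
      by (intro mult_nonneg_nonneg) (auto simp: sum_distrib_left[symmetric])
  qed
  have F_bound: "\<bar>F M t s\<bar> \<le> indicat_real {\<alpha>..\<beta>} s * (\<kappa> * G)" for M t s
    using \<Xi>(2)[of "real (i M s - i M t) * h M"] \<Xi>(3)[of "real (i M s - i M t) * h M"] G[of "r M t" "r M s"] G0 \<kappa>0
    by (auto simp: F_def indicator_def abs_mult intro!: mult_mono)
  have r_lim: "(\<lambda>M. r M t) \<longlonglongrightarrow> t" if t: "\<alpha> \<le> t" for t
  proof -
    have "\<bar>r M t - t\<bar> \<le> h M" if "M > 0" for M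
    proof -
      have "real (i M t) \<le> (t - \<alpha>) / h M" "(t - \<alpha>) / h M < real (i M t) + 1"
        using t h(1)[OF that] unfolding i_def by simp_all
      then have "real (i M t) * h M \<le> t - \<alpha>" "t - \<alpha> < real (i M t) * h M + h M"
        using h(1)[OF that] by (simp_all add: pos_le_divide_eq pos_divide_less_eq algebra_simps)
      then show ?thesis unfolding r_def by linarith
    qed
    then have "\<forall>\<^sub>F M in sequentially. norm (r M t - t) \<le> h M"
      by (intro eventually_mono[OF eventually_gt_at_top[of "0::nat"]]) simp
    moreover have "h \<longlonglongrightarrow> 0" unfolding h_def by (rule lim_const_over_n)
    ultimately have "(\<lambda>M. r M t - t) \<longlonglongrightarrow> 0" by (rule Lim_null_comparison)
    then show ?thesis by (rule LIM_zero_cancel)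
  qed
  \<comment> \<open>Away from the finite set D the function \<phi> is constant near t, so its values
    at the grid points eventually equal \<phi> t.\<close>
  have \<phi>_lim: "\<forall>\<^sub>F M in sequentially. \<phi> (r M t) = \<phi> t" if t: "\<alpha> \<le> t" "t \<le> \<beta>" "t \<notin> D" for t
  proof -
    have "t \<in> (\<Union>m\<in>S. I m) \<union> D" using cover(2) t by auto
    with t(3) obtain m where m: "m \<in> S" "t \<in> I m" by auto
    have "\<forall>\<^sub>F M in sequentially. r M t \<in> I m"
      using topological_tendstoD[OF r_lim[OF t(1)] S(3)[OF m(1)] m(2)] .
    then show ?thesis by eventually_elim (use \<phi>I m in auto)
  qed
  \<comment> \<open>For s different from t the two points eventually lie in different cells, in the
    right order, so the condition on the cell indices eventually agrees with the condition on s and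
    t.\<close>
  have F_lim: "(\<lambda>M. F M t s) \<longlonglongrightarrow> f t s" if t: "t \<notin> D" and s: "s \<notin> D" "s \<noteq> t" "s \<noteq> \<beta>" "t \<noteq> \<beta>" for t s
  proof -
    consider "t < \<alpha> \<or> t > \<beta> \<or> s < \<alpha> \<or> s > \<beta>" | "\<alpha> \<le> t" "\<alpha> \<le> s" "t < \<beta>" "s < \<beta>" "s < t"
      | "\<alpha> \<le> t" "\<alpha> \<le> s" "t < \<beta>" "s < \<beta>" "t < s" using s by linarith
    then show ?thesis
    proof cases
      case 1
      then have "F M t s = 0" "f t s = 0" for M by (auto simp: F_def f_def indicator_def)
      then show ?thesis by simp
    next
      case 2
      have f0: "f t s = 0" using 2 by (simp add: f_def)
      have "\<forall>\<^sub>F M in sequentially. r M s < r M t"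
        by (rule eventually_less_limits[OF r_lim r_lim]) (use 2 in auto)
      then have "\<forall>\<^sub>F M in sequentially. F M t s = 0"
        using eventually_gt_at_top[of "0::nat"]
      proof eventually_elim
        case (elim M)
        then have "i M s < i M t" using h(1)[of M] by (simp add: r_def)
        then show ?case by (simp add: F_def)
      qed
      then show ?thesis unfolding f0 by (rule tendsto_eventually)
    next
      case 3
      have "\<forall>\<^sub>F M in sequentially. r M t < r M s"
        by (rule eventually_less_limits[OF r_lim r_lim]) (use 3 in auto)
      moreover have "\<forall>\<^sub>F M in sequentially. \<phi> (r M t) = \<phi> t" "\<forall>\<^sub>F M in sequentially. \<phi> (r M s) = \<phi> s"
        using \<phi>_lim 3 t s by auto
      ultimately have ev: "\<forall>\<^sub>F M in sequentially. \<Xi> (r M s - r M t) * g (\<phi> t) (\<phi> s) = F M t s"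
        using eventually_gt_at_top[of "0::nat"]
      proof eventually_elim
        case (elim M)
        then have "i M t < i M s" using h(1)[of M] by (simp add: r_def)
        then show ?case using 3 elim by (simp add: F_def r_def of_nat_diff algebra_simps)
      qed
      have "(\<lambda>M. \<Xi> (r M s - r M t)) \<longlonglongrightarrow> \<Xi> (s - t)"
        using 3 by (intro continuous_on_tendsto_compose[OF \<Xi>(1)] tendsto_diff r_lim) auto
      then have "(\<lambda>M. \<Xi> (r M s - r M t) * g (\<phi> t) (\<phi> s)) \<longlonglongrightarrow> \<Xi> (s - t) * g (\<phi> t) (\<phi> s)"
        by (intro tendsto_intros)
      moreover have "f t s = \<Xi> (s - t) * g (\<phi> t) (\<phi> s)" using 3 by (simp add: f_def)
      ultimately show ?thesis using Lim_transform_eventually[OF _ ev] by simp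
    qed
  qed
  have AE_fin: "AE x in lborel. x \<notin> E" if "finite E" for E :: "real set"
    using that by (intro AE_not_in finite_imp_null_set_lborel)
  \<comment> \<open>The index is \<open>Suc M\<close> because M = 0 would give the degenerate width
    h 0 = 0.\<close>
  have inner_lim: "(\<lambda>M. LINT s|lborel. F (Suc M) t s) \<longlonglongrightarrow> (LINT s|lborel. f t s)" if t: "t \<notin> D" "t \<noteq> \<beta>" for t
  proof (rule integral_dominated_convergence)
    show "f t \<in> borel_measurable lborel" using measurable_Pair2[OF fm, of t] by simp
    show "F (Suc M) t \<in> borel_measurable lborel" for M
      using integrable_F[of "Suc M" t] by (rule borel_measurable_integrable) simp
    show "integrable lborel (\<lambda>s. indicat_real {\<alpha>..\<beta>} s * (\<kappa> * G))"
      by (intro integrable_mult_left integrable_real_indicator) (auto simp: emeasure_lborel_Icc_eq)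
    show "AE s in lborel. norm (F (Suc M) t s) \<le> indicat_real {\<alpha>..\<beta>} s * (\<kappa> * G)" for M
      using F_bound by simp
    show "AE s in lborel. (\<lambda>M. F (Suc M) t s) \<longlonglongrightarrow> f t s"
    proof -
      have "AE s in lborel. s \<notin> insert t (insert \<beta> D)" using cover(1) by (intro AE_fin) simp
      then show ?thesis by eventually_elim (use t in \<open>auto intro!: LIMSEQ_Suc F_lim\<close>)
    qed
  qed
  have lim: "(\<lambda>M. LINT t|lborel. LINT s|lborel. F (Suc M) t s) \<longlonglongrightarrow> (LINT t|lborel. LINT s|lborel. f t s)"
  proof (rule integral_dominated_convergence)
    show "(\<lambda>t. LINT s|lborel. f t s) \<in> borel_measurable lborel"
    proof (rule lborel.borel_measurable_lebesgue_integral)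
      have "sets (lborel \<Otimes>\<^sub>M lborel) = sets (borel \<Otimes>\<^sub>M (borel :: real measure))"
        by (intro sets_pair_measure_cong) simp_all
      from measurable_cong_sets[OF this refl] fm
      show "(\<lambda>(t, s). f t s) \<in> borel_measurable (lborel \<Otimes>\<^sub>M lborel)" by blast
    qed
    show "(\<lambda>t. LINT s|lborel. F (Suc M) t s) \<in> borel_measurable lborel" for M
      unfolding has_bochner_integral_integral_eq[OF inner_F[OF zero_less_Suc]]
      using step_integral[OF h[OF zero_less_Suc, of M], of "\<lambda>k. h (Suc M) * (\<Sum>j<Suc M.
        if k \<le> j then \<Xi> (real (j - k) * h (Suc M)) * g (\<phi> (\<alpha> + real k * h (Suc M))) (\<phi> (\<alpha> + real j * h (Suc M))) else 0)",
        THEN integrable.intros, THEN borel_measurable_integrable]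
      unfolding i_def[symmetric] r_def .
    show "integrable lborel (\<lambda>t. indicat_real {\<alpha>..\<beta>} t * (\<kappa> * G * (\<beta> - \<alpha>)))"
      by (intro integrable_mult_left integrable_real_indicator) (auto simp: emeasure_lborel_Icc_eq)
    show "AE t in lborel. (\<lambda>M. LINT s|lborel. F (Suc M) t s) \<longlonglongrightarrow> (LINT s|lborel. f t s)"
    proof -
      have "AE t in lborel. t \<notin> insert \<beta> D" using cover(1) by (intro AE_fin) simp
      then show ?thesis by eventually_elim (auto intro!: inner_lim)
    qed
    show "AE t in lborel. norm (LINT s|lborel. F (Suc M) t s) \<le> indicat_real {\<alpha>..\<beta>} t * (\<kappa> * G * (\<beta> - \<alpha>))" for M
    proof (intro AE_I2)
      fix t
      have "norm (LINT s|lborel. F (Suc M) t s) \<le> (LINT s|lborel. norm (F (Suc M) t s))"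
        by (rule integral_norm_bound)
      also have "\<dots> \<le> (LINT s|lborel. indicat_real {\<alpha>..\<beta>} s * (\<kappa> * G))"
        using integrable_F[of "Suc M" t] F_bound
        by (intro integral_mono integrable_norm integrable_mult_left integrable_real_indicator) (auto simp: emeasure_lborel_Icc_eq)
      also have "\<dots> = \<kappa> * G * (\<beta> - \<alpha>)" using \<alpha>\<beta> by simp
      finally have "norm (LINT s|lborel. F (Suc M) t s) \<le> \<kappa> * G * (\<beta> - \<alpha>)" .
      moreover have "(LINT s|lborel. F (Suc M) t s) = 0" if "t \<notin> {\<alpha>..\<beta>}"
        using that by (auto simp: F_def indicator_def)
      ultimately show "norm (LINT s|lborel. F (Suc M) t s) \<le> indicat_real {\<alpha>..\<beta>} t * (\<kappa> * G * (\<beta> - \<alpha>))"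
        by (cases "t \<in> {\<alpha>..\<beta>}") auto
    qed
  qed
  have "0 \<le> (LINT t|lborel. LINT s|lborel. f t s)"
    by (rule LIMSEQ_le_const[OF lim]) (use F_nonneg in auto)
  also have "(LINT t|lborel. LINT s|lborel. f t s)
      = (LINT t:{\<alpha>..\<beta>}|lborel. LINT s:{t..\<beta>}|lborel. \<Xi> (s - t) * g (\<phi> t) (\<phi> s))"
    unfolding set_lebesgue_integral_def f_def by simp
  finally show ?thesis .
qed

section \<open>Memory kernels\<close>

lemma integral_cong_finite:
  fixes f g :: "'a::euclidean_space \<Rightarrow> 'b::{banach, second_countable_topology}"
  assumes "finite D" "\<And>x. x \<notin> D \<Longrightarrow> f x = g x"
  shows "integral\<^sup>L lborel f = integral\<^sup>L lborel g" and "integrable lborel f \<longleftrightarrow> integrable lborel g"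
proof -
  show "integral\<^sup>L lborel f = integral\<^sup>L lborel g"
    by (rule integral_discrete_difference[where X = D]) (auto simp: assms countable_finite)
  show "integrable lborel f \<longleftrightarrow> integrable lborel g"
    by (rule integrable_discrete_difference[where X = D]) (auto simp: assms countable_finite)
qed

lemma set_integral_cong_finite:
  fixes f g :: "'a::euclidean_space \<Rightarrow> 'b::{banach, second_countable_topology}"
  assumes "finite D" "\<And>x. x \<notin> D \<Longrightarrow> x \<in> A \<longleftrightarrow> x \<in> A'" "\<And>x. x \<in> A \<Longrightarrow> x \<in> A' \<Longrightarrow> x \<notin> D \<Longrightarrow> f x = g x"
  shows "(LINT x:A|lborel. f x) = (LINT x:A'|lborel. g x)"
    and "set_integrable lborel A f \<longleftrightarrow> set_integrable lborel A' g"
  unfolding set_lebesgue_integral_def set_integrable_def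
  using assms by (auto intro!: integral_cong_finite[OF assms(1)] simp: indicator_def)

lemma set_integrable_bounded:
  fixes f :: "real \<Rightarrow> real"
  assumes "f \<in> borel_measurable borel" "\<And>x. x \<in> {c..d} \<Longrightarrow> \<bar>f x\<bar> \<le> C"
  shows "set_integrable lborel {c..d} f"
  unfolding set_integrable_def
proof (rule Bochner_Integration.integrable_bound)
  show "integrable lborel (\<lambda>x. indicat_real {c..d} x * C)"
    by (intro integrable_mult_left integrable_real_indicator) (auto simp: emeasure_lborel_Icc_eq)
  show "AE x in lborel. norm (indicat_real {c..d} x *\<^sub>R f x) \<le> norm (indicat_real {c..d} x * C)"
    using assms(2) by (intro AE_I2) (fastforce simp: indicator_def)
qed (use assms(1) in measurable)

locale memory_kernel =
  fixes K :: "real \<Rightarrow> real" and \<kappa> :: real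
  assumes K_nonneg: "t > 0 \<Longrightarrow> 0 \<le> K t"
    and K_deriv: "t > 0 \<Longrightarrow> \<exists>D\<le>0. (K has_real_derivative D) (at t)"
    and K_int: "set_integrable lborel {0<..} K"
    and K_mass: "(LINT s:{0<..}|lborel. \<bar>K s\<bar>) = \<kappa>"
begin

text \<open>K is unconstrained on the nonpositive reals, so the value is meaningful for x \<ge> 0
  only. Where a function on the whole line is wanted, \<open>\<xi> (max 0 x)\<close> is
  used.\<close>

definition \<xi> :: "real \<Rightarrow> real" where "\<xi> x = (LINT s:{x<..}|lborel. K s)"

lemma K_cont: "t > 0 \<Longrightarrow> isCont K t"
  using K_deriv DERIV_isCont by blast

lemma K_mono: "0 < s \<Longrightarrow> s \<le> t \<Longrightarrow> K t \<le> K s"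
  using K_deriv by (intro DERIV_nonpos_imp_nonincreasing[of s t K]) (meson less_le_trans)+

lemma K_subset: "A \<in> sets borel \<Longrightarrow> A \<subseteq> {0<..} \<Longrightarrow> set_integrable lborel A K"
  by (rule set_integrable_subset[OF K_int]) auto

lemma \<xi>_split: "0 \<le> x \<Longrightarrow> x \<le> y \<Longrightarrow> \<xi> x = (LINT s:{x<..y}|lborel. K s) + \<xi> y"
proof -
  assume xy: "0 \<le> x" "x \<le> y"
  have "{x<..} = {x<..y} \<union> {y<..}" using xy by auto
  then show ?thesis unfolding \<xi>_def using xy
    by (simp add: set_integral_Un K_subset disjoint_iff subset_iff)
qed

lemma integral_K_nonneg: "0 \<le> x \<Longrightarrow> 0 \<le> (LINT s:{x<..y}|lborel. K s)"
  unfolding set_lebesgue_integral_def by (intro Bochner_Integration.integral_nonneg) (auto simp: indicator_def K_nonneg)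

lemma \<xi>_zero: "\<xi> 0 = \<kappa>"
  unfolding \<xi>_def K_mass[symmetric] by (intro set_lebesgue_integral_cong) (auto simp: K_nonneg)

lemma \<xi>_nonneg: "0 \<le> x \<Longrightarrow> 0 \<le> \<xi> x"
  unfolding \<xi>_def set_lebesgue_integral_def by (intro Bochner_Integration.integral_nonneg) (auto simp: indicator_def K_nonneg)

lemma \<xi>_antimono: "0 \<le> x \<Longrightarrow> x \<le> y \<Longrightarrow> \<xi> y \<le> \<xi> x"
  using \<xi>_split[of x y] integral_K_nonneg[of x y] by simp

lemma \<xi>_le: "0 \<le> x \<Longrightarrow> \<xi> x \<le> \<kappa>"
  using \<xi>_antimono[of 0 x] by (simp add: \<xi>_zero)

text \<open>K is nonincreasing, so its integral over the second of two adjacent intervals of length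
  h is at most that over the first.\<close>

lemma \<xi>_convex:
  assumes "0 \<le> x" "0 \<le> h" shows "2 * \<xi> (x + h) \<le> \<xi> x + \<xi> (x + 2 * h)"
proof -
  have shift: "(LINT s:{x+h<..x+2*h}|lborel. K s) = (LINT s:{x<..x+h}|lborel. K (s + h))"
    unfolding set_lebesgue_integral_def
    by (subst lborel_integral_real_affine[of 1 _ h]) (auto simp: indicator_def add.commute intro!: Bochner_Integration.integral_cong)
  have int: "set_integrable lborel {x<..x+h} (\<lambda>s. K (s + h))"
  proof -
    have "integrable lborel (\<lambda>s. indicat_real {x+h<..x+2*h} (h + 1 * s) *\<^sub>R K (h + 1 * s))"
    proof (rule lborel_integrable_real_affine)
      have "{x+h<..x+2*h} \<subseteq> {0<..}" using assms by auto
      then show "integrable lborel (\<lambda>s. indicat_real {x+h<..x+2*h} s *\<^sub>R K s)"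
        using K_subset[of "{x+h<..x+2*h}"] unfolding set_integrable_def by simp
    qed simp
    moreover have "(\<lambda>s. indicat_real {x+h<..x+2*h} (h + 1 * s) *\<^sub>R K (h + 1 * s)) = (\<lambda>s. indicat_real {x<..x+h} s *\<^sub>R K (s + h))"
      by (auto simp: fun_eq_iff indicator_def add.commute)
    ultimately show ?thesis unfolding set_integrable_def by simp
  qed
  have "(LINT s:{x<..x+h}|lborel. K (s + h)) \<le> (LINT s:{x<..x+h}|lborel. K s)"
  proof (rule set_integral_mono[OF int])
    have "{x<..x+h} \<subseteq> {0<..}" using assms by auto
    then show "set_integrable lborel {x<..x+h} K" by (intro K_subset) auto
  qed (use assms in \<open>auto intro: K_mono\<close>)
  then show ?thesis
    using \<xi>_split[of x "x + h"] \<xi>_split[of "x + h" "x + 2 * h"] assms shift by simp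
qed

text \<open>Continuity includes the point 0, where K may blow up: K on the positive axis is itself
  an integrable dominating function.\<close>

lemma \<xi>_continuous: "continuous_on UNIV (\<lambda>x. \<xi> (max 0 x))"
proof (rule continuous_at_imp_continuous_on, intro ballI, unfold continuous_at_sequentially, intro allI impI)
  fix x :: real and u assume u: "u \<longlonglongrightarrow> x"
  show "((\<lambda>x. \<xi> (max 0 x)) \<circ> u) \<longlonglongrightarrow> \<xi> (max 0 x)"
    unfolding \<xi>_def set_lebesgue_integral_def comp_def
  proof (rule integral_dominated_convergence)
    have m: "set_integrable lborel {max 0 y<..} K" for y by (intro K_subset) auto
    show "(\<lambda>s. indicat_real {max 0 x<..} s *\<^sub>R K s) \<in> borel_measurable lborel"
      "(\<lambda>s. indicat_real {max 0 (u i)<..} s *\<^sub>R K s) \<in> borel_measurable lborel" for i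
      using m unfolding set_integrable_def by (auto intro: borel_measurable_integrable)
    show "integrable lborel (\<lambda>s. norm (indicat_real {0<..} s *\<^sub>R K s))"
      using K_int unfolding set_integrable_def by (rule integrable_norm)
    show "AE s in lborel. norm (indicat_real {max 0 (u i)<..} s *\<^sub>R K s) \<le> norm (indicat_real {0<..} s *\<^sub>R K s)" for i
      by (intro AE_I2) (auto simp: indicator_def)
    have "AE s in lborel. s \<noteq> max 0 x" by (rule AE_lborel_singleton)
    then show "AE s in lborel. (\<lambda>i. indicat_real {max 0 (u i)<..} s *\<^sub>R K s) \<longlonglongrightarrow> indicat_real {max 0 x<..} s *\<^sub>R K s"
    proof eventually_elim
      case (elim s)
      have lim: "(\<lambda>i. max 0 (u i)) \<longlonglongrightarrow> max 0 x" by (intro tendsto_intros u)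
      have "\<forall>\<^sub>F i in sequentially. indicat_real {max 0 (u i)<..} s *\<^sub>R K s = indicat_real {max 0 x<..} s *\<^sub>R K s"
      proof (cases "max 0 x < s")
        case True
        from order_tendstoD(2)[OF lim this] show ?thesis
        proof eventually_elim
          case (elim i)
          then have "s \<in> {max 0 (u i)<..}" "s \<in> {max 0 x<..}" using True by (simp_all only: greaterThan_iff)
          then show ?case by (simp only: indicator_simps)
        qed
      next
        case False
        with elim have "s < max 0 x" by (meson linorder_neqE)
        from order_tendstoD(1)[OF lim this] show ?thesis
        proof eventually_elim
          case (elim i)
          then have "s \<notin> {max 0 (u i)<..}" "s \<notin> {max 0 x<..}" using False by (simp_all only: greaterThan_iff not_less less_imp_le)
          then show ?case by (simp only: indicator_simps not_False_eq_True)
        qed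
      qed
      then show ?case by (rule tendsto_eventually)
    qed
  qed
qed

lemma \<xi>_deriv: assumes "x > 0" shows "(\<xi> has_real_derivative - K x) (at x)"
proof -
  \<comment> \<open>The base point x / 2 stays away from 0, so that K is continuous on the interval
    of integration.\<close>
  let ?c = "x / 2" and ?b = "2 * x"
  have cont: "continuous_on {?c..?b} K"
    using assms K_cont by (intro continuous_at_imp_continuous_on) auto
  have "((\<lambda>y. integral {?c..y} K) has_real_derivative K x) (at x within {?c..?b})"
    using assms by (intro integral_has_real_derivative cont) auto
  then have "((\<lambda>y. integral {?c..y} K) has_real_derivative K x) (at x)"
    using assms by (subst (asm) at_within_interior) auto
  then have "((\<lambda>y. \<xi> ?c - integral {?c..y} K) has_real_derivative 0 - K x) (at x)"
    by (intro derivative_intros)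
  then have "((\<lambda>y. \<xi> ?c - integral {?c..y} K) has_real_derivative - K x) (at x)" by simp
  then show ?thesis
  proof (rule has_field_derivative_transform_within_open[of _ _ _ "{?c<..}"])
    fix y assume "y \<in> {?c<..}"
    then have y: "?c \<le> y" by simp
    have "set_integrable lborel {?c..y} K" using assms by (intro K_subset) auto
    then have "integral {?c..y} K = (LINT s:{?c..y}|lborel. K s)" by (rule set_borel_integral_eq_integral(2)[symmetric])
    also have "\<dots> = (LINT s:{?c<..y}|lborel. K s)"
      by (rule set_integral_cong_finite(1)[of "{?c}"]) auto
    finally show "\<xi> ?c - integral {?c..y} K = \<xi> y" using \<xi>_split[of ?c y] y assms by simp
  qed (use assms in auto)
qed

section \<open>Integrability of the memory terms and integration by parts\<close>

lemma K_affine_integrable: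
  assumes g: "continuous_on {c..d} g" and e: "e = 1 \<or> e = -1" and pos: "\<And>s. s \<in> {c<..<d} \<Longrightarrow> p + e * s > 0"
  shows "set_integrable lborel {c..d} (\<lambda>s. K (p + e * s) * (g s :: real))"
proof -
  obtain M where "\<forall>y\<in>g ` {c..d}. norm y \<le> M"
    using compact_imp_bounded[OF compact_continuous_image[OF g compact_Icc]] unfolding bounded_iff by blast
  then have M: "\<bar>g s\<bar> \<le> M" if "s \<in> {c..d}" for s using that by simp
  have "integrable lborel (\<lambda>s. indicat_real {0<..} (p + e * s) *\<^sub>R K (p + e * s))"
    using K_int e unfolding set_integrable_def by (intro lborel_integrable_real_affine) auto
  note Ki = this
  have gm: "(\<lambda>s. indicat_real {c..d} s *\<^sub>R g s) \<in> borel_measurable lborel"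
    using borel_integrable_atLeastAtMost'[OF g] unfolding set_integrable_def by (rule borel_measurable_integrable)
  have "integrable lborel (\<lambda>s. (indicat_real {0<..} (p + e * s) *\<^sub>R K (p + e * s)) * (indicat_real {c..d} s *\<^sub>R g s))"
  proof (rule Bochner_Integration.integrable_bound)
    show "integrable lborel (\<lambda>s. (indicat_real {0<..} (p + e * s) *\<^sub>R K (p + e * s)) * M)"
      using Ki by (rule integrable_mult_left)
    show "(\<lambda>s. (indicat_real {0<..} (p + e * s) *\<^sub>R K (p + e * s)) * (indicat_real {c..d} s *\<^sub>R g s)) \<in> borel_measurable lborel"
      using gm by (intro borel_measurable_times borel_measurable_integrable[OF Ki])
    show "AE s in lborel. norm ((indicat_real {0<..} (p + e * s) *\<^sub>R K (p + e * s)) * (indicat_real {c..d} s *\<^sub>R g s))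
      \<le> norm ((indicat_real {0<..} (p + e * s) *\<^sub>R K (p + e * s)) * M)"
    proof (intro AE_I2)
      fix s
      show "norm ((indicat_real {0<..} (p + e * s) *\<^sub>R K (p + e * s)) * (indicat_real {c..d} s *\<^sub>R g s))
        \<le> norm ((indicat_real {0<..} (p + e * s) *\<^sub>R K (p + e * s)) * M)"
      proof (cases "s \<in> {c..d}")
        case True
        have "\<bar>g s\<bar> \<le> \<bar>M\<bar>" using M[OF True] by linarith
        then show ?thesis using True by (simp add: abs_mult mult_left_mono)
      qed simp
    qed
  qed
  then show ?thesis
    unfolding set_integrable_def
  \<comment> \<open>At an end point the argument of K may be 0, where K is unconstrained; the two
    end points are discarded as a null set.\<close>
  proof (subst (asm) integral_cong_finite(2)[of "{c, d}"])
    show "indicat_real {0<..} (p + e * s) *\<^sub>R K (p + e * s) * (indicat_real {c..d} s *\<^sub>R g s)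
        = indicat_real {c..d} s *\<^sub>R (K (p + e * s) * g s)" if "s \<notin> {c, d}" for s
      using pos[of s] that by (auto simp: indicator_def)
  qed auto
qed

lemma K_shift_integrable:
  "continuous_on {t..T} g \<Longrightarrow> set_integrable lborel {t..T} (\<lambda>s. K (s - t) * (g s :: real))"
  using K_affine_integrable[of t T g 1 "- t"] by simp

lemma K_reflect_integrable:
  "continuous_on {c..d} g \<Longrightarrow> d \<le> T \<Longrightarrow> set_integrable lborel {c..d} (\<lambda>t. K (T - t) * (g t :: real))"
  using K_affine_integrable[of c d g "-1" T] by simp

lemma \<xi>_step_integrable:
  assumes \<gamma>: "\<gamma> \<in> borel_measurable borel" "\<And>s. \<bar>\<gamma> s\<bar> \<le> C"
  shows "t \<le> T \<Longrightarrow> set_integrable lborel {t..T} (\<lambda>s. \<xi> (s - t) * \<gamma> s)"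
    and "d \<le> T \<Longrightarrow> set_integrable lborel {c..d} (\<lambda>t. \<xi> (T - t) * \<gamma> t)"
proof -
  have \<xi>m[measurable]: "(\<lambda>x. \<xi> (max 0 x)) \<in> borel_measurable borel"
    using \<xi>_continuous by (rule borel_measurable_continuous_onI)
  have b: "\<bar>\<xi> (max 0 x) * \<gamma> s\<bar> \<le> \<kappa> * C" for x s
    using \<xi>_nonneg[of "max 0 x"] \<xi>_le[of "max 0 x"] \<gamma>(2)[of s] by (auto simp: abs_mult intro!: mult_mono)
  have "set_integrable lborel {t..T} (\<lambda>s. \<xi> (max 0 (s - t)) * \<gamma> s)"
    by (rule set_integrable_bounded[OF _ b]) (use \<gamma> in measurable)
  then show "set_integrable lborel {t..T} (\<lambda>s. \<xi> (s - t) * \<gamma> s)" if "t \<le> T"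
    by (subst (asm) set_integrable_cong[OF refl refl]) (auto simp: max_def)
  have "set_integrable lborel {c..d} (\<lambda>t. \<xi> (max 0 (T - t)) * \<gamma> t)"
    by (rule set_integrable_bounded[OF _ b]) (use \<gamma> in measurable)
  then show "set_integrable lborel {c..d} (\<lambda>t. \<xi> (T - t) * \<gamma> t)" if "d \<le> T"
    using that by (subst (asm) set_integrable_cong[OF refl refl]) (auto simp: max_def)
qed

lemma \<xi>_memory_integrable:
  assumes \<gamma>: "\<gamma> \<in> borel_measurable borel" "\<And>s. \<bar>\<gamma> s\<bar> \<le> C" and cd: "d \<le> T"
  shows "set_integrable lborel {c..d} (\<lambda>t. LINT s:{t..T}|lborel. \<xi> (s - t) * \<gamma> s)"
proof -
  have \<xi>m[measurable]: "(\<lambda>x. \<xi> (max 0 x)) \<in> borel_measurable borel"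
    using \<xi>_continuous by (rule borel_measurable_continuous_onI)
  note \<gamma>(1)[measurable]
  \<comment> \<open>The triangle is written as a jointly measurable indicator, so that the inner
    integral is measurable in t as a parameter integral. The lower limit \<open>max c t\<close>
    makes the bound valid for every real t and equals t on {c..d}.\<close>
  define X where "X t = (LINT s|lborel. (if max c t \<le> s \<and> s \<le> T then 1 else 0) * (\<xi> (max 0 (s - t)) * \<gamma> s))" for t
  have \<kappa>: "0 \<le> \<kappa>" using \<xi>_nonneg[of 0] by (simp add: \<xi>_zero)
  have C: "0 \<le> C" using \<gamma>(2)[of 0] by linarith
  have "(\<lambda>(t, s). (if max c t \<le> s \<and> s \<le> T then 1 else 0) * (\<xi> (max 0 (s - t)) * \<gamma> s)) \<in> borel_measurable (borel \<Otimes>\<^sub>M lborel)"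
    by measurable
  then have "X \<in> borel_measurable borel"
    unfolding X_def by (rule lborel.borel_measurable_lebesgue_integral)
  moreover have "\<bar>X t\<bar> \<le> (LINT s|lborel. indicat_real {c..T} s * (\<kappa> * C))" for t
  proof -
    let ?f = "\<lambda>s. (if max c t \<le> s \<and> s \<le> T then 1 else 0) * (\<xi> (max 0 (s - t)) * \<gamma> s)"
    have ic: "integrable lborel (\<lambda>s. indicat_real {c..T} s * (\<kappa> * C))"
      by (intro integrable_mult_left integrable_real_indicator) (auto simp: emeasure_lborel_Icc_eq)
    have b: "norm (?f s) \<le> indicat_real {c..T} s * (\<kappa> * C)" for s
      using \<xi>_nonneg[of "max 0 (s - t)"] \<xi>_le[of "max 0 (s - t)"] \<gamma>(2)[of s] \<kappa> C
      by (auto simp: abs_mult indicator_def intro!: mult_mono)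
    have "integrable lborel ?f"
    proof (rule Bochner_Integration.integrable_bound[OF ic])
      show "?f \<in> borel_measurable lborel" by measurable
      have "norm (?f s) \<le> norm (indicat_real {c..T} s * (\<kappa> * C))" for s
        using order_trans[OF b abs_ge_self] by (simp only: real_norm_def)
      then show "AE s in lborel. norm (?f s) \<le> norm (indicat_real {c..T} s * (\<kappa> * C))" by (intro AE_I2)
    qed
    from order_trans[OF integral_norm_bound integral_mono[OF integrable_norm[OF this] ic b]]
    show ?thesis unfolding X_def by (simp only: real_norm_def)
  qed
  ultimately have "set_integrable lborel {c..d} X" by (rule set_integrable_bounded)
  moreover have "X t = (LINT s:{t..T}|lborel. \<xi> (s - t) * \<gamma> s)" if "t \<in> {c..d}" for t
    unfolding X_def set_lebesgue_integral_def using that cd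
    by (intro Bochner_Integration.integral_cong) (auto simp: indicator_def max_def)
  then have "set_integrable lborel {c..d} X \<longleftrightarrow> set_integrable lborel {c..d} (\<lambda>t. LINT s:{t..T}|lborel. \<xi> (s - t) * \<gamma> s)"
    by (intro set_integrable_cong refl)
  ultimately show ?thesis by simp
qed

lemma memory_by_parts:
  assumes tT: "t \<le> T" and g: "continuous_on {t..T} g" and D: "finite D"
    and der: "\<And>s. s \<in> {t<..<T} - D \<Longrightarrow> (g has_real_derivative \<gamma> s) (at s)"
    and \<gamma>: "\<gamma> \<in> borel_measurable borel" "\<And>s. \<bar>\<gamma> s\<bar> \<le> C"
  shows "(LINT s:{t..T}|lborel. K (s - t) * g s)
    = \<kappa> * g t - \<xi> (T - t) * g T + (LINT s:{t..T}|lborel. \<xi> (s - t) * \<gamma> s)"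
proof -
  \<comment> \<open>An antiderivative away from D, since \<xi>' = - K. Writing \<open>max 0\<close>
    makes its continuity up to s = t an instance of \<open>\<xi>_continuous\<close>, although K may
    be singular there.\<close>
  let ?f = "\<lambda>s. - (\<xi> (max 0 (s - t)) * g s)"
  have "((\<lambda>s. K (s - t) * g s - \<xi> (s - t) * \<gamma> s) has_integral ?f T - ?f t) {t..T}"
  proof (rule fundamental_theorem_of_calculus_interior_strong[OF D tT])
    show "continuous_on {t..T} ?f"
      by (intro continuous_intros g continuous_on_compose2[OF \<xi>_continuous, of _ "\<lambda>s. s - t"]) auto
    fix s assume s: "s \<in> {t<..<T} - D"
    have "(\<xi> has_real_derivative - K (s - t)) (at (s - t))" using s by (intro \<xi>_deriv) auto
    moreover have "((\<lambda>s. s - t) has_real_derivative 1) (at s)" by (auto intro!: derivative_eq_intros)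
    ultimately have "((\<lambda>s. \<xi> (s - t)) has_real_derivative - K (s - t)) (at s)"
      using DERIV_chain2[of \<xi> "- K (s - t)" "\<lambda>s. s - t" s 1 UNIV] by simp
    then have "((\<lambda>s. - (\<xi> (s - t) * g s)) has_real_derivative K (s - t) * g s - \<xi> (s - t) * \<gamma> s) (at s)"
      using der[OF s] by (auto intro!: derivative_eq_intros)
    then have "(?f has_real_derivative K (s - t) * g s - \<xi> (s - t) * \<gamma> s) (at s)"
      by (rule has_field_derivative_transform_within_open[of _ _ _ "{t<..}"]) (use s in auto)
    then show "(?f has_vector_derivative K (s - t) * g s - \<xi> (s - t) * \<gamma> s) (at s)"
      by (simp add: has_real_derivative_iff_has_vector_derivative)
  qed
  then have "integral {t..T} (\<lambda>s. K (s - t) * g s - \<xi> (s - t) * \<gamma> s) = \<kappa> * g t - \<xi> (T - t) * g T"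
    using tT by (simp add: integral_unique \<xi>_zero)
  moreover have int: "set_integrable lborel {t..T} (\<lambda>s. K (s - t) * g s)" "set_integrable lborel {t..T} (\<lambda>s. \<xi> (s - t) * \<gamma> s)"
    using K_shift_integrable[OF g] \<xi>_step_integrable(1)[OF \<gamma> tT] by auto
  ultimately have "(LINT s:{t..T}|lborel. K (s - t) * g s - \<xi> (s - t) * \<gamma> s) = \<kappa> * g t - \<xi> (T - t) * g T"
    by (subst set_borel_integral_eq_integral(2)) (auto intro: set_integral_diff(1))
  then show ?thesis using set_integral_diff(2)[OF int] by simp
qed

text \<open>The same device in the other variable, to be applied to the boundary term at T of
  \<open>memory_by_parts\<close>. The case d = T is included, where K may be singular.\<close>

lemma terminal_by_parts:
  assumes cd: "c \<le> d" "d \<le> T" and g: "continuous_on {c..d} g"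
    and der: "\<And>t. t \<in> {c<..<d} \<Longrightarrow> (g has_real_derivative \<gamma> t) (at t)"
    and \<gamma>: "\<gamma> \<in> borel_measurable borel" "\<And>s. \<bar>\<gamma> s\<bar> \<le> C"
  shows "(LINT t:{c..d}|lborel. K (T - t) * g t)
    = \<xi> (T - d) * g d - \<xi> (T - c) * g c - (LINT t:{c..d}|lborel. \<xi> (T - t) * \<gamma> t)"
proof -
  let ?f = "\<lambda>t. \<xi> (max 0 (T - t)) * g t"
  have "((\<lambda>t. K (T - t) * g t + \<xi> (T - t) * \<gamma> t) has_integral ?f d - ?f c) {c..d}"
  proof (rule fundamental_theorem_of_calculus_interior_strong[of "{}", OF _ cd(1)])
    show "continuous_on {c..d} ?f"
      by (intro continuous_intros g continuous_on_compose2[OF \<xi>_continuous, of _ "\<lambda>s. T - s"]) auto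
    fix t assume t: "t \<in> {c<..<d} - {}"
    then have tT: "0 < T - t" using cd by auto
    have "((\<lambda>t. T - t) has_real_derivative -1) (at t)" by (auto intro!: derivative_eq_intros)
    with \<xi>_deriv[OF tT] have "((\<lambda>t. \<xi> (T - t)) has_real_derivative K (T - t)) (at t)"
      using DERIV_chain2[of \<xi> "- K (T - t)" "\<lambda>t. T - t" t "-1" UNIV] by simp
    then have "((\<lambda>t. \<xi> (T - t) * g t) has_real_derivative K (T - t) * g t + \<xi> (T - t) * \<gamma> t) (at t)"
      using der[of t] t by (auto intro!: derivative_eq_intros)
    then have "(?f has_real_derivative K (T - t) * g t + \<xi> (T - t) * \<gamma> t) (at t)"
      by (rule has_field_derivative_transform_within_open[of _ _ _ "{..<T}"]) (use tT in auto)
    then show "(?f has_vector_derivative K (T - t) * g t + \<xi> (T - t) * \<gamma> t) (at t)"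
      by (simp add: has_real_derivative_iff_has_vector_derivative)
  qed simp
  then have "integral {c..d} (\<lambda>t. K (T - t) * g t + \<xi> (T - t) * \<gamma> t) = \<xi> (T - d) * g d - \<xi> (T - c) * g c"
    using cd by (simp add: integral_unique)
  moreover have int: "set_integrable lborel {c..d} (\<lambda>t. K (T - t) * g t)" "set_integrable lborel {c..d} (\<lambda>t. \<xi> (T - t) * \<gamma> t)"
    using K_reflect_integrable[OF g cd(2)] \<xi>_step_integrable(2)[OF \<gamma> cd(2)] by auto
  ultimately have "(LINT t:{c..d}|lborel. K (T - t) * g t + \<xi> (T - t) * \<gamma> t) = \<xi> (T - d) * g d - \<xi> (T - c) * g c"
    by (subst set_borel_integral_eq_integral(2)) (auto intro: set_integral_add(1))
  then show ?thesis using set_integral_add(2)[OF int] by simp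
qed

end

section \<open>The discrete dual problem\<close>

lemma affine_integral:
  fixes c d \<alpha> \<beta> :: real
  assumes "c \<le> d"
  shows "(LINT t:{c<..<d}|lborel. \<alpha> + (t - c) * \<beta>) = (d - c) * (\<alpha> + (d - c) / 2 * \<beta>)"
proof -
  let ?F = "\<lambda>t. \<alpha> * t + (t - c)\<^sup>2 / 2 * \<beta>"
  have "(LINT t:{c<..<d}|lborel. \<alpha> + (t - c) * \<beta>) = (LINT t:{c..d}|lborel. \<alpha> + (t - c) * \<beta>)"
    by (rule set_integral_cong_finite(1)[of "{c, d}"]) auto
  also have "\<dots> = integral {c..d} (\<lambda>t. \<alpha> + (t - c) * \<beta>)"
    by (intro set_borel_integral_eq_integral(2) borel_integrable_atLeastAtMost' continuous_intros)
  also have "\<dots> = ?F d - ?F c"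
    by (intro integral_unique fundamental_theorem_of_calculus assms)
      (auto intro!: derivative_eq_intros simp flip: has_real_derivative_iff_has_vector_derivative)
  also have "\<dots> = (d - c) * (\<alpha> + (d - c) / 2 * \<beta>)" by (simp add: power2_eq_square algebra_simps)
  finally show ?thesis .
qed

lemma L2_inner_zero_left [simp]: "L2_inner \<Omega> 0 v = 0"
  by (simp add: L2_inner_def set_lebesgue_integral_def)

lemma integral_singleton:
  fixes f :: "real \<Rightarrow> real"
  shows "set_integrable lborel {c..c} f" "(LINT t:{c..c}|lborel. f t) = 0"
  using set_integral_cong_finite[of "{c}" "{c..c}" "{}" f f]
  by (simp_all add: set_lebesgue_integral_def[of _ "{}"] set_integrable_def[of _ "{}"])

locale discrete_setting =
  fixes \<kappa> :: real and P :: "'d::finite cg_data" and l :: real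
  assumes setting: "cg_setting \<kappa> P"
    and nested: "\<forall>n\<in>{1..nsteps P}. Vh P (n - 1) \<subseteq> Vh P n"
    and well_defined: "l \<noteq> 0 \<longrightarrow> Ah_pow_well_defined P l"
begin

abbreviation "\<Omega> \<equiv> Omega P"
abbreviation "a \<equiv> aform P"
abbreviation "N \<equiv> nsteps P"
abbreviation "\<tau> \<equiv> tnode P"
abbreviation "T \<equiv> tend P"
abbreviation "V \<equiv> Vh P"
abbreviation "I \<equiv> I_open P"
abbreviation "W \<equiv> V N"

sublocale mk: memory_kernel "kern P" \<kappa>
  using setting unfolding cg_setting_def by unfold_locales auto

lemma xi_eq: "xi P = mk.\<xi>"
  by (simp add: fun_eq_iff xi_def mk.\<xi>_def)

lemma \<kappa>_bounds: "0 \<le> \<kappa>" "\<kappa> < 1"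
  using mk.\<xi>_nonneg[of 0] setting by (simp_all add: mk.\<xi>_zero cg_setting_def)

sublocale ef: elliptic_form \<Omega> "opA P" a
  using setting unfolding cg_setting_def convex_polygonal_domain_def by unfold_locales auto

lemma fe: "n \<le> N \<Longrightarrow> fe_space \<Omega> (opA P) a (mesh P n)"
  using setting unfolding cg_setting_def by unfold_locales auto

subsection \<open>Time grid\<close>

lemma \<tau>_less: "m < n \<Longrightarrow> n \<le> N \<Longrightarrow> \<tau> m < \<tau> n"
proof (induction n)
  case (Suc n)
  have "\<tau> n < \<tau> (Suc n)" using setting Suc.prems unfolding cg_setting_def by simp
  with Suc show ?case by (cases "m = n") (auto intro: less_trans)
qed simp

lemma \<tau>_le: "m \<le> n \<Longrightarrow> n \<le> N \<Longrightarrow> \<tau> m \<le> \<tau> n"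
  using \<tau>_less[of m n] by (cases "m = n") auto

lemma \<tau>_zero: "\<tau> 0 = 0" and T_pos: "0 < T"
  using setting unfolding cg_setting_def by auto

lemma \<tau>_nonneg: "n \<le> N \<Longrightarrow> 0 \<le> \<tau> n"
  using \<tau>_le[of 0 n] by (simp add: \<tau>_zero)

lemma N_pos: "0 < N"
  using T_pos \<tau>_zero by (cases "N = 0") auto

lemma step_less: "m \<in> {1..N} \<Longrightarrow> \<tau> (m - 1) < \<tau> m"
  by (rule \<tau>_less) auto

lemma V_mono: "m \<le> n \<Longrightarrow> n \<le> N \<Longrightarrow> V m \<subseteq> V n"
proof (induction n)
  case (Suc n)
  have "V n \<subseteq> V (Suc n)" using nested Suc.prems by (metis Suc_eq_plus1 add_diff_cancel_right' atLeastAtMost_iff le_add2)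
  with Suc show ?case by (cases "m = Suc n") auto
qed simp

lemma V_W: "m \<le> N \<Longrightarrow> u \<in> V m \<Longrightarrow> u \<in> W"
  using V_mono[of m N] by auto

lemma tidx_eq:
  assumes "m \<in> {1..N}" "\<tau> (m - 1) < t" "t \<le> \<tau> m" shows "tidx P t = m"
  unfolding tidx_def
proof (rule Least_equality)
  fix y assume y: "t \<le> \<tau> y"
  show "m \<le> y"
  proof (rule ccontr)
    assume "\<not> m \<le> y"
    then have "\<tau> y \<le> \<tau> (m - 1)" using assms(1) by (intro \<tau>_le) auto
    with y assms show False by linarith
  qed
qed (use assms in auto)

lemma tidx_node: "n \<le> N \<Longrightarrow> tidx P (\<tau> n) = n"
proof (cases "n = 0")
  case True
  then show ?thesis unfolding tidx_def by (intro Least_equality) auto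
qed (use tidx_eq[of n "\<tau> n"] step_less[of n] in auto)

lemma tidx_I: "m \<in> {1..N} \<Longrightarrow> t \<in> I m \<Longrightarrow> tidx P t = m"
  by (rule tidx_eq) auto

lemma I_disjoint: "m \<in> {1..N} \<Longrightarrow> k \<in> {1..N} \<Longrightarrow> t \<in> I m \<Longrightarrow> t \<in> I k \<Longrightarrow> m = k"
  using tidx_I by metis

lemma closed_I_subset: assumes "m \<in> {1..N}" shows "{\<tau> (m - 1)..\<tau> m} \<subseteq> {0..T}"
proof -
  have "0 \<le> \<tau> (m - 1)" using assms by (intro \<tau>_nonneg) auto
  moreover have "\<tau> m \<le> T" using assms by (intro \<tau>_le) auto
  ultimately show ?thesis by auto
qed

lemma I_subset: "m \<in> {1..N} \<Longrightarrow> I m \<subseteq> {0..T}"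
  using closed_I_subset[of m] greaterThanLessThan_subseteq_atLeastAtMost_iff by fastforce

lemma grid_cover:
  assumes "n \<le> m" "m \<le> N" shows "{\<tau> n..\<tau> m} \<subseteq> (\<Union>k\<in>{n+1..m}. I k) \<union> \<tau> ` {..N}"
  using assms
proof (induction m)
  case 0 then show ?case by auto
next
  case (Suc m)
  show ?case
  proof (cases "n = Suc m")
    case False
    with Suc have IH: "{\<tau> n..\<tau> m} \<subseteq> (\<Union>k\<in>{n+1..m}. I k) \<union> \<tau> ` {..N}" by auto
    show ?thesis
    proof
      fix t assume t: "t \<in> {\<tau> n..\<tau> (Suc m)}"
      consider "t \<in> {\<tau> n..\<tau> m}" | "t \<in> I (Suc m)" | "t = \<tau> (Suc m)" using t by force
      then show "t \<in> (\<Union>k\<in>{n+1..Suc m}. I k) \<union> \<tau> ` {..N}"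
        using IH Suc.prems False by cases force+
    qed
  qed (use Suc in auto)
qed

lemma split_integral:
  fixes f :: "real \<Rightarrow> real"
  assumes "n \<le> m" "m \<le> N" "\<And>k. k \<in> {n+1..m} \<Longrightarrow> set_integrable lborel (I k) f"
  shows "set_integrable lborel {\<tau> n..\<tau> m} f \<and> (LINT t:{\<tau> n..\<tau> m}|lborel. f t) = (\<Sum>k\<in>{n+1..m}. LINT t:I k|lborel. f t)"
  using assms
proof (induction m)
  case 0
  then show ?case using integral_singleton[of "\<tau> 0" f] by simp
next
  case (Suc m)
  show ?case
  proof (cases "n = Suc m")
    case True
    then show ?thesis using integral_singleton[of "\<tau> n" f] by simp
  next
    case False
    with Suc have IH: "set_integrable lborel {\<tau> n..\<tau> m} f"
      "(LINT t:{\<tau> n..\<tau> m}|lborel. f t) = (\<Sum>k\<in>{n+1..m}. LINT t:I k|lborel. f t)" by auto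
    have int: "set_integrable lborel (I (Suc m)) f"
      by (rule Suc.prems(3)) (use Suc.prems False in simp)
    have le: "\<tau> n \<le> \<tau> m" "\<tau> m < \<tau> (Suc m)" using Suc.prems False by (auto intro: \<tau>_le \<tau>_less)
    have ae: "(x \<in> {\<tau> n..\<tau> (Suc m)}) = (x \<in> {\<tau> n..\<tau> m} \<union> I (Suc m))" if "x \<notin> {\<tau> (Suc m)}" for x
      using that le by auto
    have disj: "{\<tau> n..\<tau> m} \<inter> I (Suc m) = {}" by auto
    have "(\<Sum>k\<in>{n+1..Suc m}. LINT t:I k|lborel. f t) = (\<Sum>k\<in>{n+1..m}. LINT t:I k|lborel. f t) + (LINT t:I (Suc m)|lborel. f t)"
      using Suc.prems False by (simp add: sum.cl_ivl_Suc)
    then show ?thesis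
      using set_integral_cong_finite[of "{\<tau> (Suc m)}" "{\<tau> n..\<tau> (Suc m)}" "{\<tau> n..\<tau> m} \<union> I (Suc m)" f f, OF _ ae]
        set_integral_Un[OF disj IH(1) int] set_integrable_Un[OF IH(1) int] IH(2) by simp
  qed
qed

subsection \<open>Discrete norms\<close>

text \<open>All powers \<open>A\<^sub>n\<^sup>l\<close> are restrictions of \<open>\<Lambda> = A\<^sub>N\<^sup>l\<close>, so the discrete norms at all times come from the two
  forms \<open>s(u, v) = (\<Lambda> u, v)\<close> and \<open>b(u, v) = a(\<Lambda> u, v)\<close> on the largest space.\<close>

definition \<Lambda> :: "'d vfield \<Rightarrow> 'd vfield" where "\<Lambda> = An_pow P N l"
definition s :: "'d vfield \<Rightarrow> 'd vfield \<Rightarrow> real" where "s u v = ip P (\<Lambda> u) v"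
definition b :: "'d vfield \<Rightarrow> 'd vfield \<Rightarrow> real" where "b u v = a (\<Lambda> u) v"

lemma V_P1: "V n = P1_space \<Omega> (mesh P n)" by (simp add: Vh_def)

lemma An_pow_eq: "An_pow P n r = op_power \<Omega> (P1_space \<Omega> (mesh P n)) (discrete_op \<Omega> a (P1_space \<Omega> (mesh P n))) r"
  by (simp add: An_pow_def An_def Vh_def)

lemma \<Lambda>_eq: assumes n: "n \<le> N" and u: "u \<in> V n" shows "An_pow P n l u = \<Lambda> u"
proof (cases "l = 0")
  case True
  then show ?thesis
    using fe_space.pw_zero[OF fe[OF n], of u] fe_space.pw_zero[OF fe[OF order_refl], of u] u V_W[OF n u]
    unfolding \<Lambda>_def An_pow_eq V_P1 by simp
next
  case False
  then show ?thesis using well_defined n u V_W[OF n u] unfolding Ah_pow_well_defined_def \<Lambda>_def by blast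
qed

text \<open>On V n the operator \<Lambda> is the power of A_n, which maps V n to itself; so
  \<open>\<Lambda> u\<close> is an admissible test function on the n-th interval.\<close>

lemma \<Lambda>_mem: "n \<le> N \<Longrightarrow> u \<in> V n \<Longrightarrow> \<Lambda> u \<in> V n"
  using fe_space.pw_mem[OF fe] \<Lambda>_eq by (metis An_pow_eq V_P1)

lemma V_subspace: "n \<le> N \<Longrightarrow> subspace (V n)"
  using fe_space.subspace_P1[OF fe] by (simp add: V_P1)

lemma V_H10: "u \<in> V n \<Longrightarrow> u \<in> H10 \<Omega>"
  by (simp add: Vh_def P1_space_def)

lemma V_L2: "u \<in> V n \<Longrightarrow> u \<in> L2 \<Omega>"
  using V_H10 H10_H1 H1_L2 by blast

sublocale s: psd_form W s
  using fe_space.pw_form[OF fe[OF order_refl], of l] by (simp add: s_def[abs_def] \<Lambda>_def An_pow_eq ip_def V_P1)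

sublocale b: psd_form W b
  using fe_space.a_pw_form[OF fe[OF order_refl], of l] by (simp add: b_def[abs_def] \<Lambda>_def An_pow_eq V_P1)

lemma Ah_pow_\<Lambda>: "tidx P t = n \<Longrightarrow> n \<le> N \<Longrightarrow> u \<in> V n \<Longrightarrow> Ah_pow P t l u = \<Lambda> u"
  by (simp add: Ah_pow_def \<Lambda>_eq)

text \<open>Consistency between meshes is assumed for the exponent l. The power l + 1 therefore
  appears only paired with elements of the same space V n, where it reduces to \<open>a\<close> of
  the l-th power.\<close>

lemma Ah_pow_Suc:
  assumes "tidx P t = n" "n \<le> N" "u \<in> V n" "v \<in> V n"
  shows "ip P (Ah_pow P t (l + 1) u) v = b u v"
  using fe_space.pw_Suc[OF fe[OF assms(2)], of u v l] \<Lambda>_eq[OF assms(2,3)] assms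
  by (simp add: Ah_pow_def An_pow_eq b_def V_P1 ip_def)

lemma hnorm_eq:
  assumes "tidx P t = n" "n \<le> N" "u \<in> V n"
  shows "hnorm P t l u = sqrt (s u u)" "hnorm P t (l + 1) u = sqrt (b u u)"
proof -
  have half: "hnorm P t r u = sqrt (ip P (An_pow P n r u) u)" for r
    using fe_space.pw_half[OF fe[OF assms(2)], of u r] assms
    by (simp add: hnorm_def L2_norm_def Ah_pow_def An_pow_eq V_P1 ip_def)
  show "hnorm P t l u = sqrt (s u u)" unfolding half s_def using \<Lambda>_eq assms by simp
  show "hnorm P t (l + 1) u = sqrt (b u u)"
    unfolding half using Ah_pow_Suc[OF assms assms(3)] assms(1) by (simp add: Ah_pow_def)
qed

subsection \<open>Continuous piecewise linear functions in time\<close>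

definition pl :: "(real \<Rightarrow> 'd vfield) \<Rightarrow> bool" where
  "pl U \<longleftrightarrow> continuous_on (\<Omega> \<times> {0..T}) (\<lambda>(x, t). U t x) \<and>
     (\<forall>n\<in>{1..N}. \<exists>p q. \<forall>t\<in>I n. U t = (\<lambda>x. p x + t *\<^sub>R q x)) \<and>
     (\<forall>n\<le>N. U (\<tau> n) \<in> V n) \<and> (\<forall>n\<in>{1..N}. \<forall>t\<in>I n. U t \<in> Vbar P n)"

lemma Uhk_pl: "(Z1, Z2) \<in> Uhk P \<Longrightarrow> pl Z1 \<and> pl Z2"
  unfolding Uhk_def pl_def by auto

definition slope :: "(real \<Rightarrow> 'd vfield) \<Rightarrow> nat \<Rightarrow> 'd vfield" where
  "slope U m = (1 / (\<tau> m - \<tau> (m - 1))) *\<^sub>R (U (\<tau> m) - U (\<tau> (m - 1)))"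

lemma pl_node: "pl U \<Longrightarrow> n \<le> N \<Longrightarrow> U (\<tau> n) \<in> V n"
  by (simp add: pl_def)

text \<open>Nestedness enters here: the left end value belongs to the space of the previous mesh and
  hence also to V m. This is why the slope lies in V m and can be used for testing.\<close>

lemma pl_nodes_mem: "pl U \<Longrightarrow> m \<in> {1..N} \<Longrightarrow> U (\<tau> m) \<in> V m \<and> U (\<tau> (m - 1)) \<in> V m"
  using pl_node[of U m] pl_node[of U "m - 1"] bspec[OF nested, of m] by (meson atLeastAtMost_iff diff_le_self le_trans subsetD)

lemma slope_mem: "pl U \<Longrightarrow> m \<in> {1..N} \<Longrightarrow> slope U m \<in> V m"
  unfolding slope_def using pl_nodes_mem[of U m] V_subspace[of m]
  by (intro subspace_scale subspace_diff) auto

text \<open>\<open>Uhk\<close> prescribes an affine form on the open time interval only. On \<Omega>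
  it extends to the end points by continuity; outside \<Omega>, where continuity is not part of the
  definition, all values are 0 and this determines the affine coefficients.\<close>

lemma pl_linear:
  assumes U: "pl U" and m: "m \<in> {1..N}" and t: "t \<in> {\<tau> (m - 1)..\<tau> m}"
  shows "U t = U (\<tau> (m - 1)) + (t - \<tau> (m - 1)) *\<^sub>R slope U m"
proof -
  let ?c = "\<tau> (m - 1)" and ?d = "\<tau> m"
  have cd: "?c < ?d" by (rule step_less[OF m])
  obtain p q where pq: "\<And>t. t \<in> I m \<Longrightarrow> U t = (\<lambda>x. p x + t *\<^sub>R q x)"
    using U m unfolding pl_def by blast
  have all: "U t x = p x + t *\<^sub>R q x" if t: "t \<in> {?c..?d}" for t x
  proof (cases "x \<in> \<Omega>")
    case True
    have "continuous_on (\<Omega> \<times> {0..T}) (\<lambda>(x, t). U t x)" using U by (simp add: pl_def)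
    then have "continuous_on ((\<lambda>t. (x, t)) ` {0..T}) (\<lambda>(x, t). U t x)"
      by (rule continuous_on_subset) (use True in auto)
    from continuous_on_compose[OF _ this]
    have "continuous_on {0..T} (\<lambda>t. U t x)" by (simp add: o_def continuous_on_Pair)
    then have "continuous_on {?c..?d} (\<lambda>t. U t x)"
      by (rule continuous_on_subset[OF _ closed_I_subset[OF m]])
    then have "continuous_on (closure {?c<..<?d}) (\<lambda>t. U t x - (p x + t *\<^sub>R q x))"
      using cd by (simp add: closure_greaterThanLessThan) (intro continuous_intros)
    then have "U t x - (p x + t *\<^sub>R q x) = 0"
      by (rule continuous_constant_on_closure) (use pq t cd in \<open>auto simp: closure_greaterThanLessThan\<close>)
    then show ?thesis by simp
  next
    case False
    have z: "p x + t *\<^sub>R q x = 0" if "t \<in> I m" for t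
    proof -
      have "U t \<in> Vbar P m" using U m that unfolding pl_def by blast
      then have "U t x = 0" using False by (simp add: Vbar_def P1_space_def)
      then show ?thesis using pq[OF that] by simp
    qed
    \<comment> \<open>An affine function that vanishes at two different times has both coefficients
      0.\<close>
    obtain t1 where t1: "?c < t1" "t1 < ?d" using dense[OF cd] by blast
    obtain t2 where t2: "t1 < t2" "t2 < ?d" using dense[OF t1(2)] by blast
    have "p x + t1 *\<^sub>R q x = 0" "p x + t2 *\<^sub>R q x = 0" using z t1 t2 by auto
    then have "(t2 - t1) *\<^sub>R q x = 0" by (metis add_diff_cancel_left diff_self scaleR_diff_left)
    then have q: "q x = 0" using t2 by simp
    with \<open>p x + t1 *\<^sub>R q x = 0\<close> have p: "p x = 0" by simp
    have n0: "U (\<tau> k) x = 0" if "k \<le> N" for k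
      using pl_node[OF U that] False by (simp add: Vh_def P1_space_def)
    have mm: "m - 1 \<le> N" "m \<le> N" using m by auto
    consider "t = ?c" | "t = ?d" | "t \<in> I m" using t by force
    then show ?thesis
    proof cases
      case 1 then show ?thesis using n0[OF mm(1)] p q by simp
    next
      case 2 then show ?thesis using n0[OF mm(2)] p q by simp
    next
      case 3 then show ?thesis using pq by simp
    qed
  qed
  have sl: "slope U m = q"
  proof
    fix x
    have "U ?d x - U ?c x = (?d - ?c) *\<^sub>R q x" using all[of ?d x] all[of ?c x] cd by (simp add: scaleR_diff_left)
    then show "slope U m x = q x" using cd by (simp add: slope_def)
  qed
  show ?thesis
  proof
    fix x
    show "U t x = (U ?c + (t - ?c) *\<^sub>R slope U m) x"
      unfolding sl using all[OF t, of x] all[of ?c x] cd by (simp add: scaleR_diff_left)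
  qed
qed

lemma pl_mem:
  assumes "pl U" "m \<in> {1..N}" "t \<in> {\<tau> (m - 1)..\<tau> m}" shows "U t \<in> V m"
proof -
  have "subspace (V m)" using assms(2) by (intro V_subspace) auto
  then show ?thesis
    unfolding pl_linear[OF assms] using pl_nodes_mem[OF assms(1,2)] slope_mem[OF assms(1,2)]
    by (intro subspace_add subspace_scale) auto
qed

lemma pl_mem_W: assumes U: "pl U" and t: "t \<in> {0..T}" shows "U t \<in> W"
proof -
  have "t \<in> (\<Union>k\<in>{0+1..N}. I k) \<union> \<tau> ` {..N}"
    by (rule subsetD[OF grid_cover]) (use t in \<open>simp_all add: \<tau>_zero\<close>)
  then consider k where "k \<in> {1..N}" "t \<in> I k" | k where "k \<le> N" "t = \<tau> k" by auto
  then show ?thesis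
  proof cases
    case 1 then show ?thesis using pl_mem[OF U, of k t] V_W[of k] by auto
  next
    case 2 then show ?thesis using pl_node[OF U] V_W by auto
  qed
qed

lemma tderiv_pl:
  assumes U: "pl U" and m: "m \<in> {1..N}" and t: "t \<in> I m"
  shows "tderiv U t = slope U m"
proof
  fix x
  have "((\<lambda>r. U (\<tau> (m - 1)) x + (r - \<tau> (m - 1)) *\<^sub>R slope U m x) has_vector_derivative slope U m x) (at t)"
    by (auto intro!: derivative_eq_intros)
  then have "((\<lambda>r. U r x) has_vector_derivative slope U m x) (at t)"
  proof (rule has_vector_derivative_transform_within_open[of _ _ _ "I m"])
    fix r assume "r \<in> I m"
    then have "r \<in> {\<tau> (m - 1)..\<tau> m}" by auto
    from fun_cong[OF pl_linear[OF U m this], of x]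
    show "U (\<tau> (m - 1)) x + (r - \<tau> (m - 1)) *\<^sub>R slope U m x = U r x" by simp
  qed (use t in auto)
  then show "tderiv U t x = slope U m x"
    unfolding tderiv_def by (rule vector_derivative_at)
qed

text \<open>All analysis in time is done on these scalar functions, which avoids putting a topology
  on the function space. The integral is the trapezoidal rule, exact for affine functions.\<close>

lemma form_pl:
  assumes g: "psd_form W g" and U: "pl U" and u: "u \<in> W"
  shows form_pl_eq: "m \<in> {1..N} \<Longrightarrow> t \<in> {\<tau> (m - 1)..\<tau> m} \<Longrightarrow>
      g u (U t) = g u (U (\<tau> (m - 1))) + (t - \<tau> (m - 1)) * g u (slope U m)"
    and form_pl_continuous: "continuous_on {0..T} (\<lambda>t. g u (U t))"
    and form_pl_deriv: "m \<in> {1..N} \<Longrightarrow> t \<in> I m \<Longrightarrow> ((\<lambda>t. g u (U t)) has_real_derivative g u (slope U m)) (at t)"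
    and form_pl_integral: "m \<in> {1..N} \<Longrightarrow> (LINT t:I m|lborel. g u (U t))
      = (\<tau> m - \<tau> (m - 1)) / 2 * (g u (U (\<tau> (m - 1))) + g u (U (\<tau> m)))"
proof -
  interpret psd_form W g by (rule g)
  show eq: "g u (U t) = g u (U (\<tau> (m - 1))) + (t - \<tau> (m - 1)) * g u (slope U m)"
    if m: "m \<in> {1..N}" and t: "t \<in> {\<tau> (m - 1)..\<tau> m}" for m t
    using pl_linear[OF U m t] pl_nodes_mem[OF U m] slope_mem[OF U m] V_W[of m] m u
    by (simp add: form_add_right form_scale_right mem_scale)
  have "continuous_on {\<tau> 0..\<tau> m} (\<lambda>t. g u (U t))" if "m \<le> N" for m
    using that
  proof (induction m)
    case (Suc m)
    have "continuous_on {\<tau> m..\<tau> (Suc m)} (\<lambda>t. g u (U t))"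
    proof (rule continuous_on_eq)
      show "continuous_on {\<tau> m..\<tau> (Suc m)} (\<lambda>t. g u (U (\<tau> m)) + (t - \<tau> m) * g u (slope U (Suc m)))"
        by (intro continuous_intros)
      fix t assume "t \<in> {\<tau> m..\<tau> (Suc m)}"
      then show "g u (U (\<tau> m)) + (t - \<tau> m) * g u (slope U (Suc m)) = g u (U t)"
        using eq[of "Suc m" t] Suc.prems by simp
    qed
    moreover have "{\<tau> 0..\<tau> (Suc m)} = {\<tau> 0..\<tau> m} \<union> {\<tau> m..\<tau> (Suc m)}"
      using \<tau>_le[of 0 m] \<tau>_le[of m "Suc m"] Suc.prems by auto
    ultimately show ?case using Suc by (auto intro: continuous_on_closed_Un)
  qed simp
  from this[of N] show "continuous_on {0..T} (\<lambda>t. g u (U t))" by (simp add: \<tau>_zero)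
  show "((\<lambda>t. g u (U t)) has_real_derivative g u (slope U m)) (at t)" if m: "m \<in> {1..N}" and t: "t \<in> I m" for m t
  proof (rule has_field_derivative_transform_within_open[of _ _ _ "I m"])
    show "((\<lambda>t. g u (U (\<tau> (m - 1))) + (t - \<tau> (m - 1)) * g u (slope U m)) has_real_derivative g u (slope U m)) (at t)"
      by (auto intro!: derivative_eq_intros)
    fix r assume "r \<in> I m"
    then show "g u (U (\<tau> (m - 1))) + (r - \<tau> (m - 1)) * g u (slope U m) = g u (U r)"
      using eq[OF m, of r] by simp
  qed (use t in auto)
  show "(LINT t:I m|lborel. g u (U t)) = (\<tau> m - \<tau> (m - 1)) / 2 * (g u (U (\<tau> (m - 1))) + g u (U (\<tau> m)))"
    if m: "m \<in> {1..N}" for m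
  proof -
    have "(LINT t:I m|lborel. g u (U t)) = (LINT t:I m|lborel. g u (U (\<tau> (m - 1))) + (t - \<tau> (m - 1)) * g u (slope U m))"
    proof (intro set_lebesgue_integral_cong allI impI)
      fix t assume "t \<in> I m"
      then show "g u (U t) = g u (U (\<tau> (m - 1))) + (t - \<tau> (m - 1)) * g u (slope U m)" by (intro eq m) auto
    qed simp
    also have "\<dots> = (\<tau> m - \<tau> (m - 1)) * (g u (U (\<tau> (m - 1))) + (\<tau> m - \<tau> (m - 1)) / 2 * g u (slope U m))"
      using step_less[OF m] by (intro affine_integral) simp
    also have "\<dots> = (\<tau> m - \<tau> (m - 1)) / 2 * (g u (U (\<tau> (m - 1))) + g u (U (\<tau> m)))"
    proof -
      have e: "g u (U (\<tau> m)) = g u (U (\<tau> (m - 1))) + (\<tau> m - \<tau> (m - 1)) * g u (slope U m)"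
        by (rule eq[OF m]) (use step_less[OF m] in simp)
      have "k * (A + k / 2 * B) = k / 2 * (A + (A + k * B))" for k A B :: real by (simp add: field_simps)
      then show ?thesis unfolding e .
    qed
    finally show ?thesis .
  qed
qed

lemma form_pl_integrable:
  assumes "psd_form W g" "pl U" "u \<in> W" "m \<in> {1..N}"
  shows "set_integrable lborel (I m) (\<lambda>t. g u (U t))"
proof (rule set_integrable_subset)
  show "set_integrable lborel {0..T} (\<lambda>t. g u (U t))"
    by (rule borel_integrable_atLeastAtMost'[OF form_pl_continuous[OF assms(1-3)]])
qed (use I_subset[OF assms(4)] in auto)

subsection \<open>Load terms\<close>

definition load_mean :: "(real \<Rightarrow> 'd vfield) \<Rightarrow> nat \<Rightarrow> 'd vfield" where
  "load_mean j m = (\<lambda>x. (1 / (\<tau> m - \<tau> (m - 1))) *\<^sub>R (LINT r:I m|lborel. Ph P r (j r) x))"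

lemma PkPh_eq: "m \<in> {1..N} \<Longrightarrow> t \<in> I m \<Longrightarrow> PkPh P j t = load_mean j m"
  using tidx_I[of m t] by (simp add: PkPh_def Pk_def load_mean_def Let_def)

lemma Ph_props:
  assumes "tidx P t = n" "n \<le> N" "v \<in> L2 \<Omega>"
  shows "Ph P t v \<in> V n" and "y \<in> V n \<Longrightarrow> ip P (Ph P t v) y = ip P v y"
  using fe_space.L2_proj_mem[OF fe[OF assms(2)] assms(3)] fe_space.L2_proj_inner[OF fe[OF assms(2)] assms(3)] assms(1)
  by (simp_all add: Ph_def V_P1 ip_def)

lemma load_ip_integrable:
  assumes j: "load P j" and y: "y \<in> V n" and m: "m \<in> {1..N}"
  shows "set_integrable lborel (I m) (\<lambda>t. ip P (j t) y)"
proof (rule set_integrable_subset[of _ "{0..T}"])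
  have yL: "y \<in> L2 \<Omega>" by (rule V_L2[OF y])
  have jL: "j t \<in> L2 \<Omega>" if "t \<in> {0..T}" for t using j that by (simp add: load_def)
  show "set_integrable lborel {0..T} (\<lambda>t. ip P (j t) y)"
  proof (rule set_integrable_bound)
    show "set_integrable lborel {0..T} (\<lambda>t. L2_norm \<Omega> y * L2_norm \<Omega> (j t))"
      using j unfolding load_def by (intro set_integrable_mult_right) auto
    show "AE t in lborel. t \<in> {0..T} \<longrightarrow> norm (ip P (j t) y) \<le> norm (L2_norm \<Omega> y * L2_norm \<Omega> (j t))"
      using L2.cauchy_schwarz[OF jL yL] by (intro AE_I2) (auto simp: ip_def L2_norm_def mult.commute abs_mult L2.form_nonneg jL yL)
    \<comment> \<open>The load is measurable in (x, t), whereas the theorem on parameter integrals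
      expects the parameter t first; hence the swap below.\<close>
    have jm: "(\<lambda>(x, t). indicat_real (\<Omega> \<times> {0..T}) (x, t) *\<^sub>R j t x) \<in> borel_measurable (lborel \<Otimes>\<^sub>M lborel)"
      using j unfolding load_def set_borel_measurable_def by (simp add: case_prod_beta')
    have ym: "(\<lambda>x. indicat_real \<Omega> x *\<^sub>R y x) \<in> borel_measurable lborel"
      using L2_measurable[OF yL] by (simp add: set_borel_measurable_def)
    have "(\<lambda>(t, x). (indicat_real (\<Omega> \<times> {0..T}) (x, t) *\<^sub>R j t x) \<bullet> (indicat_real \<Omega> x *\<^sub>R y x)) \<in> borel_measurable (lborel \<Otimes>\<^sub>M lborel)"
      unfolding case_prod_beta'
    proof (rule borel_measurable_inner)
      show "(\<lambda>z. indicat_real (\<Omega> \<times> {0..T}) (snd z, fst z) *\<^sub>R j (fst z) (snd z)) \<in> borel_measurable (lborel \<Otimes>\<^sub>M lborel)"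
        using measurable_pair_swap[OF jm] by (simp add: case_prod_beta')
      show "(\<lambda>z. indicat_real \<Omega> (snd z) *\<^sub>R y (snd z)) \<in> borel_measurable (lborel \<Otimes>\<^sub>M lborel)"
        by (rule measurable_compose[OF measurable_snd ym])
    qed
    then have "(\<lambda>t. LINT x|lborel. (indicat_real (\<Omega> \<times> {0..T}) (x, t) *\<^sub>R j t x) \<bullet> (indicat_real \<Omega> x *\<^sub>R y x)) \<in> borel_measurable lborel"
      by (rule lborel.borel_measurable_lebesgue_integral)
    moreover have "(LINT x|lborel. (indicat_real (\<Omega> \<times> {0..T}) (x, t) *\<^sub>R j t x) \<bullet> (indicat_real \<Omega> x *\<^sub>R y x))
        = indicat_real {0..T} t *\<^sub>R ip P (j t) y" for t
      unfolding ip_def L2_inner_def set_lebesgue_integral_def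
      by (subst integral_scaleR_right[symmetric], intro Bochner_Integration.integral_cong refl) (auto simp: indicator_def)
    ultimately show "set_borel_measurable lborel {0..T} (\<lambda>t. ip P (j t) y)"
      by (simp add: set_borel_measurable_def)
  qed
qed (use I_subset[OF m] in auto)

text \<open>An orthonormal basis of V m reduces time integrals of functions with values in V m to
  scalar integrals of the coefficients \<open>c e t\<close>. The norm bound is the triangle
  inequality for the mean, obtained by pairing the mean with itself.\<close>

lemma load_mean_props:
  assumes j: "load P j" and m: "m \<in> {1..N}"
  shows load_mean_mem: "load_mean j m \<in> V m"
    and load_mean_ip: "y \<in> V m \<Longrightarrow> (LINT t:I m|lborel. ip P (j t) y) = (\<tau> m - \<tau> (m - 1)) * ip P (load_mean j m) y"
    and load_norm_integrable: "psd_form W g \<Longrightarrow> set_integrable lborel (I m) (\<lambda>t. sqrt (g (Ph P t (j t)) (Ph P t (j t))))"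
    and load_mean_norm: "psd_form W g \<Longrightarrow> (\<tau> m - \<tau> (m - 1)) * sqrt (g (load_mean j m) (load_mean j m))
      \<le> (LINT t:I m|lborel. sqrt (g (Ph P t (j t)) (Ph P t (j t))))"
proof -
  have mN: "m \<le> N" using m by auto
  interpret fes: fe_space \<Omega> "opA P" a "mesh P m" by (rule fe[OF mN])
  define k where "k = \<tau> m - \<tau> (m - 1)"
  have k: "k > 0" using step_less[OF m] by (simp add: k_def)
  obtain E where E: "fes.ip.orthonormal E" "E \<subseteq> V m" "finite E"
    and basis: "\<And>v. v \<in> V m \<Longrightarrow> v = (\<Sum>e\<in>E. ip P v e *\<^sub>R e)"
    using fes.ip.orthonormal_basis_exists[OF fes.subspace_P1 order_refl] unfolding V_P1 ip_def by blast
  have jL: "j t \<in> L2 \<Omega>" if "t \<in> I m" for t using j that I_subset[OF m] by (auto simp: load_def)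
  define c where "c e t = ip P (j t) e" for e t
  have cint: "set_integrable lborel (I m) (c e)" if "e \<in> E" for e
    unfolding c_def using E(2) that by (intro load_ip_integrable[OF j _ m]) auto
  have w: "Ph P t (j t) = (\<Sum>e\<in>E. c e t *\<^sub>R e)" "Ph P t (j t) \<in> V m" if t: "t \<in> I m" for t
  proof -
    note pr = Ph_props[OF tidx_I[OF m t] mN jL[OF t]]
    show "Ph P t (j t) \<in> V m" by (rule pr(1))
    have "Ph P t (j t) = (\<Sum>e\<in>E. ip P (Ph P t (j t)) e *\<^sub>R e)" by (rule basis[OF pr(1)])
    also have "\<dots> = (\<Sum>e\<in>E. c e t *\<^sub>R e)" using pr(2) E(2) by (intro sum.cong refl) (auto simp: c_def)
    finally show "Ph P t (j t) = (\<Sum>e\<in>E. c e t *\<^sub>R e)" .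
  qed
  define C where "C e = (LINT t:I m|lborel. c e t)" for e
  have mean: "load_mean j m = (\<Sum>e\<in>E. (C e / k) *\<^sub>R e)"
  proof
    fix x
    have "(LINT r:I m|lborel. Ph P r (j r) x) = (LINT r:I m|lborel. \<Sum>e\<in>E. c e r *\<^sub>R e x)"
      by (intro set_lebesgue_integral_cong) (auto simp: w)
    also have "\<dots> = (\<Sum>e\<in>E. LINT r:I m|lborel. c e r *\<^sub>R e x)"
    proof -
      have "set_integrable lborel (I m) (\<lambda>r. c e r *\<^sub>R e x)" if "e \<in> E" for e
        using cint[OF that] by (intro set_integrable_scaleR_left)
      then show ?thesis
        unfolding set_lebesgue_integral_def set_integrable_def scaleR_sum_right
        by (intro Bochner_Integration.integral_sum)
    qed
    also have "\<dots> = (\<Sum>e\<in>E. C e *\<^sub>R e x)"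
      using cint unfolding C_def set_lebesgue_integral_def set_integrable_def
      by (intro sum.cong refl) (subst integral_scaleR_left[symmetric], simp_all)
    finally show "load_mean j m x = (\<Sum>e\<in>E. (C e / k) *\<^sub>R e) x"
      by (simp add: load_mean_def k_def scaleR_sum_right)
  qed
  show mem: "load_mean j m \<in> V m"
    unfolding mean using E V_subspace[OF mN] by (intro subspace_sum subspace_scale) auto
  \<comment> \<open>Taking the mean commutes with linear functionals; h will be the pairing with y
    and, for the norm bound, the pairing with the mean itself.\<close>
  have lin: "set_integrable lborel (I m) (\<lambda>t. h (Ph P t (j t)))"
    "(LINT t:I m|lborel. h (Ph P t (j t))) = k * h (load_mean j m)"
    if h: "\<And>c. h (\<Sum>e\<in>E. c e *\<^sub>R e) = (\<Sum>e\<in>E. c e * (h e :: real))" for h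
  proof -
    have int: "set_integrable lborel (I m) (\<lambda>t. c e t * h e)" if "e \<in> E" for e
      using cint[OF that] by (intro set_integrable_mult_left)
    have eq: "h (Ph P t (j t)) = (\<Sum>e\<in>E. c e t * h e)" if "t \<in> I m" for t using w[OF that] h by simp
    have "set_integrable lborel (I m) (\<lambda>t. \<Sum>e\<in>E. c e t * h e)"
      using int unfolding set_integrable_def scaleR_sum_right by (intro Bochner_Integration.integrable_sum)
    then show "set_integrable lborel (I m) (\<lambda>t. h (Ph P t (j t)))"
      by (subst set_integrable_cong[OF refl refl eq]) auto
    have "(LINT t:I m|lborel. h (Ph P t (j t))) = (LINT t:I m|lborel. \<Sum>e\<in>E. c e t * h e)"
      by (intro set_lebesgue_integral_cong) (auto simp: eq)
    also have "\<dots> = (\<Sum>e\<in>E. LINT t:I m|lborel. c e t * h e)"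
      using int unfolding set_lebesgue_integral_def set_integrable_def scaleR_sum_right
      by (intro Bochner_Integration.integral_sum) auto
    also have "\<dots> = (\<Sum>e\<in>E. C e * h e)" unfolding C_def by simp
    also have "\<dots> = k * h (load_mean j m)" unfolding mean h using k by (simp add: sum_distrib_left)
    finally show "(LINT t:I m|lborel. h (Ph P t (j t))) = k * h (load_mean j m)" .
  qed
  show "(LINT t:I m|lborel. ip P (j t) y) = (\<tau> m - \<tau> (m - 1)) * ip P (load_mean j m) y" if y: "y \<in> V m"
  proof -
    have "(LINT t:I m|lborel. ip P (j t) y) = (LINT t:I m|lborel. ip P (Ph P t (j t)) y)"
      using Ph_props(2)[OF tidx_I[OF m] mN jL y] by (intro set_lebesgue_integral_cong) auto
    also have "\<dots> = k * ip P (load_mean j m) y"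
    proof (rule lin(2))
      show "ip P (\<Sum>e\<in>E. c e *\<^sub>R e) y = (\<Sum>e\<in>E. c e * ip P e y)" for c
        unfolding ip_def using E(2) y by (intro fes.ip.form_expand_left) (auto simp: V_P1)
    qed
    finally show ?thesis by (simp add: k_def)
  qed
  fix g assume "psd_form W g"
  then interpret g: psd_form W g .
  have EW: "e \<in> W" if "e \<in> E" for e using E(2) that V_W[OF mN] by auto
  have wW: "Ph P t (j t) \<in> W" if "t \<in> I m" for t using w(2)[OF that] V_W[OF mN] by auto
  have mW: "load_mean j m \<in> W" using mem V_W[OF mN] by auto
  have sq: "sqrt (g (Ph P t (j t)) (Ph P t (j t))) = sqrt (\<Sum>e\<in>E. \<Sum>f\<in>E. c e t * (c f t * g e f))" if t: "t \<in> I m" for t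
  proof -
    let ?w = "Ph P t (j t)"
    have "g ?w ?w = (\<Sum>e\<in>E. c e t * g e ?w)"
      by (subst (1) w(1)[OF t], rule g.form_expand_left) (use EW wW[OF t] in auto)
    also have "\<dots> = (\<Sum>e\<in>E. c e t * (\<Sum>f\<in>E. c f t * g e f))"
      unfolding w(1)[OF t] using EW by (intro sum.cong refl arg_cong2[where f="(*)"] g.form_expand_right) auto
    finally show ?thesis by (simp add: sum_distrib_left)
  qed
  have bound: "sqrt (g (Ph P t (j t)) (Ph P t (j t))) \<le> (\<Sum>e\<in>E. \<bar>c e t\<bar> * sqrt (g e e))" if t: "t \<in> I m" for t
  proof -
    have "sqrt (g (\<Sum>e\<in>F. c e t *\<^sub>R e) (\<Sum>e\<in>F. c e t *\<^sub>R e)) \<le> (\<Sum>e\<in>F. \<bar>c e t\<bar> * sqrt (g e e))" if "finite F" "F \<subseteq> E" for F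
      using that
    proof (induction F)
      case (insert e F)
      have "(\<Sum>e\<in>F. c e t *\<^sub>R e) \<in> W" using insert.prems EW by (intro g.mem_sum g.mem_scale) auto
      moreover have "e \<in> W" using insert.prems EW by auto
      ultimately show ?case
        unfolding sum.insert[OF insert.hyps]
        using g.triangle[of "c e t *\<^sub>R e" "\<Sum>e\<in>F. c e t *\<^sub>R e"] g.norm_scale[of e "c e t"] g.mem_scale[of e "c e t"]
          insert.IH insert.prems by (smt (verit) insert_subset)
    qed (simp add: g.form_zero_left g.mem_zero)
    from this[OF E(3) order_refl] show ?thesis unfolding w(1)[OF t] .
  qed
  show nint: "set_integrable lborel (I m) (\<lambda>t. sqrt (g (Ph P t (j t)) (Ph P t (j t))))"
  proof (rule set_integrable_bound)
    show "set_integrable lborel (I m) (\<lambda>t. \<Sum>e\<in>E. \<bar>c e t\<bar> * sqrt (g e e))"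
    proof -
      have "set_integrable lborel (I m) (\<lambda>t. \<bar>c e t\<bar> * sqrt (g e e))" if "e \<in> E" for e
        using set_integrable_abs[OF cint[OF that]] by (intro set_integrable_mult_left)
      then show ?thesis unfolding set_integrable_def scaleR_sum_right by (intro Bochner_Integration.integrable_sum)
    qed
    show "AE t in lborel. t \<in> I m \<longrightarrow> norm (sqrt (g (Ph P t (j t)) (Ph P t (j t)))) \<le> norm (\<Sum>e\<in>E. \<bar>c e t\<bar> * sqrt (g e e))"
    proof (intro AE_I2 impI)
      fix t assume t: "t \<in> I m"
      have "0 \<le> g (Ph P t (j t)) (Ph P t (j t))" by (rule g.form_nonneg[OF wW[OF t]])
      then show "norm (sqrt (g (Ph P t (j t)) (Ph P t (j t)))) \<le> norm (\<Sum>e\<in>E. \<bar>c e t\<bar> * sqrt (g e e))"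
        using bound[OF t] by simp
    qed
    \<comment> \<open>Measurability of the norm in t is read off from the coefficients, cut off
      outside I m, where both sides below are then 0.\<close>
    have cm: "(\<lambda>t. indicat_real (I m) t *\<^sub>R c e t) \<in> borel_measurable lborel" if "e \<in> E" for e
      using cint[OF that] unfolding set_integrable_def by (rule borel_measurable_integrable)
    have "(\<lambda>t. sqrt (\<Sum>e\<in>E. \<Sum>f\<in>E. (indicat_real (I m) t *\<^sub>R c e t) * ((indicat_real (I m) t *\<^sub>R c f t) * g e f))) \<in> borel_measurable lborel"
      using cm by (intro measurable_compose[OF _ borel_measurable_sqrt] borel_measurable_sum borel_measurable_times borel_measurable_const)
    also have "(\<lambda>t. sqrt (\<Sum>e\<in>E. \<Sum>f\<in>E. (indicat_real (I m) t *\<^sub>R c e t) * ((indicat_real (I m) t *\<^sub>R c f t) * g e f)))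
      = (\<lambda>t. indicat_real (I m) t *\<^sub>R sqrt (g (Ph P t (j t)) (Ph P t (j t))))"
    proof
      fix t
      show "sqrt (\<Sum>e\<in>E. \<Sum>f\<in>E. (indicat_real (I m) t *\<^sub>R c e t) * ((indicat_real (I m) t *\<^sub>R c f t) * g e f))
        = indicat_real (I m) t *\<^sub>R sqrt (g (Ph P t (j t)) (Ph P t (j t)))"
        by (cases "t \<in> I m") (simp_all add: sq)
    qed
    finally show "set_borel_measurable lborel (I m) (\<lambda>t. sqrt (g (Ph P t (j t)) (Ph P t (j t))))"
      by (simp add: set_borel_measurable_def)
  qed
  let ?p = "load_mean j m"
  show "(\<tau> m - \<tau> (m - 1)) * sqrt (g ?p ?p) \<le> (LINT t:I m|lborel. sqrt (g (Ph P t (j t)) (Ph P t (j t))))"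
  proof (cases "g ?p ?p = 0")
    case True
    then show ?thesis unfolding set_lebesgue_integral_def
      using g.form_nonneg[OF wW]
      by (auto intro!: Bochner_Integration.integral_nonneg simp: indicator_def)
  next
    case False
    then have pos: "g ?p ?p > 0" using g.form_nonneg[OF mW] by simp
    have gl: "g (\<Sum>e\<in>E. c e *\<^sub>R e) ?p = (\<Sum>e\<in>E. c e * g e ?p)" for c
      using EW mW by (intro g.form_expand_left) auto
    \<comment> \<open>Cauchy-Schwarz bounds the left side by the norm of the mean times the integral
      of the norms; one factor of the norm of the mean is then cancelled.\<close>
    have "k * g ?p ?p = (LINT t:I m|lborel. g (Ph P t (j t)) ?p)" by (rule lin(2)[of "\<lambda>u. g u ?p", OF gl, symmetric])
    also have "\<dots> \<le> (LINT t:I m|lborel. sqrt (g (Ph P t (j t)) (Ph P t (j t))) * sqrt (g ?p ?p))"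
    proof (rule set_integral_mono)
      show "set_integrable lborel (I m) (\<lambda>t. g (Ph P t (j t)) ?p)" by (rule lin(1)[of "\<lambda>u. g u ?p", OF gl])
      show "set_integrable lborel (I m) (\<lambda>t. sqrt (g (Ph P t (j t)) (Ph P t (j t))) * sqrt (g ?p ?p))"
        using nint by (intro set_integrable_mult_left)
      show "g (Ph P t (j t)) ?p \<le> sqrt (g (Ph P t (j t)) (Ph P t (j t))) * sqrt (g ?p ?p)" if "t \<in> I m" for t
        using g.cauchy_schwarz[OF wW[OF that] mW] by linarith
    qed
    also have "\<dots> = (LINT t:I m|lborel. sqrt (g (Ph P t (j t)) (Ph P t (j t)))) * sqrt (g ?p ?p)" by simp
    finally have "(k * sqrt (g ?p ?p)) * sqrt (g ?p ?p) \<le> (LINT t:I m|lborel. sqrt (g (Ph P t (j t)) (Ph P t (j t)))) * sqrt (g ?p ?p)"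
      using pos by (simp add: mult.assoc)
    then show ?thesis using pos by (simp add: k_def)
  qed
qed

subsection \<open>Tested equations\<close>

lemma left_lim_T:
  assumes "m \<in> {1..N}" "\<And>t. t \<in> I N \<Longrightarrow> v t = y"
  shows "left_lim T v = y"
proof
  fix x
  have "\<forall>\<^sub>F t in at_left T. t \<in> I N"
    using eventually_at_left_real[OF step_less[of N]] N_pos by simp
  then have "\<forall>\<^sub>F t in at_left T. v t x = y x" by eventually_elim (simp add: assms(2))
  then have "((\<lambda>t. v t x) \<longlongrightarrow> y x) (at_left T)" by (rule tendsto_eventually)
  then show "left_lim T v x = y x" unfolding left_lim_def by (intro tendsto_Lim trivial_limit_at_left_real)
qed

text \<open>Test functions concentrated on one time interval; they split the variational equation
  into one equation per interval and component.\<close>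

definition pulse :: "nat \<Rightarrow> 'd vfield \<Rightarrow> real \<Rightarrow> 'd vfield" where
  "pulse m y t = (if t \<in> I m then y else 0)"

lemma pulse_I: "m \<in> {1..N} \<Longrightarrow> k \<in> {1..N} \<Longrightarrow> t \<in> I k \<Longrightarrow> pulse m y t = (if k = m then y else 0)"
  using I_disjoint[of m k t] by (auto simp: pulse_def)

lemma pulse_outside: "t \<notin> I m \<Longrightarrow> pulse m y t = 0"
  unfolding pulse_def by (rule if_not_P)

lemma zero_mem_V: "n \<le> N \<Longrightarrow> 0 \<in> V n"
  by (rule subspace_0[OF V_subspace])

lemma pulse_Vhk:
  assumes "m \<in> {1..N}" "y \<in> V m"
  shows "(pulse m y, \<lambda>_. 0) \<in> Vhk P" "(\<lambda>_. 0, pulse m y) \<in> Vhk P"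
proof -
  have *: "\<forall>n\<in>{1..N}. \<exists>z\<in>V n. \<forall>t\<in>I n. pulse m y t = z"
  proof
    fix n assume n: "n \<in> {1..N}"
    show "\<exists>z\<in>V n. \<forall>t\<in>I n. pulse m y t = z"
      by (rule bexI[of _ "if n = m then y else 0"]) (use pulse_I[OF assms(1) n] assms(2) zero_mem_V[of n] n in auto)
  qed
  have z: "\<forall>n\<in>{1..N}. \<exists>z\<in>V n. \<forall>t\<in>I n. (\<lambda>_::real. 0) t = z" using zero_mem_V by auto
  show "(pulse m y, \<lambda>_. 0) \<in> Vhk P" "(\<lambda>_. 0, pulse m y) \<in> Vhk P"
    unfolding Vhk_def using * z by blast+
qed

lemma integral_pulse:
  assumes "m \<in> {1..N}" "\<And>t. t \<in> {0..T} \<Longrightarrow> t \<notin> I m \<Longrightarrow> f t = (0::real)"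
  shows "(LINT t:{0..T}|lborel. f t) = (LINT t:I m|lborel. f t)"
  unfolding set_lebesgue_integral_def
  using I_subset[OF assms(1)] assms(2)
  by (intro Bochner_Integration.integral_cong refl) (auto simp: indicator_def)

lemma ip_zero_left: "ip P 0 v = 0"
  by (simp add: ip_def)

lemma a_zero_left: "v \<in> H10 \<Omega> \<Longrightarrow> a 0 v = 0"
  by (rule psd_form.form_zero_left[OF ef.a_psd_form])

end

locale dual_solution = discrete_setting \<kappa> P l for \<kappa> and P :: "'d::finite cg_data" and l +
  fixes z1T z2T :: "'d vfield" and j1 j2 Z1 Z2 :: "real \<Rightarrow> 'd vfield"
  assumes data: "z1T \<in> L2 \<Omega>" "z2T \<in> L2 \<Omega>" "load P j1" "load P j2"
    and Z_Uhk: "(Z1, Z2) \<in> Uhk P"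
    and dual: "\<forall>V \<in> Vhk P. Bstar P V (Z1, Z2) = Lstar P j1 j2 z1T z2T V"
    and Z1_T: "Z1 T = Ph P T z1T" and Z2_T: "Z2 T = Ph P T z2T"
begin

lemma pl1: "pl Z1" and pl2: "pl Z2"
  using Uhk_pl[OF Z_Uhk] by auto

lemma Z_H10: "t \<in> {0..T} \<Longrightarrow> Z2 t \<in> H10 \<Omega>"
  using pl_mem_W[OF pl2] V_H10 by blast

lemma terminal:
  assumes "z \<in> L2 \<Omega>" "y \<in> V N" shows "ip P y (Ph P T z) = ip P y z"
  using Ph_props(2)[OF tidx_node[of N] _ assms] by (simp add: ip_def L2_inner_commute)

text \<open>The terminal terms of the two sides cancel, because Z1(T) is the projection of z1T and
  the left limit of the pulse belongs to V N.\<close>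

lemma tested1:
  assumes m: "m \<in> {1..N}" and y: "y \<in> V m"
  shows "(LINT t:I m|lborel. - ip P y (tderiv Z1 t) + a y (Z2 t) - (LINT r:{t..T}|lborel. kern P (r - t) * a y (Z2 r)))
    = (LINT t:I m|lborel. ip P y (j1 t))"
proof -
  have NN: "N \<in> {1..N}" using N_pos by simp
  define v where "v = pulse m y"
  have ll: "left_lim T v = (if N = m then y else 0)" "left_lim T (\<lambda>_. 0 :: 'd vfield) = 0"
    by (rule left_lim_T[OF m], simp add: v_def pulse_I[OF m NN], rule left_lim_T[OF m], simp)
  have trm: "ip P (left_lim T v) (Z1 T) = ip P (left_lim T v) z1T"
    unfolding ll Z1_T using terminal[OF data(1)] y by (auto simp: ip_zero_left)
  \<comment> \<open>Linearity of \<open>a\<close> is known on H^1_0 only, so \<open>a 0\<close>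
    vanishes against Z2(r) because that function lies in H^1_0.\<close>
  have inner: "(LINT r:{t..T}|lborel. kern P (r - t) * a 0 (Z2 r)) = 0" if "t \<in> {0..T}" for t
  proof -
    have "(LINT r:{t..T}|lborel. kern P (r - t) * a 0 (Z2 r)) = (LINT r:{t..T}|lborel. 0)"
      using that by (intro set_lebesgue_integral_cong) (auto intro!: a_zero_left Z_H10)
    then show ?thesis by simp
  qed
  have "Bstar P (v, \<lambda>_. 0) (Z1, Z2) = Lstar P j1 j2 z1T z2T (v, \<lambda>_. 0)"
    using dual pulse_Vhk(1)[OF m y] unfolding v_def by blast
  then have "(LINT t:{0..T}|lborel. - ip P (v t) (tderiv Z1 t) + a (v t) (Z2 t)
        - (LINT r:{t..T}|lborel. kern P (r - t) * a (v t) (Z2 r)))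
      = (LINT t:{0..T}|lborel. ip P (v t) (j1 t))"
    unfolding Bstar_def Lstar_def prod.case trm ll(2) by (simp add: ip_zero_left)
  also have "(LINT t:{0..T}|lborel. - ip P (v t) (tderiv Z1 t) + a (v t) (Z2 t)
        - (LINT r:{t..T}|lborel. kern P (r - t) * a (v t) (Z2 r)))
      = (LINT t:I m|lborel. - ip P (v t) (tderiv Z1 t) + a (v t) (Z2 t)
        - (LINT r:{t..T}|lborel. kern P (r - t) * a (v t) (Z2 r)))"
  proof (rule integral_pulse[OF m])
    fix t assume t: "t \<in> {0..T}" "t \<notin> I m"
    have "v t = 0" unfolding v_def by (rule pulse_outside[OF t(2)])
    show "- ip P (v t) (tderiv Z1 t) + a (v t) (Z2 t)
        - (LINT r:{t..T}|lborel. kern P (r - t) * a (v t) (Z2 r)) = 0" unfolding \<open>v t = 0\<close> using t(1) by (simp add: ip_zero_left a_zero_left Z_H10 inner)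
  qed
  also have "\<dots> = (LINT t:I m|lborel. - ip P y (tderiv Z1 t) + a y (Z2 t) - (LINT r:{t..T}|lborel. kern P (r - t) * a y (Z2 r)))"
    by (intro set_lebesgue_integral_cong) (auto simp: v_def pulse_def)
  also have "(LINT t:{0..T}|lborel. ip P (v t) (j1 t)) = (LINT t:I m|lborel. ip P (v t) (j1 t))"
  proof (rule integral_pulse[OF m])
    fix t assume t: "t \<in> {0..T}" "t \<notin> I m"
    have "v t = 0" unfolding v_def by (rule pulse_outside[OF t(2)])
    show "ip P (v t) (j1 t) = 0" unfolding \<open>v t = 0\<close> using t(1) by (simp add: ip_zero_left)
  qed
  also have "\<dots> = (LINT t:I m|lborel. ip P y (j1 t))"
    by (intro set_lebesgue_integral_cong) (auto simp: v_def pulse_def)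
  finally show ?thesis .
qed

lemma tested2:
  assumes m: "m \<in> {1..N}" and y: "y \<in> V m"
  shows "(LINT t:I m|lborel. - ip P y (tderiv Z2 t) - ip P y (Z1 t)) = (LINT t:I m|lborel. ip P y (j2 t))"
proof -
  have NN: "N \<in> {1..N}" using N_pos by simp
  define v where "v = pulse m y"
  have ll: "left_lim T v = (if N = m then y else 0)" "left_lim T (\<lambda>_. 0 :: 'd vfield) = 0"
    by (rule left_lim_T[OF m], simp add: v_def pulse_I[OF m NN], rule left_lim_T[OF m], simp)
  have trm: "ip P (left_lim T v) (Z2 T) = ip P (left_lim T v) z2T"
    unfolding ll Z2_T using terminal[OF data(2)] y by (auto simp: ip_zero_left)
  have inner: "(LINT r:{t..T}|lborel. kern P (r - t) * a 0 (Z2 r)) = 0" if "t \<in> {0..T}" for t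
  proof -
    have "(LINT r:{t..T}|lborel. kern P (r - t) * a 0 (Z2 r)) = (LINT r:{t..T}|lborel. 0)"
      using that by (intro set_lebesgue_integral_cong) (auto intro!: a_zero_left Z_H10)
    then show ?thesis by simp
  qed
  have "Bstar P (\<lambda>_. 0, v) (Z1, Z2) = Lstar P j1 j2 z1T z2T (\<lambda>_. 0, v)"
    using dual pulse_Vhk(2)[OF m y] unfolding v_def by blast
  then have "(LINT t:{0..T}|lborel. - ip P 0 (tderiv Z1 t) + a 0 (Z2 t)
        - (LINT r:{t..T}|lborel. kern P (r - t) * a 0 (Z2 r)) - ip P (v t) (tderiv Z2 t) - ip P (v t) (Z1 t))
      = (LINT t:{0..T}|lborel. ip P (v t) (j2 t))"
    unfolding Bstar_def Lstar_def prod.case trm ll(2) by (simp add: ip_zero_left)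
  also have "(LINT t:{0..T}|lborel. - ip P 0 (tderiv Z1 t) + a 0 (Z2 t)
        - (LINT r:{t..T}|lborel. kern P (r - t) * a 0 (Z2 r)) - ip P (v t) (tderiv Z2 t) - ip P (v t) (Z1 t))
      = (LINT t:{0..T}|lborel. - ip P (v t) (tderiv Z2 t) - ip P (v t) (Z1 t))"
    by (intro set_lebesgue_integral_cong) (auto simp: ip_zero_left a_zero_left Z_H10 inner)
  also have "\<dots> = (LINT t:I m|lborel. - ip P (v t) (tderiv Z2 t) - ip P (v t) (Z1 t))"
  proof (rule integral_pulse[OF m])
    fix t assume t: "t \<in> {0..T}" "t \<notin> I m"
    have "v t = 0" unfolding v_def by (rule pulse_outside[OF t(2)])
    show "- ip P (v t) (tderiv Z2 t) - ip P (v t) (Z1 t) = 0" unfolding \<open>v t = 0\<close> using t(1) by (simp add: ip_zero_left)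
  qed
  also have "\<dots> = (LINT t:I m|lborel. - ip P y (tderiv Z2 t) - ip P y (Z1 t))"
    by (intro set_lebesgue_integral_cong) (auto simp: v_def pulse_def)
  also have "(LINT t:{0..T}|lborel. ip P (v t) (j2 t)) = (LINT t:I m|lborel. ip P (v t) (j2 t))"
  proof (rule integral_pulse[OF m])
    fix t assume t: "t \<in> {0..T}" "t \<notin> I m"
    have "v t = 0" unfolding v_def by (rule pulse_outside[OF t(2)])
    show "ip P (v t) (j2 t) = 0" unfolding \<open>v t = 0\<close> using t(1) by (simp add: ip_zero_left)
  qed
  also have "\<dots> = (LINT t:I m|lborel. ip P y (j2 t))"
    by (intro set_lebesgue_integral_cong) (auto simp: v_def pulse_def)
  finally show ?thesis .
qed

subsection \<open>The energy identity\<close>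

abbreviation "d1 \<equiv> slope Z1"
abbreviation "d2 \<equiv> slope Z2"
abbreviation "p1 \<equiv> load_mean j1"
abbreviation "p2 \<equiv> load_mean j2"

text \<open>The time derivative of Z2 as a step function with value 0 at the nodes, where
  \<open>tderiv\<close> need not be a derivative. The sum of indicators is the form expected by
  \<open>convex_kernel_positive_type\<close>.\<close>

definition rate :: "real \<Rightarrow> 'd vfield" where
  "rate = (\<lambda>t. \<Sum>m\<in>{1..N}. indicat_real (I m) t *\<^sub>R d2 m)"

definition memory :: "'d vfield \<Rightarrow> real \<Rightarrow> real" where
  "memory u t = (LINT r:{t..T}|lborel. kern P (r - t) * b u (Z2 r))"

definition rate_memory :: "'d vfield \<Rightarrow> real \<Rightarrow> real" where
  "rate_memory u t = (LINT r:{t..T}|lborel. mk.\<xi> (r - t) * b u (rate r))"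

lemma rate_eq:
  assumes "m \<in> {1..N}" "t \<in> I m" shows "rate t = d2 m"
proof -
  have "rate t = (\<Sum>k\<in>{1..N}. if k = m then d2 m else 0)"
    unfolding rate_def
  proof (intro sum.cong refl)
    fix k assume k: "k \<in> {1..N}"
    show "indicat_real (I k) t *\<^sub>R d2 k = (if k = m then d2 m else 0)"
      using I_disjoint[OF k assms(1) _ assms(2)] assms(2) by (cases "t \<in> I k") (simp_all only: indicator_simps, auto)
  qed
  then show ?thesis using assms(1) by simp
qed

lemma slope_W: "m \<in> {1..N} \<Longrightarrow> d1 m \<in> W \<and> d2 m \<in> W"
  using slope_mem[OF pl1] slope_mem[OF pl2] V_W[of m] by auto

lemma mean_W: "m \<in> {1..N} \<Longrightarrow> p1 m \<in> W \<and> p2 m \<in> W"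
  using load_mean_mem[OF data(3)] load_mean_mem[OF data(4)] V_W[of m] by auto

lemma b_rate:
  assumes u: "u \<in> W"
  shows "b u (rate r) = (\<Sum>m\<in>{1..N}. indicat_real (I m) r * b u (d2 m))"
  unfolding rate_def using u slope_W by (intro b.form_expand_right) auto

lemma b_rate_measurable: "u \<in> W \<Longrightarrow> (\<lambda>r. b u (rate r)) \<in> borel_measurable borel"
  unfolding b_rate by measurable

lemma b_rate_bounded: "u \<in> W \<Longrightarrow> \<bar>b u (rate r)\<bar> \<le> (\<Sum>m\<in>{1..N}. \<bar>b u (d2 m)\<bar>)"
  unfolding b_rate by (intro order_trans[OF sum_abs] sum_mono) (auto simp: abs_mult indicator_def)

lemma Z_W: "t \<in> {0..T} \<Longrightarrow> Z1 t \<in> W \<and> Z2 t \<in> W"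
  using pl_mem_W[OF pl1] pl_mem_W[OF pl2] by auto

lemma Z2_T_W: "Z2 T \<in> W"
  using pl_node[OF pl2 order_refl] .

lemma memory_parts:
  assumes u: "u \<in> W" and t: "t \<in> {0..T}"
  shows "memory u t = \<kappa> * b u (Z2 t) - mk.\<xi> (T - t) * b u (Z2 T) + rate_memory u t"
  unfolding memory_def rate_memory_def
proof (rule mk.memory_by_parts[OF _ _ _ _ b_rate_measurable[OF u] b_rate_bounded[OF u]])
  show "t \<le> T" using t by simp
  show "continuous_on {t..T} (\<lambda>r. b u (Z2 r))"
    by (rule continuous_on_subset[OF form_pl_continuous[OF b.psd_form_axioms pl2 u]]) (use t in auto)
  show "finite (\<tau> ` {..N})" by simp
  fix r assume r: "r \<in> {t<..<T} - \<tau> ` {..N}"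
  have "r \<in> (\<Union>k\<in>{0+1..N}. I k) \<union> \<tau> ` {..N}"
    by (rule subsetD[OF grid_cover]) (use t r in \<open>simp_all add: \<tau>_zero\<close>)
  with r obtain m where m: "m \<in> {1..N}" "r \<in> I m" by auto
  show "((\<lambda>r. b u (Z2 r)) has_real_derivative b u (rate r)) (at r)"
    using form_pl_deriv[OF b.psd_form_axioms pl2 u m] unfolding rate_eq[OF m] .
qed

lemma rate_memory_integrable:
  assumes u: "u \<in> W" and m: "m \<in> {1..N}" shows "set_integrable lborel (I m) (rate_memory u)"
proof (rule set_integrable_subset)
  show "set_integrable lborel {\<tau> (m - 1)..\<tau> m} (rate_memory u)"
    unfolding rate_memory_def
    by (rule mk.\<xi>_memory_integrable[OF b_rate_measurable[OF u] b_rate_bounded[OF u]]) (use m in \<open>auto intro: \<tau>_le\<close>)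
qed auto

lemma \<xi>_const_integrable:
  assumes m: "m \<in> {1..N}" shows "set_integrable lborel (I m) (\<lambda>t. mk.\<xi> (T - t) * c)"
proof (rule set_integrable_subset)
  show "set_integrable lborel {\<tau> (m - 1)..\<tau> m} (\<lambda>t. mk.\<xi> (T - t) * c)"
    by (rule mk.\<xi>_step_integrable(2)[of "\<lambda>_. c" "\<bar>c\<bar>"]) (use m in \<open>auto intro: \<tau>_le\<close>)
qed auto

lemma memory_integral:
  assumes u: "u \<in> W" and m: "m \<in> {1..N}"
  shows "set_integrable lborel (I m) (memory u)"
    and "(LINT t:I m|lborel. memory u t) = \<kappa> * (LINT t:I m|lborel. b u (Z2 t))
      - (LINT t:I m|lborel. mk.\<xi> (T - t) * b u (Z2 T)) + (LINT t:I m|lborel. rate_memory u t)"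
proof -
  have eq: "memory u t = \<kappa> * b u (Z2 t) - mk.\<xi> (T - t) * b u (Z2 T) + rate_memory u t" if "t \<in> I m" for t
    using memory_parts[OF u] subsetD[OF I_subset[OF m] that] by blast
  have i1: "set_integrable lborel (I m) (\<lambda>t. \<kappa> * b u (Z2 t))"
    using form_pl_integrable[OF b.psd_form_axioms pl2 u m] by (intro set_integrable_mult_right)
  note i2 = \<xi>_const_integrable[OF m, of "b u (Z2 T)"] and i3 = rate_memory_integrable[OF u m]
  note i12 = set_integral_diff(1)[OF i1 i2]
  show "set_integrable lborel (I m) (memory u)"
  proof -
    have "set_integrable lborel (I m) (memory u) \<longleftrightarrow>
      set_integrable lborel (I m) (\<lambda>t. \<kappa> * b u (Z2 t) - mk.\<xi> (T - t) * b u (Z2 T) + rate_memory u t)"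
      by (intro set_integrable_cong refl eq)
    with set_integral_add(1)[OF i12 i3] show ?thesis by blast
  qed
  have "(LINT t:I m|lborel. memory u t)
      = (LINT t:I m|lborel. \<kappa> * b u (Z2 t) - mk.\<xi> (T - t) * b u (Z2 T) + rate_memory u t)"
    by (intro set_lebesgue_integral_cong) (auto intro!: eq)
  also have "\<dots> = \<kappa> * (LINT t:I m|lborel. b u (Z2 t))
      - (LINT t:I m|lborel. mk.\<xi> (T - t) * b u (Z2 T)) + (LINT t:I m|lborel. rate_memory u t)"
    by (simp only: set_integral_add(2)[OF i12 i3] set_integral_diff(2)[OF i1 i2] set_integral_mult_right)
  finally show "(LINT t:I m|lborel. memory u t) = \<kappa> * (LINT t:I m|lborel. b u (Z2 t))
      - (LINT t:I m|lborel. mk.\<xi> (T - t) * b u (Z2 T)) + (LINT t:I m|lborel. rate_memory u t)" .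
qed

lemma const_integral: "m \<in> {1..N} \<Longrightarrow> (LINT t:I m|lborel. c) = (\<tau> m - \<tau> (m - 1)) * (c::real)"
  using affine_integral[of "\<tau> (m - 1)" "\<tau> m" c 0] step_less[of m] by simp

lemma const_integrable: "set_integrable lborel (I m) (\<lambda>t. c::real)"
proof (rule set_integrable_subset)
  show "set_integrable lborel {\<tau> (m - 1)..\<tau> m} (\<lambda>t. c)" by (rule set_integrable_bounded[of _ _ _ "\<bar>c\<bar>"]) auto
qed auto

text \<open>Tested with \<open>\<Lambda> u\<close>, the L2 products become s and the form
  \<open>a\<close> becomes b. The load enters through its mean, because the test function is
  constant in time on the interval.\<close>

lemma equation1:
  assumes m: "m \<in> {1..N}" and u: "u \<in> V m"
  shows "- ((\<tau> m - \<tau> (m - 1)) * s u (d1 m)) + (LINT t:I m|lborel. b u (Z2 t)) - (LINT t:I m|lborel. memory u t)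
    = (\<tau> m - \<tau> (m - 1)) * s u (p1 m)"
proof -
  have mN: "m \<le> N" using m by simp
  have uW: "u \<in> W" by (rule V_W[OF mN u])
  have y: "\<Lambda> u \<in> V m" by (rule \<Lambda>_mem[OF mN u])
  note ib = form_pl_integrable[OF b.psd_form_axioms pl2 uW m]
  note im = memory_integral(1)[OF uW m]
  note ic = const_integrable[of m "- s u (d1 m)"]
  have "(LINT t:I m|lborel. - ip P (\<Lambda> u) (tderiv Z1 t) + a (\<Lambda> u) (Z2 t) - (LINT r:{t..T}|lborel. kern P (r - t) * a (\<Lambda> u) (Z2 r)))
      = (LINT t:I m|lborel. - s u (d1 m) + b u (Z2 t) - memory u t)"
    by (intro set_lebesgue_integral_cong) (auto simp: tderiv_pl[OF pl1 m] s_def b_def memory_def)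
  also have "\<dots> = (LINT t:I m|lborel. - s u (d1 m)) + (LINT t:I m|lborel. b u (Z2 t)) - (LINT t:I m|lborel. memory u t)"
    by (simp only: set_integral_diff(2)[OF set_integral_add(1)[OF ic ib] im] set_integral_add(2)[OF ic ib])
  also have "(LINT t:I m|lborel. - s u (d1 m)) = - ((\<tau> m - \<tau> (m - 1)) * s u (d1 m))"
    unfolding const_integral[OF m] by simp
  also have "(LINT t:I m|lborel. - ip P (\<Lambda> u) (tderiv Z1 t) + a (\<Lambda> u) (Z2 t) - (LINT r:{t..T}|lborel. kern P (r - t) * a (\<Lambda> u) (Z2 r)))
      = (LINT t:I m|lborel. ip P (j1 t) (\<Lambda> u))"
    unfolding tested1[OF m y] by (simp add: ip_def L2_inner_commute)
  also have "\<dots> = (\<tau> m - \<tau> (m - 1)) * s u (p1 m)"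
    unfolding load_mean_ip[OF data(3) m y] by (simp add: s_def ip_def L2_inner_commute)
  finally show ?thesis by simp
qed

lemma equation2:
  assumes m: "m \<in> {1..N}" and u: "u \<in> V m"
  shows "(\<tau> m - \<tau> (m - 1)) * (s u (d2 m) + s u (p2 m)) = - (LINT t:I m|lborel. s u (Z1 t))"
proof -
  have mN: "m \<le> N" using m by simp
  have uW: "u \<in> W" by (rule V_W[OF mN u])
  have y: "\<Lambda> u \<in> V m" by (rule \<Lambda>_mem[OF mN u])
  note int_s = form_pl_integrable[OF s.psd_form_axioms pl1 uW m]
  have "(LINT t:I m|lborel. - ip P (\<Lambda> u) (tderiv Z2 t) - ip P (\<Lambda> u) (Z1 t)) = (LINT t:I m|lborel. - s u (d2 m) - s u (Z1 t))"
    by (intro set_lebesgue_integral_cong) (auto simp: tderiv_pl[OF pl2 m] s_def)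
  also have "\<dots> = (\<tau> m - \<tau> (m - 1)) * (- s u (d2 m)) - (LINT t:I m|lborel. s u (Z1 t))"
    by (simp only: set_integral_diff(2)[OF const_integrable int_s] const_integral[OF m])
  also have "(LINT t:I m|lborel. - ip P (\<Lambda> u) (tderiv Z2 t) - ip P (\<Lambda> u) (Z1 t)) = (LINT t:I m|lborel. ip P (j2 t) (\<Lambda> u))"
    unfolding tested2[OF m y] by (simp add: ip_def L2_inner_commute)
  also have "\<dots> = (\<tau> m - \<tau> (m - 1)) * s u (p2 m)"
    unfolding load_mean_ip[OF data(4) m y] by (simp add: s_def ip_def L2_inner_commute)
  finally show ?thesis by (simp add: algebra_simps)
qed

text \<open>The integral is given by the trapezoidal rule, the slope is a difference quotient of
  node values, and symmetry cancels the mixed products.\<close>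

lemma telescope:
  assumes g: "psd_form W g" and U: "pl U" and m: "m \<in> {1..N}"
  shows "(LINT t:I m|lborel. g (slope U m) (U t)) = (g (U (\<tau> m)) (U (\<tau> m)) - g (U (\<tau> (m - 1))) (U (\<tau> (m - 1)))) / 2"
proof -
  interpret psd_form W g by (rule g)
  let ?k = "\<tau> m - \<tau> (m - 1)"
  have W: "U (\<tau> m) \<in> W" "U (\<tau> (m - 1)) \<in> W" "slope U m \<in> W"
    using pl_nodes_mem[OF U m] slope_mem[OF U m] V_W[of m] m by auto
  have sl: "?k * g (slope U m) w = g (U (\<tau> m)) w - g (U (\<tau> (m - 1))) w" if "w \<in> W" for w
    using step_less[OF m] W that unfolding slope_def by (simp add: form_scale_left form_diff_left mem_diff)
  have "(LINT t:I m|lborel. g (slope U m) (U t))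
      = (?k * g (slope U m) (U (\<tau> (m - 1))) + ?k * g (slope U m) (U (\<tau> m))) / 2"
  proof -
    have "k / 2 * (A + B) = (k * A + k * B) / 2" for k A B :: real by (simp add: field_simps)
    then show ?thesis unfolding form_pl_integral[OF g U W(3) m] .
  qed
  then show ?thesis unfolding sl[OF W(1)] sl[OF W(2)] using form_sym[OF W(1,2)] by simp
qed

definition energy :: "nat \<Rightarrow> real" where
  "energy n = s (Z1 (\<tau> n)) (Z1 (\<tau> n)) + (1 - \<kappa>) * b (Z2 (\<tau> n)) (Z2 (\<tau> n))"

text \<open>\<open>memory_parts\<close> leaves \<xi>(T - t) times b of the slope and Z2(T).
  Integrating by parts in t exchanges the slope for Z2 itself, with weight K(T - t), and produces
  node values that telescope.\<close>

lemma K_integral: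
  assumes m: "m \<in> {1..N}"
  shows "set_integrable lborel (I m) (\<lambda>t. kern P (T - t) * b (Z2 T) (Z2 t))"
    and "(LINT t:I m|lborel. kern P (T - t) * b (Z2 T) (Z2 t))
      = mk.\<xi> (T - \<tau> m) * b (Z2 T) (Z2 (\<tau> m)) - mk.\<xi> (T - \<tau> (m - 1)) * b (Z2 T) (Z2 (\<tau> (m - 1)))
        - (LINT t:I m|lborel. mk.\<xi> (T - t) * b (Z2 T) (d2 m))"
proof -
  let ?c = "\<tau> (m - 1)" and ?d = "\<tau> m"
  have cont: "continuous_on {?c..?d} (\<lambda>t. b (Z2 T) (Z2 t))"
    by (rule continuous_on_subset[OF form_pl_continuous[OF b.psd_form_axioms pl2 Z2_T_W] closed_I_subset[OF m]])
  have dT: "?d \<le> T" using m by (intro \<tau>_le) auto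
  show "set_integrable lborel (I m) (\<lambda>t. kern P (T - t) * b (Z2 T) (Z2 t))"
    by (rule set_integrable_subset[OF mk.K_reflect_integrable[OF cont dT]]) auto
  have open_closed: "(LINT t:I m|lborel. f t) = (LINT t:{?c..?d}|lborel. f t)" for f :: "real \<Rightarrow> real"
    by (rule set_integral_cong_finite(1)[of "{?c, ?d}"]) auto
  show "(LINT t:I m|lborel. kern P (T - t) * b (Z2 T) (Z2 t))
      = mk.\<xi> (T - \<tau> m) * b (Z2 T) (Z2 (\<tau> m)) - mk.\<xi> (T - \<tau> (m - 1)) * b (Z2 T) (Z2 (\<tau> (m - 1)))
        - (LINT t:I m|lborel. mk.\<xi> (T - t) * b (Z2 T) (d2 m))"
    unfolding open_closed
    by (rule mk.terminal_by_parts[OF _ dT cont, of "\<lambda>_. b (Z2 T) (d2 m)" "\<bar>b (Z2 T) (d2 m)\<bar>"])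
      (use step_less[OF m] form_pl_deriv[OF b.psd_form_axioms pl2 Z2_T_W m] in auto)
qed

text \<open>The first equation is tested with \<open>\<Lambda> (d2 m)\<close> and \<open>\<Lambda> (p2 m)\<close>; the second one identifies \<open>d2 m + p2 m\<close> with
  minus the mean of \<open>Z1\<close>.\<close>

lemma energy_step:
  assumes m: "m \<in> {1..N}"
  shows "energy (m - 1) + 2 * (LINT t:I m|lborel. rate_memory (d2 m) t)
    = energy m + 2 * (LINT t:I m|lborel. s (p1 m) (Z1 t)) + 2 * (LINT t:I m|lborel. b (p2 m) (Z2 t))
      - 2 * (LINT t:I m|lborel. memory (p2 m) t) - 2 * (LINT t:I m|lborel. kern P (T - t) * b (Z2 T) (Z2 t))
      + 2 * (mk.\<xi> (T - \<tau> m) * b (Z2 T) (Z2 (\<tau> m)) - mk.\<xi> (T - \<tau> (m - 1)) * b (Z2 T) (Z2 (\<tau> (m - 1))))"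
proof -
  let ?k = "\<tau> m - \<tau> (m - 1)"
  have mem: "d1 m \<in> V m" "d2 m \<in> V m" "p1 m \<in> V m" "p2 m \<in> V m"
    using slope_mem[OF pl1 m] slope_mem[OF pl2 m] load_mean_mem[OF data(3) m] load_mean_mem[OF data(4) m] by auto
  have memW: "d1 m \<in> W" "d2 m \<in> W" "p1 m \<in> W" "p2 m \<in> W"
    using slope_W[OF m] mean_W[OF m] by auto
  have e1: "?k * s (d2 m) (d1 m) + ?k * s (p2 m) (d1 m) = - (LINT t:I m|lborel. s (d1 m) (Z1 t))"
    using equation2[OF m mem(1)] s.form_sym[OF memW(1,2)] s.form_sym[OF memW(1,4)] by (simp add: algebra_simps)
  have e2: "?k * s (d2 m) (p1 m) + ?k * s (p2 m) (p1 m) = - (LINT t:I m|lborel. s (p1 m) (Z1 t))"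
    using equation2[OF m mem(3)] s.form_sym[OF memW(3,2)] s.form_sym[OF memW(3,4)] by (simp add: algebra_simps)
  have c: "(LINT t:I m|lborel. mk.\<xi> (T - t) * b (Z2 T) (d2 m)) = (LINT t:I m|lborel. mk.\<xi> (T - t) * b (d2 m) (Z2 T))"
    using b.form_sym[OF Z2_T_W memW(2)] by simp
  have split: "(LINT t:I m|lborel. memory (d2 m) t) = \<kappa> * (LINT t:I m|lborel. b (d2 m) (Z2 t))
      - (LINT t:I m|lborel. mk.\<xi> (T - t) * b (d2 m) (Z2 T)) + (LINT t:I m|lborel. rate_memory (d2 m) t)"
    by (rule memory_integral(2)[OF memW(2) m])
  have \<kappa>b: "\<kappa> * (LINT t:I m|lborel. b (d2 m) (Z2 t))
    = (\<kappa> * b (Z2 (\<tau> m)) (Z2 (\<tau> m)) - \<kappa> * b (Z2 (\<tau> (m - 1))) (Z2 (\<tau> (m - 1)))) / 2"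
    unfolding telescope[OF b.psd_form_axioms pl2 m] by (simp add: algebra_simps)
  have balance: "(LINT t:I m|lborel. s (d1 m) (Z1 t)) + (LINT t:I m|lborel. b (d2 m) (Z2 t)) - (LINT t:I m|lborel. memory (d2 m) t)
      + (LINT t:I m|lborel. b (p2 m) (Z2 t)) - (LINT t:I m|lborel. memory (p2 m) t) = - (LINT t:I m|lborel. s (p1 m) (Z1 t))"
    using equation1[OF m mem(2)] equation1[OF m mem(4)] e1 e2 by linarith
  show ?thesis
    using balance split[unfolded \<kappa>b] K_integral(2)[OF m, unfolded c]
    unfolding energy_def left_diff_distrib mult_1 telescope[OF s.psd_form_axioms pl1 m] telescope[OF b.psd_form_axioms pl2 m]
    by argo
qed

lemma energy_sum:
  assumes "n \<le> N"
  shows "energy n + 2 * (\<Sum>m\<in>{n+1..N}. LINT t:I m|lborel. rate_memory (d2 m) t)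
    = s (Z1 T) (Z1 T) + (1 + \<kappa>) * b (Z2 T) (Z2 T)
      + 2 * (\<Sum>m\<in>{n+1..N}. LINT t:I m|lborel. s (p1 m) (Z1 t))
      + 2 * (\<Sum>m\<in>{n+1..N}. LINT t:I m|lborel. b (p2 m) (Z2 t))
      - 2 * (\<Sum>m\<in>{n+1..N}. LINT t:I m|lborel. memory (p2 m) t)
      - 2 * (\<Sum>m\<in>{n+1..N}. LINT t:I m|lborel. kern P (T - t) * b (Z2 T) (Z2 t))
      - 2 * mk.\<xi> (T - \<tau> n) * b (Z2 T) (Z2 (\<tau> n))"
  using assms
proof (induction rule: inc_induct)
  case base
  \<comment> \<open>At n = N the last term is 2 \<kappa> b(Z2(T), Z2(T)), because \<xi>(0) =
    \<kappa>. This is where the factor 1 - \<kappa> of the energy meets the factor 1 + \<kappa> of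
    the right-hand side.\<close>
  show ?case by (simp add: energy_def mk.\<xi>_zero algebra_simps)
next
  case (step n)
  have ins: "{n+1..N} = insert (Suc n) {Suc n + 1..N}" using step by auto
  have sums: "(\<Sum>m\<in>{n+1..N}. f m) = f (Suc n) + (\<Sum>m\<in>{Suc n+1..N}. f m)" for f :: "nat \<Rightarrow> real"
    unfolding ins by (rule sum.insert) auto
  have "energy n + 2 * (LINT t:I (Suc n)|lborel. rate_memory (d2 (Suc n)) t)
    = energy (Suc n) + 2 * (LINT t:I (Suc n)|lborel. s (p1 (Suc n)) (Z1 t)) + 2 * (LINT t:I (Suc n)|lborel. b (p2 (Suc n)) (Z2 t))
      - 2 * (LINT t:I (Suc n)|lborel. memory (p2 (Suc n)) t) - 2 * (LINT t:I (Suc n)|lborel. kern P (T - t) * b (Z2 T) (Z2 t))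
      + 2 * (mk.\<xi> (T - \<tau> (Suc n)) * b (Z2 T) (Z2 (\<tau> (Suc n))) - mk.\<xi> (T - \<tau> n) * b (Z2 T) (Z2 (\<tau> n)))"
    using energy_step[of "Suc n"] step by simp
  with step.IH show ?case unfolding sums by (simp add: algebra_simps)
qed

subsection \<open>Stability\<close>

text \<open>The kernel is extended by \<open>max 0\<close> to a continuous function on the whole
  line, as \<open>convex_kernel_positive_type\<close> demands; on the triangle of integration this
  changes nothing.\<close>

lemma rate_memory_sum_nonneg:
  assumes "n < N"
  shows "0 \<le> (\<Sum>m\<in>{n+1..N}. LINT t:I m|lborel. rate_memory (d2 m) t)"
proof -
  have "0 \<le> (LINT t:{\<tau> n..T}|lborel. LINT r:{t..T}|lborel. mk.\<xi> (max 0 (r - t)) * b (rate t) (rate r))"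
  proof (rule b.convex_kernel_positive_type[where S = "{1..N}" and D = "\<tau> ` {..N}" and I = I and c = d2 and \<kappa> = \<kappa>])
    show "\<tau> n < T" using assms by (rule \<tau>_less) simp
    show "continuous_on UNIV (\<lambda>x. mk.\<xi> (max 0 x))" by (rule mk.\<xi>_continuous)
    show "mk.\<xi> (max 0 (x + h)) \<le> mk.\<xi> (max 0 x)" if "0 \<le> x" "0 \<le> h" for x h
      using mk.\<xi>_antimono[of x "x + h"] that by simp
    show "2 * mk.\<xi> (max 0 (x + h)) \<le> mk.\<xi> (max 0 x) + mk.\<xi> (max 0 (x + 2 * h))" if "0 \<le> x" "0 \<le> h" for x h
      using mk.\<xi>_convex[OF that] that by simp
    show "{\<tau> n..T} \<subseteq> (\<Union>m\<in>{1..N}. I m) \<union> \<tau> ` {..N}"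
      using grid_cover[of n N] assms by fastforce
    show "rate = (\<lambda>t. \<Sum>m\<in>{1..N}. indicat_real (I m) t *\<^sub>R d2 m)" by (rule rate_def)
    show "m = k" if "m \<in> {1..N}" "k \<in> {1..N}" "t \<in> I m" "t \<in> I k" for m k t
      using that by (rule I_disjoint)
  qed (use slope_W mk.\<xi>_nonneg mk.\<xi>_le in auto)
  also have "(LINT t:{\<tau> n..T}|lborel. LINT r:{t..T}|lborel. mk.\<xi> (max 0 (r - t)) * b (rate t) (rate r))
      = (LINT t:{\<tau> n..T}|lborel. rate_memory (rate t) t)"
    unfolding rate_memory_def by (intro set_lebesgue_integral_cong allI impI) (auto simp: max_def intro!: set_lebesgue_integral_cong)
  also have "\<dots> = (\<Sum>m\<in>{n+1..N}. LINT t:I m|lborel. rate_memory (rate t) t)"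
  proof (rule split_integral[THEN conjunct2])
    fix m assume "m \<in> {n+1..N}"
    then have m: "m \<in> {1..N}" by auto
    show "set_integrable lborel (I m) (\<lambda>t. rate_memory (rate t) t)"
      using rate_memory_integrable[OF _ m, of "d2 m"] slope_W[OF m] rate_eq[OF m]
      by (subst set_integrable_cong[OF refl refl, of _ _ "rate_memory (d2 m)"]) auto
  qed (use assms in auto)
  also have "\<dots> = (\<Sum>m\<in>{n+1..N}. LINT t:I m|lborel. rate_memory (d2 m) t)"
  proof (intro sum.cong refl set_lebesgue_integral_cong allI impI)
    fix m t assume "m \<in> {n+1..N}" and t: "t \<in> I m"
    then have "m \<in> {1..N}" by auto
    from rate_eq[OF this t] show "rate_memory (rate t) t = rate_memory (d2 m) t" by simp
  qed simp
  finally show ?thesis .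
qed

text \<open>Between two nodes U is a convex combination of its node values.\<close>

lemma pl_norm_le:
  assumes g: "psd_form W g" and U: "pl U" and m: "m \<in> {1..N}" and t: "t \<in> {\<tau> (m - 1)..\<tau> m}"
    and M: "sqrt (g (U (\<tau> (m - 1))) (U (\<tau> (m - 1)))) \<le> M" "sqrt (g (U (\<tau> m)) (U (\<tau> m))) \<le> M"
  shows "sqrt (g (U t) (U t)) \<le> M"
proof -
  interpret psd_form W g by (rule g)
  define \<theta> where "\<theta> = (t - \<tau> (m - 1)) / (\<tau> m - \<tau> (m - 1))"
  have \<theta>: "0 \<le> \<theta>" "\<theta> \<le> 1" using t step_less[OF m] by (auto simp: \<theta>_def divide_le_eq_1)
  have W: "U (\<tau> m) \<in> W" "U (\<tau> (m - 1)) \<in> W" using pl_nodes_mem[OF U m] V_W[of m] m by auto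
  have "U t = U (\<tau> (m - 1)) + \<theta> *\<^sub>R (U (\<tau> m) - U (\<tau> (m - 1)))"
    by (subst pl_linear[OF U m t]) (simp add: slope_def \<theta>_def)
  also have "\<dots> = (1 - \<theta>) *\<^sub>R U (\<tau> (m - 1)) + \<theta> *\<^sub>R U (\<tau> m)"
    by (simp add: algebra_simps)
  finally have "sqrt (g (U t) (U t)) \<le> sqrt (g ((1 - \<theta>) *\<^sub>R U (\<tau> (m - 1))) ((1 - \<theta>) *\<^sub>R U (\<tau> (m - 1))))
      + sqrt (g (\<theta> *\<^sub>R U (\<tau> m)) (\<theta> *\<^sub>R U (\<tau> m)))"
    using triangle[OF mem_scale[OF W(2)] mem_scale[OF W(1)]] by simp
  also have "\<dots> = (1 - \<theta>) * sqrt (g (U (\<tau> (m - 1))) (U (\<tau> (m - 1)))) + \<theta> * sqrt (g (U (\<tau> m)) (U (\<tau> m)))"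
    using \<theta> unfolding norm_scale[OF W(1)] norm_scale[OF W(2)] by simp
  also have "\<dots> \<le> (1 - \<theta>) * M + \<theta> * M" using \<theta> M by (intro add_mono mult_left_mono) auto
  finally show ?thesis by (simp add: algebra_simps)
qed

lemma form_integral_le:
  assumes g: "psd_form W g" and U: "pl U" and u: "u \<in> W" and m: "m \<in> {1..N}"
    and M: "\<And>t. t \<in> I m \<Longrightarrow> sqrt (g (U t) (U t)) \<le> M"
  shows "(LINT t:I m|lborel. g u (U t)) \<le> (\<tau> m - \<tau> (m - 1)) * sqrt (g u u) * M"
proof -
  interpret psd_form W g by (rule g)
  have "(LINT t:I m|lborel. g u (U t)) \<le> (LINT t:I m|lborel. sqrt (g u u) * M)"
  proof (rule set_integral_mono[OF form_pl_integrable[OF g U u m] const_integrable])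
    fix t assume t: "t \<in> I m"
    have UW: "U t \<in> W" using pl_mem_W[OF U] I_subset[OF m] t by blast
    have "g u (U t) \<le> sqrt (g u u) * sqrt (g (U t) (U t))" using cauchy_schwarz[OF u UW] by linarith
    also have "\<dots> \<le> sqrt (g u u) * M" using M[OF t] form_nonneg[OF u] by (intro mult_left_mono) auto
    finally show "g u (U t) \<le> sqrt (g u u) * M" .
  qed
  then show ?thesis unfolding const_integral[OF m] by (simp add: mult.assoc)
qed

lemma memory_ge:
  assumes u: "u \<in> W" and t: "t \<in> {0..T}" and M: "\<And>r. r \<in> {t..T} \<Longrightarrow> sqrt (b (Z2 r) (Z2 r)) \<le> M"
  shows "- (\<kappa> * (sqrt (b u u) * M)) \<le> memory u t"
proof -
  let ?c = "sqrt (b u u) * M"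
  have tT: "t \<le> T" using t by simp
  have "b (Z2 T) (Z2 T) \<ge> 0" by (rule b.form_nonneg[OF Z2_T_W])
  then have M0: "0 \<le> M" using M[of T] tT order_trans[OF real_sqrt_ge_zero] by auto
  have c: "0 \<le> ?c" using M0 b.form_nonneg[OF u] by simp
  \<comment> \<open>\<open>memory_by_parts\<close> with a constant function evaluates the integral
    of K(r - t) over r in (t, T) as \<kappa> - \<xi>(T - t), which is at most \<kappa>.\<close>
  have "(LINT r:{t..T}|lborel. kern P (r - t) * (- ?c)) = \<kappa> * (- ?c) - mk.\<xi> (T - t) * (- ?c) + (LINT r:{t..T}|lborel. mk.\<xi> (r - t) * 0)"
    by (rule mk.memory_by_parts[of _ _ _ "{}" _ 0]) (use tT in auto)
  then have "- (\<kappa> * ?c) \<le> (LINT r:{t..T}|lborel. kern P (r - t) * (- ?c))"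
    using mk.\<xi>_nonneg[of "T - t"] c tT by simp
  also have "\<dots> \<le> memory u t"
    unfolding memory_def
  proof (rule set_integral_mono_AE)
    show "set_integrable lborel {t..T} (\<lambda>r. kern P (r - t) * (- ?c))"
      by (intro mk.K_shift_integrable continuous_intros)
    show "set_integrable lborel {t..T} (\<lambda>r. kern P (r - t) * b u (Z2 r))"
      by (rule mk.K_shift_integrable, rule continuous_on_subset[OF form_pl_continuous[OF b.psd_form_axioms pl2 u]])
        (use t in auto)
    have "AE r in lborel. r \<noteq> t" by (rule AE_lborel_singleton)
    then show "AE r\<in>{t..T} in lborel. kern P (r - t) * (- ?c) \<le> kern P (r - t) * b u (Z2 r)"
    proof eventually_elim
      case (elim r)
      show ?case
      proof
        assume r: "r \<in> {t..T}"
        have rW: "Z2 r \<in> W" using Z_W r t by auto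
        have "- b u (Z2 r) \<le> sqrt (b u u) * sqrt (b (Z2 r) (Z2 r))" using b.cauchy_schwarz[OF u rW] by linarith
        also have "\<dots> \<le> ?c" using M[OF r] b.form_nonneg[OF u] by (intro mult_left_mono) auto
        finally show "kern P (r - t) * (- ?c) \<le> kern P (r - t) * b u (Z2 r)"
          using r elim mk.K_nonneg[of "r - t"] by (intro mult_left_mono) auto
      qed
    qed
  qed
  finally show ?thesis .
qed

lemma stability:
  assumes n: "n \<le> N"
  shows "sqrt (s (Z1 (\<tau> n)) (Z1 (\<tau> n))) + sqrt (b (Z2 (\<tau> n)) (Z2 (\<tau> n)))
    \<le> 12 / (1 - \<kappa>) * (sqrt (s (Z1 T) (Z1 T)) + sqrt (b (Z2 T) (Z2 T))
      + (\<Sum>m\<in>{n+1..N}. (LINT t:I m|lborel. sqrt (s (Ph P t (j1 t)) (Ph P t (j1 t))))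
          + (LINT t:I m|lborel. sqrt (b (Ph P t (j2 t)) (Ph P t (j2 t))))))"
proof -
  define X Y where "X m = sqrt (s (Z1 (\<tau> m)) (Z1 (\<tau> m)))" and "Y m = sqrt (b (Z2 (\<tau> m)) (Z2 (\<tau> m)))" for m
  define S1 S2 where "S1 m = (LINT t:I m|lborel. sqrt (s (Ph P t (j1 t)) (Ph P t (j1 t))))"
    and "S2 m = (LINT t:I m|lborel. sqrt (b (Ph P t (j2 t)) (Ph P t (j2 t))))" for m
  have nodeW: "Z1 (\<tau> m) \<in> W" "Z2 (\<tau> m) \<in> W" if "m \<le> N" for m
    using pl_node[OF pl1 that] pl_node[OF pl2 that] V_W[OF that] by auto
  have XY0: "0 \<le> X m" "0 \<le> Y m" if "m \<le> N" for m
    unfolding X_def Y_def using nodeW[OF that] by (auto intro: s.form_nonneg b.form_nonneg)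
  have XY2: "(X m)\<^sup>2 = s (Z1 (\<tau> m)) (Z1 (\<tau> m))" "(Y m)\<^sup>2 = b (Z2 (\<tau> m)) (Z2 (\<tau> m))" if "m \<le> N" for m
    unfolding X_def Y_def using nodeW[OF that] by (auto intro: s.form_nonneg b.form_nonneg)
  have SS: "(\<tau> m - \<tau> (m - 1)) * sqrt (s (p1 m) (p1 m)) \<le> S1 m" "(\<tau> m - \<tau> (m - 1)) * sqrt (b (p2 m) (p2 m)) \<le> S2 m"
    "0 \<le> S1 m" "0 \<le> S2 m" if m: "m \<in> {1..N}" for m
  proof -
    show 1: "(\<tau> m - \<tau> (m - 1)) * sqrt (s (p1 m) (p1 m)) \<le> S1 m"
      unfolding S1_def by (rule load_mean_norm[OF data(3) m s.psd_form_axioms])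
    show 2: "(\<tau> m - \<tau> (m - 1)) * sqrt (b (p2 m) (p2 m)) \<le> S2 m"
      unfolding S2_def by (rule load_mean_norm[OF data(4) m b.psd_form_axioms])
    have "0 \<le> (\<tau> m - \<tau> (m - 1)) * sqrt (s (p1 m) (p1 m))" "0 \<le> (\<tau> m - \<tau> (m - 1)) * sqrt (b (p2 m) (p2 m))"
      using step_less[OF m] mean_W[OF m] s.form_nonneg b.form_nonneg by auto
    with 1 2 show "0 \<le> S1 m" "0 \<le> S2 m" by linarith+
  qed
  \<comment> \<open>The maximum is taken over n..N: the identity at q then involves the solution
    only at times from node q on, where M bounds both norms.\<close>
  obtain q where q: "q \<in> {n..N}" and qmax: "\<And>m. m \<in> {n..N} \<Longrightarrow> X m + Y m \<le> X q + Y q"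
  proof -
    have ne: "finite ((\<lambda>m. X m + Y m) ` {n..N})" "(\<lambda>m. X m + Y m) ` {n..N} \<noteq> {}" using n by auto
    from Max_in[OF this] obtain q where q: "q \<in> {n..N}" "Max ((\<lambda>m. X m + Y m) ` {n..N}) = X q + Y q" by blast
    show thesis
    proof (rule that[OF q(1)])
      fix m assume "m \<in> {n..N}"
      then show "X m + Y m \<le> X q + Y q" unfolding q(2)[symmetric] by (intro Max_ge[OF ne(1)] imageI)
    qed
  qed
  define M where "M = X q + Y q"
  have node_le: "X m \<le> M" "Y m \<le> M" if "m \<in> {q..N}" for m
    using qmax[of m] XY0[of m] that q unfolding M_def by auto
  have Z_le: "sqrt (s (Z1 t) (Z1 t)) \<le> M" "sqrt (b (Z2 t) (Z2 t)) \<le> M" if t: "t \<in> {\<tau> q..T}" for t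
  proof -
    have "t \<in> (\<Union>k\<in>{q+1..N}. I k) \<union> \<tau> ` {..N}"
      by (rule subsetD[OF grid_cover]) (use q t in simp_all)
    then consider k where "k \<in> {q+1..N}" "t \<in> I k" | k where "k \<le> N" "t = \<tau> k" by auto
    then have "sqrt (s (Z1 t) (Z1 t)) \<le> M \<and> sqrt (b (Z2 t) (Z2 t)) \<le> M"
    proof cases
      case (1 k)
      then have k: "k \<in> {1..N}" "t \<in> {\<tau> (k - 1)..\<tau> k}" and kq: "k - 1 \<in> {q..N}" "k \<in> {q..N}" by auto
      show ?thesis
        using pl_norm_le[OF s.psd_form_axioms pl1 k] pl_norm_le[OF b.psd_form_axioms pl2 k]
          node_le[OF kq(1)] node_le[OF kq(2)] unfolding X_def Y_def by blast
    next
      case (2 k)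
      have "q \<le> k"
      proof (rule ccontr)
        assume "\<not> q \<le> k"
        then have "\<tau> k < \<tau> q" using q by (intro \<tau>_less) auto
        with 2 t show False by simp
      qed
      then show ?thesis using node_le[of k] 2 unfolding X_def Y_def by simp
    qed
    then show "sqrt (s (Z1 t) (Z1 t)) \<le> M" "sqrt (b (Z2 t) (Z2 t)) \<le> M" by auto
  qed
  have M0: "0 \<le> M" using XY0[of q] q unfolding M_def by auto
  have I_sub: "t \<in> {\<tau> q..T}" "t \<in> {0..T}" if "m \<in> {q+1..N}" "t \<in> I m" for m t
  proof -
    have "\<tau> q \<le> \<tau> (m - 1)" "\<tau> m \<le> T" "0 \<le> \<tau> q" using that q by (auto intro!: \<tau>_le \<tau>_nonneg)
    then show "t \<in> {\<tau> q..T}" "t \<in> {0..T}" using that by auto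
  qed
  let ?Q = "{q+1..N}"
  have Q: "m \<in> {1..N}" if "m \<in> ?Q" for m using that by auto
  have B1: "(\<Sum>m\<in>?Q. LINT t:I m|lborel. s (p1 m) (Z1 t)) \<le> M * (\<Sum>m\<in>?Q. S1 m)"
    unfolding sum_distrib_left
  proof (rule sum_mono)
    fix m assume m: "m \<in> ?Q"
    have "(LINT t:I m|lborel. s (p1 m) (Z1 t)) \<le> (\<tau> m - \<tau> (m - 1)) * sqrt (s (p1 m) (p1 m)) * M"
      using mean_W[OF Q[OF m]] Z_le(1)[OF I_sub(1)[OF m]]
      by (intro form_integral_le[OF s.psd_form_axioms pl1 _ Q[OF m]]) auto
    also have "\<dots> \<le> S1 m * M" by (rule mult_right_mono[OF SS(1)[OF Q[OF m]] M0])
    finally show "(LINT t:I m|lborel. s (p1 m) (Z1 t)) \<le> M * S1 m" by (simp add: mult.commute)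
  qed
  have B2: "(\<Sum>m\<in>?Q. LINT t:I m|lborel. b (p2 m) (Z2 t)) \<le> M * (\<Sum>m\<in>?Q. S2 m)"
    unfolding sum_distrib_left
  proof (rule sum_mono)
    fix m assume m: "m \<in> ?Q"
    have "(LINT t:I m|lborel. b (p2 m) (Z2 t)) \<le> (\<tau> m - \<tau> (m - 1)) * sqrt (b (p2 m) (p2 m)) * M"
      using mean_W[OF Q[OF m]] Z_le(2)[OF I_sub(1)[OF m]]
      by (intro form_integral_le[OF b.psd_form_axioms pl2 _ Q[OF m]]) auto
    also have "\<dots> \<le> S2 m * M" by (rule mult_right_mono[OF SS(2)[OF Q[OF m]] M0])
    finally show "(LINT t:I m|lborel. b (p2 m) (Z2 t)) \<le> M * S2 m" by (simp add: mult.commute)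
  qed
  have B3: "- (\<kappa> * (M * (\<Sum>m\<in>?Q. S2 m))) \<le> (\<Sum>m\<in>?Q. LINT t:I m|lborel. memory (p2 m) t)"
    unfolding sum_distrib_left sum_negf[symmetric]
  proof (rule sum_mono)
    fix m assume m: "m \<in> ?Q"
    have pW: "p2 m \<in> W" using mean_W[OF Q[OF m]] by simp
    have "\<kappa> * M * ((\<tau> m - \<tau> (m - 1)) * sqrt (b (p2 m) (p2 m))) \<le> \<kappa> * M * S2 m"
      using SS(2)[OF Q[OF m]] M0 \<kappa>_bounds by (intro mult_left_mono) auto
    then have "- (\<kappa> * (M * S2 m)) \<le> (\<tau> m - \<tau> (m - 1)) * - (\<kappa> * (sqrt (b (p2 m) (p2 m)) * M))"
      by (simp add: algebra_simps)
    also have "\<dots> = (LINT t:I m|lborel. - (\<kappa> * (sqrt (b (p2 m) (p2 m)) * M)))" by (rule const_integral[OF Q[OF m], symmetric])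
    also have "\<dots> \<le> (LINT t:I m|lborel. memory (p2 m) t)"
    proof (rule set_integral_mono[OF const_integrable memory_integral(1)[OF pW Q[OF m]]])
      fix t assume t: "t \<in> I m"
      show "- (\<kappa> * (sqrt (b (p2 m) (p2 m)) * M)) \<le> memory (p2 m) t"
        using Z_le(2) I_sub(1)[OF m t] by (intro memory_ge[OF pW I_sub(2)[OF m t]]) auto
    qed
    finally show "- (\<kappa> * (M * S2 m)) \<le> (LINT t:I m|lborel. memory (p2 m) t)" .
  qed
  let ?c = "Y N * M"
  have c0: "0 \<le> ?c" using XY0(2)[of N] M0 by simp
  have bT: "- ?c \<le> b (Z2 T) (Z2 t)" if t: "t \<in> {\<tau> q..T}" for t
  proof -
    have "t \<in> {0..T}" using t \<tau>_nonneg[of q] q by auto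
    then have tW: "Z2 t \<in> W" using Z_W by blast
    have "- b (Z2 T) (Z2 t) \<le> Y N * sqrt (b (Z2 t) (Z2 t))"
      using b.cauchy_schwarz[OF Z2_T_W tW] unfolding Y_def by linarith
    also have "\<dots> \<le> ?c" using Z_le(2)[OF t] XY0(2)[of N] by (intro mult_left_mono) auto
    finally show ?thesis by simp
  qed
  have B4: "- (\<kappa> * ?c) \<le> (\<Sum>m\<in>?Q. LINT t:I m|lborel. kern P (T - t) * b (Z2 T) (Z2 t))"
  proof -
    \<comment> \<open>On the m-th interval K(T - t) integrates to h m - h (m - 1), and these
      differences telescope to at most \<kappa>.\<close>
    define h where "h m = mk.\<xi> (T - \<tau> m)" for m
    have "(\<Sum>m\<in>?Q. (h m - h (m - 1))) = h N - h q"
      using sum_telescope''[of q N h] q by simp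
    also have "\<dots> \<le> \<kappa>" using mk.\<xi>_nonneg[of "T - \<tau> q"] \<tau>_le[of q N] q by (simp add: h_def mk.\<xi>_zero)
    finally have "(\<Sum>m\<in>?Q. (h m - h (m - 1))) * ?c \<le> \<kappa> * ?c" using c0 by (rule mult_right_mono)
    then have "- (\<kappa> * ?c) \<le> (\<Sum>m\<in>?Q. - ((h m - h (m - 1)) * ?c))" unfolding sum_negf sum_distrib_right by simp
    also have "\<dots> \<le> (\<Sum>m\<in>?Q. LINT t:I m|lborel. kern P (T - t) * b (Z2 T) (Z2 t))"
    proof (rule sum_mono)
      fix m assume m: "m \<in> ?Q"
      have mT: "\<tau> m \<le> T" using m by (intro \<tau>_le) auto
      have le: "\<tau> (m - 1) \<le> \<tau> m" using step_less[OF Q[OF m]] by simp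
      have cont: "continuous_on {\<tau> (m - 1)..\<tau> m} (\<lambda>t. - ?c)" by (intro continuous_intros)
      have "(LINT t:I m|lborel. kern P (T - t) * (- ?c)) = (LINT t:{\<tau> (m - 1)..\<tau> m}|lborel. kern P (T - t) * (- ?c))"
        by (rule set_integral_cong_finite(1)[of "{\<tau> (m - 1), \<tau> m}"]) auto
      also have "\<dots> = mk.\<xi> (T - \<tau> m) * (- ?c) - mk.\<xi> (T - \<tau> (m - 1)) * (- ?c) - (LINT t:{\<tau> (m - 1)..\<tau> m}|lborel. mk.\<xi> (T - t) * 0)"
        by (rule mk.terminal_by_parts[OF le mT cont, of "\<lambda>_. 0" 0]) auto
      also have "\<dots> = - ((h m - h (m - 1)) * ?c)" by (simp add: h_def algebra_simps)
      finally have "- ((h m - h (m - 1)) * ?c) = (LINT t:I m|lborel. kern P (T - t) * (- ?c))" by simp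
      also have "\<dots> \<le> (LINT t:I m|lborel. kern P (T - t) * b (Z2 T) (Z2 t))"
      proof (rule set_integral_mono[OF _ K_integral(1)[OF Q[OF m]]])
        show "set_integrable lborel (I m) (\<lambda>t. kern P (T - t) * (- ?c))"
          by (rule set_integrable_subset[OF mk.K_reflect_integrable[OF cont mT]]) auto
        fix t assume t: "t \<in> I m"
        show "kern P (T - t) * (- ?c) \<le> kern P (T - t) * b (Z2 T) (Z2 t)"
          using bT[OF I_sub(1)[OF m t]] mk.K_nonneg[of "T - t"] t mT by (intro mult_left_mono) auto
      qed
      finally show "- ((h m - h (m - 1)) * ?c) \<le> (LINT t:I m|lborel. kern P (T - t) * b (Z2 T) (Z2 t))" .
    qed
    finally show ?thesis .
  qed
  have B5: "- (\<kappa> * ?c) \<le> mk.\<xi> (T - \<tau> q) * b (Z2 T) (Z2 (\<tau> q))"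
  proof -
    have qT: "\<tau> q \<le> T" using q by (intro \<tau>_le) auto
    have "mk.\<xi> (T - \<tau> q) * ?c \<le> \<kappa> * ?c" using mk.\<xi>_le[of "T - \<tau> q"] qT c0 by (intro mult_right_mono) auto
    then have "- (\<kappa> * ?c) \<le> mk.\<xi> (T - \<tau> q) * (- ?c)" by simp
    also have "\<dots> \<le> mk.\<xi> (T - \<tau> q) * b (Z2 T) (Z2 (\<tau> q))"
      using bT[of "\<tau> q"] qT mk.\<xi>_nonneg[of "T - \<tau> q"] by (intro mult_left_mono) auto
    finally show ?thesis .
  qed
  have B6: "0 \<le> (\<Sum>m\<in>?Q. LINT t:I m|lborel. rate_memory (d2 m) t)"
    using rate_memory_sum_nonneg[of q] q by (cases "q = N") auto
  define J where "J = (\<Sum>m\<in>?Q. S1 m) + (\<Sum>m\<in>?Q. S2 m)"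
  have J1: "0 \<le> (\<Sum>m\<in>?Q. S1 m)" "0 \<le> (\<Sum>m\<in>?Q. S2 m)" using SS Q by (auto intro!: sum_nonneg)
  have qN: "q \<le> N" using q by simp
  have "energy q \<le> (X N)\<^sup>2 + (1 + \<kappa>) * (Y N)\<^sup>2 + 2 * (M * (\<Sum>m\<in>?Q. S1 m)) + 2 * (M * (\<Sum>m\<in>?Q. S2 m))
      + 2 * (\<kappa> * (M * (\<Sum>m\<in>?Q. S2 m))) + 4 * (\<kappa> * ?c)"
    using energy_sum[OF qN] B1 B2 B3 B4 B5 B6 unfolding XY2[OF order_refl] mult.assoc by linarith
  \<comment> \<open>The largest coefficient is that of Y N: 1 + \<kappa> \<le> 2 from the square,
    and 4 \<kappa> \<le> 4 from the two terms containing Z2(T).\<close>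
  also have "\<dots> \<le> 6 * (M * (X N + Y N + J))"
  proof -
    have XN: "0 \<le> X N" "0 \<le> Y N" "X N \<le> M" "Y N \<le> M" using XY0[of N] node_le[of N] qN by auto
    have "(X N)\<^sup>2 \<le> M * X N" "(Y N)\<^sup>2 \<le> M * Y N"
      unfolding power2_eq_square using XN by (auto intro: mult_right_mono)
    moreover have "\<kappa> * (Y N)\<^sup>2 \<le> (Y N)\<^sup>2" "\<kappa> * (M * (\<Sum>m\<in>?Q. S2 m)) \<le> M * (\<Sum>m\<in>?Q. S2 m)" "\<kappa> * ?c \<le> ?c"
      using \<kappa>_bounds M0 J1 c0 by (auto intro!: mult_left_le_one_le)
    moreover have "0 \<le> M * (\<Sum>m\<in>?Q. S1 m)" "0 \<le> M * (\<Sum>m\<in>?Q. S2 m)" "0 \<le> M * X N" "0 \<le> M * Y N"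
      using M0 J1 XN by auto
    ultimately show ?thesis unfolding J_def distrib_left distrib_right mult_1 mult.commute[of "Y N" M] by linarith
  qed
  finally have E: "energy q \<le> 6 * (M * (X N + Y N + J))" .
  \<comment> \<open>The square of a sum costs a factor 2, hence 12 = 2 * 6 in the final constant.
    The weight 1 - \<kappa>, which the energy has on one of its squares, is put on both.\<close>
  have "(1 - \<kappa>) * M\<^sup>2 \<le> (1 - \<kappa>) * (2 * ((X q)\<^sup>2 + (Y q)\<^sup>2))"
  proof (intro mult_left_mono)
    show "M\<^sup>2 \<le> 2 * ((X q)\<^sup>2 + (Y q)\<^sup>2)"
      unfolding M_def using sum_squares_bound[of "X q" "Y q"] by (simp add: power2_sum)
  qed (use \<kappa>_bounds in auto)
  also have "\<dots> \<le> 2 * energy q"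
    unfolding energy_def XY2[OF qN, symmetric] using \<kappa>_bounds by (simp add: algebra_simps)
  finally have "(1 - \<kappa>) * M\<^sup>2 \<le> 12 * (M * (X N + Y N + J))" using E by linarith
  then have "M * ((1 - \<kappa>) * M) \<le> M * (12 * (X N + Y N + J))" by (simp add: power2_eq_square algebra_simps)
  \<comment> \<open>One factor M is cancelled; if M = 0, the right-hand side is nonnegative.\<close>
  then have "(1 - \<kappa>) * M \<le> 12 * (X N + Y N + J)"
    using M0 XY0[of N] J1 by (cases "M = 0") (auto simp: J_def)
  moreover have "J \<le> (\<Sum>m\<in>{n+1..N}. S1 m + S2 m)"
    unfolding J_def sum.distrib[symmetric] using SS q by (intro sum_mono2) (auto intro!: add_nonneg_nonneg)
  then have "12 * (X N + Y N + J) \<le> 12 * (X N + Y N + (\<Sum>m\<in>{n+1..N}. S1 m + S2 m))" by simp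
  ultimately have "(1 - \<kappa>) * M \<le> 12 * (X N + Y N + (\<Sum>m\<in>{n+1..N}. S1 m + S2 m))" by (rule order_trans)
  then have "M \<le> 12 / (1 - \<kappa>) * (X N + Y N + (\<Sum>m\<in>{n+1..N}. S1 m + S2 m))"
    using \<kappa>_bounds by (simp add: pos_le_divide_eq mult.commute)
  moreover have "X n + Y n \<le> M" using qmax[of n] n by (simp add: M_def)
  ultimately show ?thesis unfolding X_def Y_def S1_def S2_def by linarith
qed

subsection \<open>The identity in terms of the discrete operators\<close>

text \<open>The integrands of the theorem contain projections, discrete powers and time derivatives,
  which are identified with the forms s and b inside the intervals; the nodes are a null
  set.\<close>

lemma integral_pieces:
  assumes n: "n \<le> N" and eq: "\<And>m t. m \<in> {n+1..N} \<Longrightarrow> t \<in> I m \<Longrightarrow> F t = G m t"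
    and int: "\<And>m. m \<in> {n+1..N} \<Longrightarrow> set_integrable lborel (I m) (G m)"
  shows "(LINT t:{\<tau> n..T}|lborel. F t) = (\<Sum>m\<in>{n+1..N}. LINT t:I m|lborel. (G m t :: real))"
proof -
  have "(LINT t:{\<tau> n..T}|lborel. F t) = (\<Sum>m\<in>{n+1..N}. LINT t:I m|lborel. F t)"
  proof (rule split_integral[OF n order_refl, THEN conjunct2])
    fix m assume m: "m \<in> {n+1..N}"
    have "set_integrable lborel (I m) F \<longleftrightarrow> set_integrable lborel (I m) (G m)"
      by (intro set_integrable_cong refl eq m)
    with int[OF m] show "set_integrable lborel (I m) F" by simp
  qed
  also have "\<dots> = (\<Sum>m\<in>{n+1..N}. LINT t:I m|lborel. G m t)"
    using eq by (intro sum.cong refl set_lebesgue_integral_cong) auto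
  finally show ?thesis .
qed

lemma hnorm_node:
  assumes "n \<le> N"
  shows "hnorm P (\<tau> n) l (Z1 (\<tau> n)) = sqrt (s (Z1 (\<tau> n)) (Z1 (\<tau> n)))"
    and "hnorm P (\<tau> n) (l + 1) (Z2 (\<tau> n)) = sqrt (b (Z2 (\<tau> n)) (Z2 (\<tau> n)))"
  using hnorm_eq[OF tidx_node[OF assms] assms] pl_node[OF pl1 assms] pl_node[OF pl2 assms] by auto

lemma energy_identity:
  assumes n: "n \<le> N"
  shows "(hnorm P (\<tau> n) l (Z1 (\<tau> n)))\<^sup>2 + (1 - \<kappa>) * (hnorm P (\<tau> n) (l + 1) (Z2 (\<tau> n)))\<^sup>2
      + 2 * (LINT t:{\<tau> n..T}|lborel. LINT r:{t..T}|lborel.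
               xi P (r - t) * a (Ah_pow P t l (tderiv Z2 t)) (tderiv Z2 r))
    = (hnorm P T l (Z1 T))\<^sup>2 + (1 + \<kappa>) * (hnorm P T (l + 1) (Z2 T))\<^sup>2
      + 2 * (LINT t:{\<tau> n..T}|lborel. ip P (Ah_pow P t l (Z1 t)) (PkPh P j1 t))
      + 2 * (LINT t:{\<tau> n..T}|lborel. ip P (Ah_pow P t (l + 1) (Z2 t)) (PkPh P j2 t))
      - 2 * (LINT t:{\<tau> n..T}|lborel. LINT r:{t..T}|lborel.
               kern P (r - t) * a (Ah_pow P t l (PkPh P j2 t)) (Z2 r))
      - 2 * (LINT t:{\<tau> n..T}|lborel. kern P (T - t) * a (Ah_pow P t l (Z2 t)) (Z2 T))
      - 2 * xi P (T - \<tau> n) * a (Ah_pow P (\<tau> n) l (Z2 (\<tau> n))) (Z2 T)"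
proof -
  have M: "m \<in> {1..N}" "m \<le> N" if "m \<in> {n+1..N}" for m using that by auto
  have A: "Ah_pow P t l u = \<Lambda> u" if "m \<in> {n+1..N}" "t \<in> I m" "u \<in> V m" for m t u
    by (rule Ah_pow_\<Lambda>[OF tidx_I[OF M(1)[OF that(1)] that(2)] M(2)[OF that(1)] that(3)])
  have ZV: "Z1 t \<in> V m" "Z2 t \<in> V m" if "m \<in> {n+1..N}" "t \<in> I m" for m t
    using pl_mem[OF pl1 M(1)[OF that(1)], of t] pl_mem[OF pl2 M(1)[OF that(1)], of t] that(2) by auto
  have pV: "p1 m \<in> V m" "p2 m \<in> V m" "d2 m \<in> V m" if "m \<in> {n+1..N}" for m
    using load_mean_mem[OF data(3) M(1)[OF that]] load_mean_mem[OF data(4) M(1)[OF that]] slope_mem[OF pl2 M(1)[OF that]] by auto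
  have W: "p1 m \<in> W" "p2 m \<in> W" "d2 m \<in> W" if "m \<in> {n+1..N}" for m
    using mean_W[OF M(1)[OF that]] slope_W[OF M(1)[OF that]] by auto
  have tW: "Z1 t \<in> W" "Z2 t \<in> W" if "m \<in> {n+1..N}" "t \<in> I m" for m t
    using ZV[OF that] V_W[OF M(2)[OF that(1)]] by auto
  have I1: "(LINT t:{\<tau> n..T}|lborel. LINT r:{t..T}|lborel. xi P (r - t) * a (Ah_pow P t l (tderiv Z2 t)) (tderiv Z2 r))
      = (\<Sum>m\<in>{n+1..N}. LINT t:I m|lborel. rate_memory (d2 m) t)"
  proof (rule integral_pieces[OF n])
    fix m t assume m: "m \<in> {n+1..N}" and t: "t \<in> I m"
    have "0 \<le> \<tau> (m - 1)" by (rule \<tau>_nonneg) (use M(2)[OF m] in simp)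
    with t have "0 \<le> t" by simp
    show "(LINT r:{t..T}|lborel. xi P (r - t) * a (Ah_pow P t l (tderiv Z2 t)) (tderiv Z2 r)) = rate_memory (d2 m) t"
      unfolding rate_memory_def xi_eq tderiv_pl[OF pl2 M(1)[OF m] t] A[OF m t pV(3)[OF m]] b_def[symmetric]
    \<comment> \<open>\<open>tderiv Z2\<close> and \<open>rate\<close> agree away from the finitely
      many nodes.\<close>
    proof (rule set_integral_cong_finite(1)[of "\<tau> ` {..N}"])
      fix r assume r: "r \<in> {t..T}" "r \<notin> \<tau> ` {..N}"
      have "r \<in> (\<Union>k\<in>{0+1..N}. I k) \<union> \<tau> ` {..N}"
        by (rule subsetD[OF grid_cover]) (use r \<open>0 \<le> t\<close> in \<open>simp_all add: \<tau>_zero\<close>)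
      with r obtain k where k: "k \<in> {1..N}" "r \<in> I k" by auto
      show "mk.\<xi> (r - t) * b (d2 m) (tderiv Z2 r) = mk.\<xi> (r - t) * b (d2 m) (rate r)"
        unfolding tderiv_pl[OF pl2 k] rate_eq[OF k] ..
    qed auto
  next
    fix m assume m: "m \<in> {n+1..N}"
    show "set_integrable lborel (I m) (rate_memory (d2 m))" by (rule rate_memory_integrable[OF W(3)[OF m] M(1)[OF m]])
  qed
  have I2: "(LINT t:{\<tau> n..T}|lborel. ip P (Ah_pow P t l (Z1 t)) (PkPh P j1 t))
      = (\<Sum>m\<in>{n+1..N}. LINT t:I m|lborel. s (p1 m) (Z1 t))"
  proof (rule integral_pieces[OF n])
    fix m t assume m: "m \<in> {n+1..N}" and t: "t \<in> I m"
    show "ip P (Ah_pow P t l (Z1 t)) (PkPh P j1 t) = s (p1 m) (Z1 t)"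
      unfolding A[OF m t ZV(1)[OF m t]] PkPh_eq[OF M(1)[OF m] t] s_def[symmetric]
      by (rule s.form_sym[OF tW(1)[OF m t] W(1)[OF m]])
  next
    fix m assume m: "m \<in> {n+1..N}"
    show "set_integrable lborel (I m) (\<lambda>t. s (p1 m) (Z1 t))"
      by (rule form_pl_integrable[OF s.psd_form_axioms pl1 W(1)[OF m] M(1)[OF m]])
  qed
  have I3: "(LINT t:{\<tau> n..T}|lborel. ip P (Ah_pow P t (l + 1) (Z2 t)) (PkPh P j2 t))
      = (\<Sum>m\<in>{n+1..N}. LINT t:I m|lborel. b (p2 m) (Z2 t))"
  proof (rule integral_pieces[OF n])
    fix m t assume m: "m \<in> {n+1..N}" and t: "t \<in> I m"
    have "ip P (Ah_pow P t (l + 1) (Z2 t)) (PkPh P j2 t) = b (Z2 t) (p2 m)"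
      unfolding PkPh_eq[OF M(1)[OF m] t]
      by (rule Ah_pow_Suc[OF tidx_I[OF M(1)[OF m] t] M(2)[OF m] ZV(2)[OF m t] pV(2)[OF m]])
    then show "ip P (Ah_pow P t (l + 1) (Z2 t)) (PkPh P j2 t) = b (p2 m) (Z2 t)"
      using b.form_sym[OF tW(2)[OF m t] W(2)[OF m]] by simp
  next
    fix m assume m: "m \<in> {n+1..N}"
    show "set_integrable lborel (I m) (\<lambda>t. b (p2 m) (Z2 t))"
      by (rule form_pl_integrable[OF b.psd_form_axioms pl2 W(2)[OF m] M(1)[OF m]])
  qed
  have I4: "(LINT t:{\<tau> n..T}|lborel. LINT r:{t..T}|lborel. kern P (r - t) * a (Ah_pow P t l (PkPh P j2 t)) (Z2 r))
      = (\<Sum>m\<in>{n+1..N}. LINT t:I m|lborel. memory (p2 m) t)"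
  proof (rule integral_pieces[OF n])
    fix m t assume m: "m \<in> {n+1..N}" and t: "t \<in> I m"
    show "(LINT r:{t..T}|lborel. kern P (r - t) * a (Ah_pow P t l (PkPh P j2 t)) (Z2 r)) = memory (p2 m) t"
      unfolding PkPh_eq[OF M(1)[OF m] t] A[OF m t pV(2)[OF m]] b_def[symmetric] memory_def ..
  next
    fix m assume m: "m \<in> {n+1..N}"
    show "set_integrable lborel (I m) (memory (p2 m))" by (rule memory_integral(1)[OF W(2)[OF m] M(1)[OF m]])
  qed
  have I5: "(LINT t:{\<tau> n..T}|lborel. kern P (T - t) * a (Ah_pow P t l (Z2 t)) (Z2 T))
      = (\<Sum>m\<in>{n+1..N}. LINT t:I m|lborel. kern P (T - t) * b (Z2 T) (Z2 t))"
  proof (rule integral_pieces[OF n])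
    fix m t assume m: "m \<in> {n+1..N}" and t: "t \<in> I m"
    show "kern P (T - t) * a (Ah_pow P t l (Z2 t)) (Z2 T) = kern P (T - t) * b (Z2 T) (Z2 t)"
      unfolding A[OF m t ZV(2)[OF m t]] b_def[symmetric] using b.form_sym[OF tW(2)[OF m t] Z2_T_W] by simp
  next
    fix m assume m: "m \<in> {n+1..N}"
    show "set_integrable lborel (I m) (\<lambda>t. kern P (T - t) * b (Z2 T) (Z2 t))" by (rule K_integral(1)[OF M(1)[OF m]])
  qed
  have sq: "(hnorm P (\<tau> k) l (Z1 (\<tau> k)))\<^sup>2 = s (Z1 (\<tau> k)) (Z1 (\<tau> k))"
    "(hnorm P (\<tau> k) (l + 1) (Z2 (\<tau> k)))\<^sup>2 = b (Z2 (\<tau> k)) (Z2 (\<tau> k))" if k: "k \<le> N" for k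
    unfolding hnorm_node[OF k] using pl_node[OF pl1 k] pl_node[OF pl2 k] V_W[OF k]
    by (auto intro!: s.form_nonneg b.form_nonneg)
  have nW: "Z2 (\<tau> n) \<in> W" using pl_node[OF pl2 n] V_W[OF n] by auto
  have last: "a (Ah_pow P (\<tau> n) l (Z2 (\<tau> n))) (Z2 T) = b (Z2 T) (Z2 (\<tau> n))"
    unfolding Ah_pow_\<Lambda>[OF tidx_node[OF n] n pl_node[OF pl2 n]] b_def[symmetric]
    by (rule b.form_sym[OF nW Z2_T_W])
  show ?thesis
    unfolding I1 I2 I3 I4 I5 last sq[OF n] sq[OF order_refl] unfolding xi_eq
    by (rule energy_sum[OF n, unfolded energy_def])
qed

lemma stability_bound:
  assumes n: "n \<le> N"
  shows "hnorm P (\<tau> n) l (Z1 (\<tau> n)) + hnorm P (\<tau> n) (l + 1) (Z2 (\<tau> n))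
    \<le> 12 / (1 - \<kappa>) * (hnorm P T l (Z1 T) + hnorm P T (l + 1) (Z2 T)
        + (LINT t:{\<tau> n..T}|lborel. hnorm P t l (Ph P t (j1 t)) + hnorm P t (l + 1) (Ph P t (j2 t))))"
proof -
  define G where "G t = sqrt (s (Ph P t (j1 t)) (Ph P t (j1 t))) + sqrt (b (Ph P t (j2 t)) (Ph P t (j2 t)))" for t
  have int: "set_integrable lborel (I m) (\<lambda>t. sqrt (s (Ph P t (j1 t)) (Ph P t (j1 t))))"
    "set_integrable lborel (I m) (\<lambda>t. sqrt (b (Ph P t (j2 t)) (Ph P t (j2 t))))" if "m \<in> {1..N}" for m
    using load_norm_integrable[OF data(3) that s.psd_form_axioms] load_norm_integrable[OF data(4) that b.psd_form_axioms] by auto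
  have "(LINT t:{\<tau> n..T}|lborel. hnorm P t l (Ph P t (j1 t)) + hnorm P t (l + 1) (Ph P t (j2 t)))
      = (\<Sum>m\<in>{n+1..N}. LINT t:I m|lborel. G t)"
  proof (rule integral_pieces[OF n])
    fix m t assume "m \<in> {n+1..N}" and t: "t \<in> I m"
    then have m: "m \<in> {1..N}" "m \<le> N" by auto
    have t0: "t \<in> {0..T}" using I_subset[OF m(1)] t by blast
    have mem: "Ph P t (j1 t) \<in> V m" "Ph P t (j2 t) \<in> V m"
      using Ph_props(1)[OF tidx_I[OF m(1) t] m(2)] data(3,4) t0 by (auto simp: load_def)
    show "hnorm P t l (Ph P t (j1 t)) + hnorm P t (l + 1) (Ph P t (j2 t)) = G t"
      unfolding G_def using hnorm_eq[OF tidx_I[OF m(1) t] m(2)] mem by simp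
  next
    fix m assume "m \<in> {n+1..N}"
    then have m: "m \<in> {1..N}" by auto
    show "set_integrable lborel (I m) G" unfolding G_def by (rule set_integral_add(1)[OF int[OF m]])
  qed
  also have "\<dots> = (\<Sum>m\<in>{n+1..N}. (LINT t:I m|lborel. sqrt (s (Ph P t (j1 t)) (Ph P t (j1 t))))
          + (LINT t:I m|lborel. sqrt (b (Ph P t (j2 t)) (Ph P t (j2 t)))))"
  proof (intro sum.cong refl)
    fix m assume "m \<in> {n+1..N}"
    then have m: "m \<in> {1..N}" by auto
    show "(LINT t:I m|lborel. G t) = (LINT t:I m|lborel. sqrt (s (Ph P t (j1 t)) (Ph P t (j1 t))))
          + (LINT t:I m|lborel. sqrt (b (Ph P t (j2 t)) (Ph P t (j2 t))))"
      unfolding G_def by (rule set_integral_add(2)[OF int[OF m]])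
  qed
  finally show ?thesis
    using stability[OF n] unfolding hnorm_node[OF n] hnorm_node[OF order_refl] by simp
qed

end

theorem theorem4:
  fixes \<kappa> :: real
  shows "\<exists>C. \<forall>(P :: ('d::finite) cg_data) z1T z2T j1 j2 Z1 Z2 l.
    cg_setting \<kappa> P \<longrightarrow>
    (\<forall>n\<in>{1..nsteps P}. Vh P (n - 1) \<subseteq> Vh P n) \<longrightarrow>
    (l \<noteq> 0 \<longrightarrow> Ah_pow_well_defined P l) \<longrightarrow>
    z1T \<in> L2 (Omega P) \<longrightarrow> z2T \<in> L2 (Omega P) \<longrightarrow> load P j1 \<longrightarrow> load P j2 \<longrightarrow>
    (Z1, Z2) \<in> Uhk P \<longrightarrow>
    (\<forall>V \<in> Vhk P. Bstar P V (Z1, Z2) = Lstar P j1 j2 z1T z2T V) \<longrightarrow>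
    Z1 (tend P) = Ph P (tend P) z1T \<longrightarrow> Z2 (tend P) = Ph P (tend P) z2T \<longrightarrow>
    (\<forall>n<nsteps P. let T = tend P; tn = tnode P n; a = aform P; K = kern P in
      (hnorm P tn l (Z1 tn))\<^sup>2 + (1 - \<kappa>) * (hnorm P tn (l + 1) (Z2 tn))\<^sup>2
        + 2 * (LINT t:{tn..T}|lborel. LINT s:{t..T}|lborel.
                 xi P (s - t) * a (Ah_pow P t l (tderiv Z2 t)) (tderiv Z2 s))
      = (hnorm P T l (Z1 T))\<^sup>2 + (1 + \<kappa>) * (hnorm P T (l + 1) (Z2 T))\<^sup>2
        + 2 * (LINT t:{tn..T}|lborel. ip P (Ah_pow P t l (Z1 t)) (PkPh P j1 t))
        + 2 * (LINT t:{tn..T}|lborel. ip P (Ah_pow P t (l + 1) (Z2 t)) (PkPh P j2 t))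
        - 2 * (LINT t:{tn..T}|lborel. LINT s:{t..T}|lborel.
                 K (s - t) * a (Ah_pow P t l (PkPh P j2 t)) (Z2 s))
        - 2 * (LINT t:{tn..T}|lborel. K (T - t) * a (Ah_pow P t l (Z2 t)) (Z2 T))
        - 2 * xi P (T - tn) * a (Ah_pow P tn l (Z2 tn)) (Z2 T)
      \<and>
      hnorm P tn l (Z1 tn) + hnorm P tn (l + 1) (Z2 tn)
      \<le> C * (hnorm P T l (Z1 T) + hnorm P T (l + 1) (Z2 T)
             + (LINT t:{tn..T}|lborel.
                  hnorm P t l (Ph P t (j1 t)) + hnorm P t (l + 1) (Ph P t (j2 t)))))"
proof (rule exI[of _ "12 / (1 - \<kappa>)"], intro allI impI)
  fix P :: "'d cg_data" and z1T z2T j1 j2 Z1 Z2 l n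
  assume "cg_setting \<kappa> P" "\<forall>n\<in>{1..nsteps P}. Vh P (n - 1) \<subseteq> Vh P n" "l \<noteq> 0 \<longrightarrow> Ah_pow_well_defined P l"
    "z1T \<in> L2 (Omega P)" "z2T \<in> L2 (Omega P)" "load P j1" "load P j2" "(Z1, Z2) \<in> Uhk P"
    "\<forall>V \<in> Vhk P. Bstar P V (Z1, Z2) = Lstar P j1 j2 z1T z2T V"
    "Z1 (tend P) = Ph P (tend P) z1T" "Z2 (tend P) = Ph P (tend P) z2T"
  then interpret dual_solution \<kappa> P l z1T z2T j1 j2 Z1 Z2
    by unfold_locales
  assume "n < nsteps P"
  then have n: "n \<le> nsteps P" by simp
  show "let T = tend P; tn = tnode P n; a = aform P; K = kern P in
      (hnorm P tn l (Z1 tn))\<^sup>2 + (1 - \<kappa>) * (hnorm P tn (l + 1) (Z2 tn))\<^sup>2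
        + 2 * (LINT t:{tn..T}|lborel. LINT s:{t..T}|lborel.
                 xi P (s - t) * a (Ah_pow P t l (tderiv Z2 t)) (tderiv Z2 s))
      = (hnorm P T l (Z1 T))\<^sup>2 + (1 + \<kappa>) * (hnorm P T (l + 1) (Z2 T))\<^sup>2
        + 2 * (LINT t:{tn..T}|lborel. ip P (Ah_pow P t l (Z1 t)) (PkPh P j1 t))
        + 2 * (LINT t:{tn..T}|lborel. ip P (Ah_pow P t (l + 1) (Z2 t)) (PkPh P j2 t))
        - 2 * (LINT t:{tn..T}|lborel. LINT s:{t..T}|lborel.
                 K (s - t) * a (Ah_pow P t l (PkPh P j2 t)) (Z2 s))
        - 2 * (LINT t:{tn..T}|lborel. K (T - t) * a (Ah_pow P t l (Z2 t)) (Z2 T))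
        - 2 * xi P (T - tn) * a (Ah_pow P tn l (Z2 tn)) (Z2 T)
      \<and>
      hnorm P tn l (Z1 tn) + hnorm P tn (l + 1) (Z2 tn)
      \<le> 12 / (1 - \<kappa>) * (hnorm P T l (Z1 T) + hnorm P T (l + 1) (Z2 T)
             + (LINT t:{tn..T}|lborel.
                  hnorm P t l (Ph P t (j1 t)) + hnorm P t (l + 1) (Ph P t (j2 t))))"
    unfolding Let_def by (rule conjI[OF energy_identity[OF n] stability_bound[OF n]])
qed

end
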